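(* Let $\{\lambda_n\}_{n\ge1}$ be an admissible scale, let $r,s$ be nonnegative integers with $$\ell=\frac{s+1-r}{2}>0,$$ let $\alpha_j>0$ $(1\le j\le r)$ and $\beta_k>0$ $(1\le k\le s)$ be real numbers, and let $$\rho=\sum_{j=1}^r\alpha_j-\sum_{k=1}^s\beta_k-1.$$ For $v\in\mathbb{R}$ and each $n$ put $z=e^{2\pi v}$ and $q=e^{-\pi\lambda_n^{-1}}$. Then $${}_r\phi_s\left(\begin{array}{c}q^{\alpha_1},\dots,q^{\alpha_r}\\ q^{\beta_1},\dots,q^{\beta_s}\end{array}\Big|\,q,(-1)^{s+1-r}zq^{-\ell(4n-1)}\right)=\frac{\prod_{k=1}^s\Gamma(\beta_k)}{\prod_{j=1}^r\Gamma(\alpha_j)}\,\frac{\lambda_n^{\rho+\ell+1/2}}{\sqrt{\ell}\,2^{\ell}\pi^{\rho+2\ell}}\exp\left\{\frac{\pi\lambda_n}{\ell}\left(v+\frac{2n\ell}{\lambda_n}\right)^2+\frac{\ell\pi\lambda_n}{3}\right\}\left\{1+\mathcal{O}(\lambda_n^{-1})\right\}$$ and $${}_r\phi_s\left(\begin{array}{c}q^{\alpha_1},\dots,q^{\alpha_r}\\ q^{\beta_1},\dots,q^{\beta_s}\end{array}\Big|\,q,(-1)^{s-r}zq^{-\ell(4n-1)}\right)=\frac{\prod_{k=1}^s\Gamma(\beta_k)}{\prod_{j=1}^r\Gamma(\alpha_j)}\,\frac{\lambda_n^{\rho+\ell+1/2}}{\sqrt{\ell}\,2^{\ell-1}\pi^{\rho+2\ell}}\exp\left\{\frac{\pi\lambda_n}{\ell}\left(v+\frac{2n\ell}{\lambda_n}\right)^2+\frac{\ell\pi\lambda_n}{3}-\frac{\pi\lambda_n}{4\ell}\right\}\left\{\cos\frac{\pi\lambda_nv}{\ell}+\mathcal{O}(\lambda_n^{-1})\right\}$$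 as $n\to\infty$, where the $\mathcal{O}$-terms are uniform for $v$ in any compact subset of $\mathbb{R}$.
   Context: An admissible scale is a sequence $\{\lambda_n\}_{n=1}^\infty$ of positive numbers with $\lim_{n\to\infty}\lambda_n/\log n=\infty$ and $\lim_{n\to\infty}n/\lambda_n^2=\infty$. For $0<q<1$, $(x;q)_\infty=\prod_{k=0}^\infty(1-xq^k)$, $(x;q)_k=(x;q)_\infty/(xq^k;q)_\infty$, and $(x_1,\dots,x_m;q)_k=\prod_{j=1}^m(x_j;q)_k$. With $\ell=(s+1-r)/2$, the basic hypergeometric series is $${}_r\phi_s\left(\begin{array}{c}a_1,\dots,a_r\\ b_1,\dots,b_s\end{array}\Big|\,q,w\right)=\sum_{k=0}^\infty\frac{(a_1,\dots,a_r;q)_k\,(wq^{-\ell})^kq^{\ell k^2}}{(q,b_1,\dots,b_s;q)_k\,(-1)^{k(s+1-r)}}.$$ $\Gamma$ is Euler's Gamma function. Note that $q$ depends on $n$. Uniformity on compacts means: for each compact $K\subset\mathbb{R}$ there are $C,N$ such that the error term is bounded in absolute value by $C$ times the indicated quantity for all $n\ge N$ and $v\in K$. *)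

theory Defs
  imports "HOL-Analysis.Analysis"
begin

definition admissible_scale :: "(nat \<Rightarrow> real) \<Rightarrow> bool" where
  "admissible_scale l \<longleftrightarrow>
     (\<forall>n\<ge>1. l n > 0) \<and>
     filterlim (\<lambda>n. l n / ln (real n)) at_top sequentially \<and>
     filterlim (\<lambda>n. real n / (l n)\<^sup>2) at_top sequentially"

definition qpochhammer_inf :: "'a::{real_normed_field,banach} \<Rightarrow> real \<Rightarrow> 'a" where
  "qpochhammer_inf x q = (\<Prod>k. 1 - x * of_real q ^ k)"

text \<open>
  The finite symbol as a quotient of infinite ones, meaningful for \<open>0 < q < 1\<close> as long as
  the infinite product in the denominator does not vanish (in particular for \<open>\<bar>x\<bar> < 1\<close>).
  If it does vanish, the quotient is \<open>0\<close> by the convention for division by zero.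
\<close>

definition qpochhammer :: "'a::{real_normed_field,banach} \<Rightarrow> real \<Rightarrow> nat \<Rightarrow> 'a" where
  "qpochhammer x q k = qpochhammer_inf x q / qpochhammer_inf (x * of_real q ^ k) q"

text \<open>
  The parameters are \<open>a 1, \<dots>, a r\<close> and \<open>b 1, \<dots>, b s\<close>; other values of \<open>a\<close> and \<open>b\<close> are irrelevant.
  Since \<open>s + 1 - r\<close> may be negative in general, it is formed in the integers.
\<close>

definition basic_hypergeometric ::
  "nat \<Rightarrow> nat \<Rightarrow> (nat \<Rightarrow> 'a) \<Rightarrow> (nat \<Rightarrow> 'a) \<Rightarrow> real \<Rightarrow> 'a \<Rightarrow> 'a::{real_normed_field,banach}" where
  "basic_hypergeometric r s a b q w =
     (let l = (real s + 1 - real r) / 2 in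
      \<Sum>k. ((\<Prod>j=1..r. qpochhammer (a j) q k)
               * (w * of_real (q powr (- l))) ^ k * of_real (q powr (l * real k ^ 2)))
           / (qpochhammer (of_real q) q k * (\<Prod>j=1..s. qpochhammer (b j) q k)
               * (- 1) powi (int k * (int s + 1 - int r))))"

text \<open>\<open>E n v = O(g n)\<close> as \<open>n \<rightarrow> \<infinity>\<close>, uniformly for \<open>v\<close> in compact sets of reals.\<close>

definition bigo_unif_on_compacts :: "(nat \<Rightarrow> real \<Rightarrow> real) \<Rightarrow> (nat \<Rightarrow> real) \<Rightarrow> bool" where
  "bigo_unif_on_compacts E g \<longleftrightarrow>
     (\<forall>K. compact K \<longrightarrow> (\<exists>C N. \<forall>n\<ge>N. \<forall>v\<in>K. \<bar>E n v\<bar> \<le> C * g n))"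

end

theory Submission
  imports Defs "HOL-Probability.Characteristic_Functions" "HOL-Real_Asymp.Real_Asymp"
begin

text \<open>
  Write \<open>q = exp (- e)\<close> with \<open>e = \<pi> / \<lambda>\<close>. Each finite symbol \<open>(a; q)\<^sub>k\<close> is the quotient of
  \<open>(a; q)\<^sub>\<infinity>\<close> and \<open>(a q\<^sup>k; q)\<^sub>\<infinity>\<close>, so the series is a constant times a sum of Gaussian weights
  centred at \<open>2 n + \<lambda> v / l\<close>, with coefficients that tend to \<open>1\<close> extremely fast for \<open>k \<ge> n\<close>.
  The terms with \<open>k < n\<close>, as well as the missing terms with \<open>k < 0\<close>, are negligible because
  \<open>n / \<lambda>\<^sup>2 \<rightarrow> \<infinity>\<close>. The remaining full Gaussian sum, plain or alternating, is evaluated by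
  Poisson summation up to an exponentially small relative error.

  The constant is governed by \<open>(q\<^sup>a; q)\<^sub>\<infinity>\<close>. Comparison of the product with Euler's limit formula for
  \<open>\<Gamma>(a)\<close> gives \<open>(q; q)\<^sub>\<infinity> / (q\<^sup>a; q)\<^sub>\<infinity> = \<Gamma>(a) e\<^bsup>a - 1\<^esup> (1 + O(e))\<close>. The case \<open>a = 1/2\<close> turns into a
  duplication relation between \<open>(q; q)\<^sub>\<infinity>\<close> at \<open>e\<close> and at \<open>2 e\<close>, which together with
  \<open>e ln (q; q)\<^sub>\<infinity> \<rightarrow> - \<pi>\<^sup>2 / 6\<close> determines \<open>(q; q)\<^sub>\<infinity>\<close> up to a factor \<open>1 + O(e)\<close>.
\<close>

section \<open>Infinite q-shifted factorials\<close>

text \<open>The alternating sum is itself exponentially small: its main term carries exp (- pi / (4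
  t)) with t = l / \<lambda>. Every error must therefore survive multiplication by exp (pi \<lambda>
  / (4 l)). From k = n on the coefficients miss 1 by a multiple of q^n / (1 - q), and q^n = exp (-
  pi n / \<lambda>) beats that factor because n eventually exceeds (1 / (4 l) + 1) \<lambda>^2.
  Below n only a bound exp (K \<lambda>) is available for the coefficients, but the distance to the
  centre gains at least exp (- pi l \<lambda>^3 / 8). For the remainder R in the expansion of ln (q;
  q)_\<infinity>, duplication reads R(e) = 2 R(2 e) + O(e). This recursion tolerates solutions of
  size 1 / e, such as c / e; the limit - pi^2 / 6, obtained independently from a Lambert series,
  excludes them. The errors linear in e come from the convexity of ln ((1 - exp (- x)) / x).\<close>

lemma qpochhammer_inf_has_prod:
  fixes x q :: real
  assumes "0 < q" "q < 1"
  shows "(\<lambda>k. 1 - x * q ^ k) has_prod qpochhammer_inf x q"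
proof -
  have "summable (\<lambda>i. norm ((1 - x * q ^ i) - 1))"
    using assms by (simp add: abs_mult summable_mult summable_geometric)
  then have "convergent_prod (\<lambda>i. 1 - x * q ^ i)"
    by (intro abs_convergent_prod_imp_convergent_prod summable_imp_abs_convergent_prod)
  then show ?thesis
    unfolding qpochhammer_inf_def by (simp add: convergent_prod_has_prod_iff)
qed

lemma qpochhammer_inf_LIMSEQ:
  fixes x q :: real
  assumes "0 < q" "q < 1"
  shows "(\<lambda>n. \<Prod>k<n. 1 - x * q ^ k) \<longlonglongrightarrow> qpochhammer_inf x q"
  using has_prod_imp_tendsto'[OF qpochhammer_inf_has_prod[OF assms]] .

lemma mult_power_less_one:
  fixes x q :: real
  assumes "0 < q" "q < 1" "0 \<le> x" "x < 1"
  shows "x * q ^ k < 1"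
proof -
  have "x * q ^ k \<le> x" using assms by (intro mult_left_le) (auto simp: power_le_one)
  then show ?thesis using assms by simp
qed

lemma qpochhammer_inf_le_1:
  fixes x q :: real
  assumes "0 < q" "q < 1" "0 \<le> x" "x < 1"
  shows "qpochhammer_inf x q \<le> 1"
proof (rule LIMSEQ_le_const2[OF qpochhammer_inf_LIMSEQ[OF assms(1,2), of x]])
  have "(\<Prod>k<n. 1 - x * q ^ k) \<le> 1" for n
    using assms by (intro prod_le_1) (auto intro: less_imp_le mult_power_less_one)
  then show "\<exists>N. \<forall>n\<ge>N. (\<Prod>k<n. 1 - x * q ^ k) \<le> 1" by blast
qed

lemma qpochhammer_inf_pos:
  fixes x q :: real
  assumes "0 < q" "q < 1" "0 \<le> x" "x < 1"
  shows "qpochhammer_inf x q > 0"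
proof -
  have pos: "0 < 1 - x * q ^ k" for k
    using mult_power_less_one[OF assms] by simp
  have "qpochhammer_inf x q \<noteq> 0"
  proof
    assume "qpochhammer_inf x q = 0"
    then obtain k where "1 - x * q ^ k = 0"
      using has_prod_eq_0_iff[OF qpochhammer_inf_has_prod[OF assms(1,2), of x]] by auto
    with pos[of k] show False by simp
  qed
  moreover have "qpochhammer_inf x q \<ge> 0"
    by (rule LIMSEQ_le_const[OF qpochhammer_inf_LIMSEQ[OF assms(1,2)]])
       (intro exI allI impI prod_nonneg ballI less_imp_le pos)
  ultimately show ?thesis by simp
qed

lemma qpochhammer_inf_antimono:
  fixes x y q :: real
  assumes "0 < q" "q < 1" "x \<le> y" "y < 1" "0 \<le> x"
  shows "qpochhammer_inf y q \<le> qpochhammer_inf x q"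
proof (rule LIMSEQ_le[OF qpochhammer_inf_LIMSEQ qpochhammer_inf_LIMSEQ])
  have "(\<Prod>k<n. 1 - y * q ^ k) \<le> (\<Prod>k<n. 1 - x * q ^ k)" for n
    using assms mult_power_less_one[of q y]
    by (intro prod_mono) (auto intro: less_imp_le mult_right_mono)
  then show "\<exists>N. \<forall>n\<ge>N. (\<Prod>k<n. 1 - y * q ^ k) \<le> (\<Prod>k<n. 1 - x * q ^ k)" by blast
qed (use assms in auto)

text \<open>Weierstrass' product inequality with a geometric series. Together with
  \<open>qpochhammer_inf_le_1\<close> it measures how close (a q^k; q)_\<infinity> is to 1.\<close>

lemma qpochhammer_inf_ge:
  fixes x q :: real
  assumes "0 < q" "q < 1" "0 \<le> x" "x < 1"
  shows "1 - x / (1 - q) \<le> qpochhammer_inf x q"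
proof (rule LIMSEQ_le_const[OF qpochhammer_inf_LIMSEQ[OF assms(1,2)]])
  have "1 - x / (1 - q) \<le> (\<Prod>k<n. 1 - x * q ^ k)" for n
  proof -
    have "1 - (\<Sum>k<n. x * q ^ k) \<le> (\<Prod>k<n. 1 - x * q ^ k)"
      using assms mult_power_less_one[OF assms]
      by (intro Weierstrass_prod_ineq) (auto intro: less_imp_le)
    moreover have "(\<Sum>k<n. x * q ^ k) \<le> x / (1 - q)"
    proof -
      have "(\<Sum>k<n. x * q ^ k) = x * ((1 - q ^ n) / (1 - q))"
        using assms by (simp add: sum_distrib_left[symmetric] sum_gp_strict)
      also have "\<dots> \<le> x * (1 / (1 - q))"
        using assms by (intro mult_left_mono divide_right_mono) auto
      finally show ?thesis by simp
    qed
    ultimately show ?thesis by linarith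
  qed
  then show "\<exists>N. \<forall>n\<ge>N. 1 - x / (1 - q) \<le> (\<Prod>k<n. 1 - x * q ^ k)" by blast
qed

text \<open>With q = exp (- e) this is ln (q^a; q)_\<infinity>. On the logarithmic scale a factor 1
  + O(e) becomes an additive error \<open>C * e\<close>, which can be summed over the
  parameters.\<close>

definition ln_qpochhammer :: "real \<Rightarrow> real \<Rightarrow> real" where
  "ln_qpochhammer a e = ln (qpochhammer_inf (exp (- e * a)) (exp (- e)))"

lemma ln_qpochhammer_sums:
  assumes "a > 0" "e > 0"
  shows "(\<lambda>k. ln (1 - exp (- (e * (real k + a))))) sums ln_qpochhammer a e"
proof -
  have "(\<lambda>k. ln (1 - exp (- e * a) * exp (- e) ^ k)) sums ln_qpochhammer a e"
    unfolding ln_qpochhammer_def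
    using assms by (intro has_prod_imp_sums_ln_real' qpochhammer_inf_has_prod)
      (auto intro!: mult_power_less_one)
  moreover have "exp (- e * a) * exp (- e) ^ k = exp (- (e * (real k + a)))" for k
    by (simp add: exp_of_nat_mult[symmetric] exp_add[symmetric] algebra_simps)
  ultimately show ?thesis by simp
qed

lemma exp_ln_qpochhammer:
  assumes "a > 0" "e > 0"
  shows "exp (ln_qpochhammer a e) = qpochhammer_inf (exp (- e * a)) (exp (- e))"
  unfolding ln_qpochhammer_def using assms by (intro exp_ln qpochhammer_inf_pos) auto

section \<open>Comparison with the Gamma function\<close>

text \<open>The factor 1 - q^(k + a) is e (k + a) times the exponential of
  \<open>ln_ratio (e * (k + a))\<close>. The linear factor belongs to Euler's formula for Gamma, and
  \<open>ln_ratio\<close> is the logarithm of the correction.\<close>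

definition ln_ratio :: "real \<Rightarrow> real" where
  "ln_ratio x = ln ((1 - exp (- x)) / x)"

lemma ln_ratio_deriv:
  assumes "x > 0"
  shows "(ln_ratio has_real_derivative (1 / (exp x - 1) - 1 / x)) (at x)"
proof -
  have "((\<lambda>x. ln (1 - exp (- x)) - ln x) has_real_derivative (exp (- x) / (1 - exp (- x)) - 1 / x)) (at x)"
    using assms by (auto intro!: derivative_eq_intros simp: divide_simps)
  also have "exp (- x) / (1 - exp (- x)) = 1 / (exp x - 1)"
    using assms by (simp add: exp_minus field_simps)
  finally show ?thesis
  proof (rule DERIV_cong_ev[THEN iffD1, rotated -1])
    show "\<forall>\<^sub>F x in nhds x. ln (1 - exp (- x)) - ln x = ln_ratio x"
      using eventually_nhds_in_open[of "{0<..}" x] assms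
      by (auto elim!: eventually_mono simp: ln_ratio_def ln_div)
  qed auto
qed

text \<open>This is x \<le> 2 sinh (x / 2), multiplied by exp (x / 2). It yields the lower bound for
  \<open>ln_ratio\<close> and, after squaring, its convexity.\<close>

lemma mult_exp_half_le: 
  assumes "x \<ge> (0::real)"
  shows "x * exp (x / 2) \<le> exp x - 1"
proof -
  let ?g = "\<lambda>x::real. exp (x/2) - exp (-x/2) - x"
  have "?g 0 \<le> ?g x"
  proof (rule DERIV_nonneg_imp_nondecreasing[OF assms])
    fix y :: real
    have "(?g has_real_derivative (exp (y/2) * (1/2) - exp (-y/2) * (-1/2) - 1)) (at y)"
      by (auto intro!: derivative_eq_intros)
    moreover have "exp (y/2) * (1/2) - exp (-y/2) * (-1/2) - 1 \<ge> 0"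
    proof -
      have "(exp (y/4) - exp (-y/4))\<^sup>2 \<ge> 0" by simp
      also have "(exp (y/4) - exp (-y/4))\<^sup>2 = exp (y/2) + exp (-y/2) - 2"
        by (simp add: algebra_simps power2_eq_square mult_exp_exp)
      finally show ?thesis by simp
    qed
    ultimately show "\<exists>z. (?g has_real_derivative z) (at y) \<and> z \<ge> 0" by blast
  qed
  then have "exp (-x/2) + x \<le> exp (x/2)" by simp
  then have "(exp (-x/2) + x) * exp (x/2) \<le> exp (x/2) * exp (x/2)" by (intro mult_right_mono) auto
  then show ?thesis by (simp add: algebra_simps exp_add[symmetric])
qed

lemma ln_ratio_bounds:
  assumes "x > 0"
  shows "ln_ratio x \<le> 0" "- x / 2 \<le> ln_ratio x"
proof -
  have p: "1 - exp (- x) > 0" using assms by simp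
  have "1 - exp (- x) \<le> x" using exp_ge_add_one_self[of "-x"] by linarith
  then show "ln_ratio x \<le> 0" using assms p unfolding ln_ratio_def by (subst ln_le_zero_iff) auto
  have "x * exp (x/2) * exp (-x) \<le> (exp x - 1) * exp (-x)"
    using mult_exp_half_le[of x] assms by (intro mult_right_mono) auto
  then have "x * exp (- x/2) \<le> 1 - exp (- x)"
    by (simp add: algebra_simps exp_add[symmetric] mult.assoc)
  then have "exp (- x/2) \<le> (1 - exp (- x)) / x" using assms by (simp add: field_simps)
  then have "ln (exp (- x/2)) \<le> ln_ratio x" unfolding ln_ratio_def using p assms
    by (intro ln_mono) auto
  then show "- x / 2 \<le> ln_ratio x" by simp
qed

lemma ln_ratio_deriv_bounds:
  assumes "x > (0::real)"
  shows "1 / (exp x - 1) - 1 / x \<le> 0" "- 1 / 2 \<le> 1 / (exp x - 1) - 1 / x"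
proof -
  have p: "exp x - 1 > 0" using assms by simp
  have "x \<le> exp x - 1" using exp_ge_add_one_self[of x] by linarith
  then show "1 / (exp x - 1) - 1 / x \<le> 0" using assms by (simp add: frac_le)
  \<comment> \<open>With the denominators cleared, the lower bound says exp x * (2 - x) \<le> 2 +
    x.\<close>
  let ?g = "\<lambda>x::real. 2 + x - exp x * (2 - x)"
  have "?g 0 \<le> ?g x"
  proof (rule DERIV_nonneg_imp_nondecreasing[where f = ?g])
    fix y :: real
    have "(?g has_real_derivative (1 - exp y * (1 - y))) (at y)"
      by (auto intro!: derivative_eq_intros simp: algebra_simps)
    moreover have "1 - exp y * (1 - y) \<ge> 0"
    proof -
      have "exp y * (1 - y) \<le> exp y * exp (- y)" 
        using exp_ge_add_one_self[of "-y"] by (intro mult_left_mono) auto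
      then show ?thesis by (simp add: exp_minus)
    qed
    ultimately show "\<exists>z. (?g has_real_derivative z) (at y) \<and> z \<ge> 0" by blast
  qed (use assms in auto)
  then show "- 1 / 2 \<le> 1 / (exp x - 1) - 1 / x"
    using p assms by (simp add: field_simps)
qed

text \<open>Convexity of \<open>ln_ratio\<close>: its second derivative 1 / w^2 - exp w / (exp w -
  1)^2 is nonnegative by the square of \<open>mult_exp_half_le\<close>.\<close>

lemma ln_ratio_deriv_mono:
  assumes "0 < x" "x \<le> (y::real)"
  shows "1 / (exp x - 1) - 1 / x \<le> 1 / (exp y - 1) - 1 / y"
proof (rule DERIV_nonneg_imp_nondecreasing[OF assms(2)])
  fix w assume w: "x \<le> w" "w \<le> y"
  then have p: "w > 0" "exp w - 1 > 0" using assms by auto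
  have "((\<lambda>x. 1 / (exp x - 1) - 1 / x) has_real_derivative (1 / w\<^sup>2 - exp w / (exp w - 1)\<^sup>2)) (at w)"
    using p by (auto intro!: derivative_eq_intros simp: power2_eq_square)
  moreover have "exp w / (exp w - 1)\<^sup>2 \<le> 1 / w\<^sup>2"
  proof -
    have "(w * exp (w/2))\<^sup>2 \<le> (exp w - 1)\<^sup>2" using mult_exp_half_le[of w] p by (intro power_mono) auto
    moreover have "exp (w/2) ^ 2 = exp w" by (simp add: exp_double[symmetric])
    ultimately show ?thesis using p by (simp add: power_mult_distrib field_simps)
  qed
  ultimately show "\<exists>z. ((\<lambda>x. 1 / (exp x - 1) - 1 / x) has_real_derivative z) (at w) \<and> z \<ge> 0"
    by (metis diff_ge_0_iff_ge)
qed

lemma ln_ratio_diff: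
  assumes "0 < x" "x \<le> y"
  shows "ln_ratio y - ln_ratio x \<le> (y - x) * (1 / (exp y - 1) - 1 / y)"
        "(y - x) * (1 / (exp x - 1) - 1 / x) \<le> ln_ratio y - ln_ratio x"
proof -
  have "\<exists>w. x \<le> w \<and> w \<le> y \<and> ln_ratio y - ln_ratio x = (y - x) * (1 / (exp w - 1) - 1 / w)"
  proof (cases "x = y")
    case False
    then have "x < y" using assms by simp
    then show ?thesis using MVT2[of x y ln_ratio "\<lambda>w. 1 / (exp w - 1) - 1 / w"] ln_ratio_deriv assms
      by (metis less_imp_le order.strict_trans2)
  qed auto
  then obtain w where w: "x \<le> w" "w \<le> y" "ln_ratio y - ln_ratio x = (y - x) * (1 / (exp w - 1) - 1 / w)" by blast
  show "ln_ratio y - ln_ratio x \<le> (y - x) * (1 / (exp y - 1) - 1 / y)"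
    unfolding w(3) using w assms by (intro mult_left_mono ln_ratio_deriv_mono) auto
  show "(y - x) * (1 / (exp x - 1) - 1 / x) \<le> ln_ratio y - ln_ratio x"
    unfolding w(3) using w assms by (intro mult_left_mono ln_ratio_deriv_mono) auto
qed

text \<open>
  By convexity of \<^const>\<open>ln_ratio\<close>, the increments in \<open>n\<close> lie between a telescoping sum of derivative
  values, all of them in \<open>[- 1/2, 0]\<close>, and \<open>0\<close>.
\<close>

lemma ln_ratio_sum_bound:
  assumes a: "a > 0"
  shows "\<exists>C\<ge>0. \<forall>e>0. \<forall>n.
    \<bar>(\<Sum>k<Suc n. ln_ratio (e * (real k + 1))) + a * ln_ratio (e * (real n + 1)) - (\<Sum>k<Suc (Suc n). ln_ratio (e * (real k + a)))\<bar> \<le> C * e"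
proof -
  \<comment> \<open>An integer above a: by monotonicity the derivative at n + 2 + a is at most the
    one at the integer shift n + p + 2, and differences of the latter kind telescope.\<close>
  define p where "p = nat \<lceil>a\<rceil>"
  have p: "a \<le> real p" unfolding p_def by linarith
  define d where "d = (\<lambda>x::real. 1 / (exp x - 1) - 1 / x)"
  \<comment> \<open>1 + 2 a controls S 0, and a (p + 1) / 2 is what the telescoping lower bound can
    lose.\<close>
  define C where "C = (1 + 2 * a) + a * (real p + 1) / 2"
  have C: "C \<ge> 0" unfolding C_def using a by auto
  have "\<bar>(\<Sum>k<Suc n. ln_ratio (e * (real k + 1))) + a * ln_ratio (e * (real n + 1)) - (\<Sum>k<Suc (Suc n). ln_ratio (e * (real k + a)))\<bar> \<le> C * e"
    if e: "e > 0" for e n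
  proof -
    \<comment> \<open>The corrections belonging to \<open>Gamma_series a (Suc n)\<close>: n + 1
      factors of the factorial, the power (n + 1)^a, and n + 2 factors of the denominator.\<close>
    define S where "S = (\<lambda>n. (\<Sum>k<Suc n. ln_ratio (e * (real k + 1))) + a * ln_ratio (e * (real n + 1)) - (\<Sum>k<Suc (Suc n). ln_ratio (e * (real k + a))))"
    \<comment> \<open>A sliding window of p + 1 derivative values: moving it by one changes V only
      by its two end values.\<close>
    define V where "V = (\<lambda>n. \<Sum>i<Suc p. d (e * (real n + real i + 1)))"
    have Vnp: "V n \<le> 0" for n
      unfolding V_def d_def using e
      by (intro sum_nonpos ln_ratio_deriv_bounds) (auto intro!: mult_pos_pos)
    have V0: "V 0 \<ge> - (real p + 1) / 2"
    proof -
      have "(\<Sum>i<Suc p. - 1 / 2) \<le> V 0"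
        unfolding V_def d_def using e by (intro sum_mono ln_ratio_deriv_bounds(2)) (auto intro!: mult_pos_pos)
      then show ?thesis by (simp add: field_simps)
    qed
    have Vd: "V n - V (Suc n) = d (e * (real n + 1)) - d (e * (real n + real p + 2))" for n
    proof -
      have "V n = d (e * (real n + 1)) + (\<Sum>i<p. d (e * (real n + real (Suc i) + 1)))"
        unfolding V_def by (subst sum.lessThan_Suc_shift) simp
      moreover have "V (Suc n) = (\<Sum>i<p. d (e * (real n + real (Suc i) + 1))) + d (e * (real n + real p + 2))"
        unfolding V_def by (simp add: algebra_simps)
      ultimately show ?thesis by simp
    qed
    have Sd: "S (Suc n) - S n = a * (ln_ratio (e * (real n + 2)) - ln_ratio (e * (real n + 1)))
        - (ln_ratio (e * (real n + 2 + a)) - ln_ratio (e * (real n + 2)))" for n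
      unfolding S_def by (simp add: algebra_simps)
    \<comment> \<open>By convexity the slope over the step from n + 1 to n + 2 is at most d at n +
      2, and the slope over the following step of length a is at least that. The two enter with
      equal weight and opposite sign.\<close>
    have up: "S (Suc n) \<le> S n" for n
    proof -
      have "ln_ratio (e * (real n + 2)) - ln_ratio (e * (real n + 1)) \<le> (e * (real n + 2) - e * (real n + 1)) * d (e * (real n + 2))"
        unfolding d_def using e by (intro ln_ratio_diff) auto
      moreover have "(e * (real n + 2 + a) - e * (real n + 2)) * d (e * (real n + 2)) \<le> ln_ratio (e * (real n + 2 + a)) - ln_ratio (e * (real n + 2))"
        unfolding d_def using e a by (intro ln_ratio_diff) auto
      ultimately have 1: "ln_ratio (e * (real n + 2)) - ln_ratio (e * (real n + 1)) \<le> e * d (e * (real n + 2))"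
        "a * (e * d (e * (real n + 2))) \<le> ln_ratio (e * (real n + 2 + a)) - ln_ratio (e * (real n + 2))"
        by (simp_all add: algebra_simps)
      from mult_left_mono[OF 1(1), of a] 1(2) a show ?thesis using Sd[of n] by linarith
    qed
    \<comment> \<open>The same slopes estimated at their outer ends instead of the common point n +
      2; the loss is exactly one shift of the window.\<close>
    have low: "S (Suc n) - S n \<ge> e * a * (V n - V (Suc n))" for n
    proof -
      have 1: "(e * (real n + 2) - e * (real n + 1)) * d (e * (real n + 1)) \<le> ln_ratio (e * (real n + 2)) - ln_ratio (e * (real n + 1))"
        unfolding d_def using e by (intro ln_ratio_diff) auto
      have 2: "ln_ratio (e * (real n + 2 + a)) - ln_ratio (e * (real n + 2)) \<le> (e * (real n + 2 + a) - e * (real n + 2)) * d (e * (real n + 2 + a))"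
        unfolding d_def using e a by (intro ln_ratio_diff) auto
      have 3: "d (e * (real n + 2 + a)) \<le> d (e * (real n + real p + 2))"
        unfolding d_def using e a p by (intro ln_ratio_deriv_mono) auto
      have "a * (e * d (e * (real n + 1))) \<le> a * (ln_ratio (e * (real n + 2)) - ln_ratio (e * (real n + 1)))"
        using 1 a by (intro mult_left_mono) (auto simp: algebra_simps)
      moreover have "ln_ratio (e * (real n + 2 + a)) - ln_ratio (e * (real n + 2)) \<le> e * a * d (e * (real n + real p + 2))"
      proof -
        have "e * a * d (e * (real n + 2 + a)) \<le> e * a * d (e * (real n + real p + 2))"
          using 3 a e by (intro mult_left_mono) auto
        then show ?thesis using 2 by (simp add: algebra_simps)
      qed
      ultimately show ?thesis using Sd[of n] unfolding Vd by (simp add: algebra_simps)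
    qed
    have up': "S n \<le> S 0" for n by (induction n) (use up order_trans in blast)+
    have low': "S n \<ge> S 0 + e * a * (V 0 - V n)" for n
    proof (induction n)
      case (Suc n)
      then show ?case using low[of n] by (simp add: algebra_simps)
    qed auto
    have S0: "\<bar>S 0\<bar> \<le> (1 + 2 * a) * e"
    proof -
      have eq: "S 0 = ln_ratio e + a * ln_ratio e - ln_ratio (e * a) - ln_ratio (e * (1 + a))" unfolding S_def by simp
      have b: "\<bar>ln_ratio x\<bar> \<le> x / 2" if "x > 0" for x using ln_ratio_bounds[OF that] by auto
      define w where "w = a * e"
      have w: "w > 0" unfolding w_def using a e by simp
      have "a * \<bar>ln_ratio e\<bar> \<le> a * (e / 2)" using b[OF e] a by (intro mult_left_mono) auto
      then have 1: "\<bar>a * ln_ratio e\<bar> \<le> w / 2" using a by (simp add: abs_mult w_def)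
      have 2: "\<bar>ln_ratio (e * a)\<bar> \<le> w / 2" using b[of "e * a"] a e by (simp add: w_def mult.commute)
      have "e * (1 + a) = e + w" unfolding w_def by (simp add: algebra_simps)
      then have 3: "\<bar>ln_ratio (e * (1 + a))\<bar> \<le> (e + w) / 2" using b[of "e * (1 + a)"] w e by simp
      have tri: "\<bar>x + y - z - u\<bar> \<le> e + 2 * w"
        if "\<bar>x\<bar> \<le> e / 2" "\<bar>y\<bar> \<le> w / 2" "\<bar>z\<bar> \<le> w / 2" "\<bar>u\<bar> \<le> (e + w) / 2" for x y z u :: real
        using that w by (auto simp: abs_le_iff)
      have "\<bar>S 0\<bar> \<le> e + 2 * w" unfolding eq by (rule tri[OF b[OF e] 1 2 3])
      then show ?thesis by (simp add: w_def algebra_simps)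
    qed
    have "e * a * (V 0 - V n) \<ge> e * a * (- (real p + 1) / 2)"
      using V0 Vnp[of n] a e by (intro mult_left_mono) auto
    then have "S n \<ge> S 0 - e * a * (real p + 1) / 2" using low'[of n] by (simp add: field_simps)
    moreover have "e * a * (real p + 1) / 2 \<ge> 0" using a e by auto
    ultimately have "\<bar>S n\<bar> \<le> (1 + 2 * a) * e + e * a * (real p + 1) / 2" using S0 up'[of n] by linarith
    also have "\<dots> = C * e" unfolding C_def by (simp add: algebra_simps)
    finally show ?thesis unfolding S_def .
  qed
  with C show ?thesis by blast
qed

lemma ln_ratio_altdef: "x > 0 \<Longrightarrow> ln_ratio x = ln (1 - exp (- x)) - ln x"
  unfolding ln_ratio_def by (simp add: ln_div)

lemma ln_Gamma_series_real:
  assumes "a > (0::real)" "n > 0"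
  shows "ln (Gamma_series a n) = (\<Sum>k<n. ln (real k + 1)) + a * ln n - (\<Sum>k<Suc n. ln (real k + a))"
proof -
  have "Gamma_series a n = (\<Prod>k<n. real k + 1) * exp (a * ln n) / (\<Prod>k<Suc n. real k + a)"
    unfolding Gamma_series_def pochhammer_prod fact_prod_Suc
    by (simp add: atLeast0LessThan add.commute del: prod.lessThan_Suc)
  moreover have "(\<Prod>k<n. real k + 1) > 0" "(\<Prod>k<Suc n. real k + a) > 0"
    using assms by (auto intro!: prod_pos simp del: prod.lessThan_Suc)
  moreover have "ln (\<Prod>k<n. real k + 1) = (\<Sum>k<n. ln (real k + 1))"
    by (intro ln_prod) auto
  moreover have "ln (\<Prod>k<Suc n. real k + a) = (\<Sum>k<Suc n. ln (real k + a))"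
    using assms by (intro ln_prod) (auto intro!: add_nonneg_pos)
  ultimately show ?thesis
    by (simp add: ln_mult ln_div less_imp_neq[symmetric] del: prod.lessThan_Suc sum.lessThan_Suc prod_zero_iff)
qed

text \<open>In Euler's formula each k + a is replaced by 1 - q^(k + a), which costs
  \<open>ln_ratio\<close> and powers of e; their exponents add up to a - 1. For fixed e the factor
  (1 - q^(n + 1))^a tends to 1 as n grows, so the bound of \<open>ln_ratio_sum_bound\<close>, being
  uniform in n, passes to the limit.\<close>

lemma ln_qpochhammer_Gamma:
  assumes a: "a > 0"
  shows "\<exists>C\<ge>0. \<forall>e>0. \<bar>ln_qpochhammer 1 e - ln_qpochhammer a e - (a - 1) * ln e - ln (Gamma a)\<bar> \<le> C * e"
proof -
  obtain C where C: "C \<ge> 0" "\<And>e n. e > 0 \<Longrightarrow>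
    \<bar>(\<Sum>k<Suc n. ln_ratio (e * (real k + 1))) + a * ln_ratio (e * (real n + 1)) - (\<Sum>k<Suc (Suc n). ln_ratio (e * (real k + a)))\<bar> \<le> C * e"
    using ln_ratio_sum_bound[OF a] by blast
  have "\<bar>ln_qpochhammer 1 e - ln_qpochhammer a e - (a - 1) * ln e - ln (Gamma a)\<bar> \<le> C * e" if e: "e > 0" for e
  proof -
    define S where "S = (\<lambda>n. (\<Sum>k<Suc n. ln_ratio (e * (real k + 1))) + a * ln_ratio (e * (real n + 1)) - (\<Sum>k<Suc (Suc n). ln_ratio (e * (real k + a))))"
    define L where "L = (\<lambda>n. (\<Sum>k<Suc n. ln (1 - exp (- (e * (real k + 1)))))
       - (\<Sum>k<Suc (Suc n). ln (1 - exp (- (e * (real k + a)))))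
       + a * ln (1 - exp (- (e * (real n + 1)))) - (a - 1) * ln e - ln (Gamma_series a (Suc n)))"
    have SL: "S n = L n" for n
    proof -
      have 1: "(\<Sum>k<Suc n. ln_ratio (e * (real k + 1))) = (\<Sum>k<Suc n. ln (1 - exp (- (e * (real k + 1)))))
          - (\<Sum>k<Suc n. ln (real k + 1)) - real (Suc n) * ln e"
      proof -
        have "(\<Sum>k<Suc n. ln_ratio (e * (real k + 1))) = (\<Sum>k<Suc n. ln (1 - exp (- (e * (real k + 1)))) - ln (real k + 1) - ln e)"
          using e by (intro sum.cong refl) (simp add: ln_ratio_altdef ln_mult)
        then show ?thesis by (simp only: sum_subtractf sum_constant card_lessThan)
      qed
      have 2: "(\<Sum>k<Suc (Suc n). ln_ratio (e * (real k + a))) = (\<Sum>k<Suc (Suc n). ln (1 - exp (- (e * (real k + a)))))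
          - (\<Sum>k<Suc (Suc n). ln (real k + a)) - real (Suc (Suc n)) * ln e"
      proof -
        have "(\<Sum>k<Suc (Suc n). ln_ratio (e * (real k + a))) = (\<Sum>k<Suc (Suc n). ln (1 - exp (- (e * (real k + a)))) - ln (real k + a) - ln e)"
          using e a by (intro sum.cong refl) (simp add: ln_ratio_altdef ln_mult add_nonneg_pos add_nonneg_eq_0_iff)
        then show ?thesis by (simp only: sum_subtractf sum_constant card_lessThan)
      qed
      have 3: "ln_ratio (e * (real n + 1)) = ln (1 - exp (- (e * (real n + 1)))) - ln e - ln (real (Suc n))"
        using e by (simp add: ln_ratio_altdef ln_mult add.commute)
      show ?thesis unfolding S_def L_def 1 2 3 ln_Gamma_series_real[OF a zero_less_Suc]
        by (simp add: algebra_simps del: sum.lessThan_Suc)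
    qed
    have "L \<longlonglongrightarrow> ln_qpochhammer 1 e - ln_qpochhammer a e + a * ln (1 - 0) - (a - 1) * ln e - ln (Gamma a)"
      unfolding L_def
    proof (intro tendsto_intros)
      show "(\<lambda>n. \<Sum>k<Suc n. ln (1 - exp (- (e * (real k + 1))))) \<longlonglongrightarrow> ln_qpochhammer 1 e"
        using ln_qpochhammer_sums[of 1 e] e LIMSEQ_Suc unfolding sums_def by fastforce
      show "(\<lambda>n. \<Sum>k<Suc (Suc n). ln (1 - exp (- (e * (real k + a))))) \<longlonglongrightarrow> ln_qpochhammer a e"
        using ln_qpochhammer_sums[of a e] e a LIMSEQ_Suc LIMSEQ_Suc[OF LIMSEQ_Suc] unfolding sums_def by blast
      show "(\<lambda>n. exp (- (e * (real n + 1)))) \<longlonglongrightarrow> 0" using e by real_asymp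
      show "(\<lambda>n. Gamma_series a (Suc n)) \<longlonglongrightarrow> Gamma a"
        using LIMSEQ_Suc[OF Gamma_series_LIMSEQ] .
      show "Gamma a \<noteq> 0" using Gamma_real_pos[OF a] by simp
    qed auto
    then have "S \<longlonglongrightarrow> ln_qpochhammer 1 e - ln_qpochhammer a e - (a - 1) * ln e - ln (Gamma a)"
      using SL by (simp add: ext[of S L])
    then have "(\<lambda>n. \<bar>S n\<bar>) \<longlonglongrightarrow> \<bar>ln_qpochhammer 1 e - ln_qpochhammer a e - (a - 1) * ln e - ln (Gamma a)\<bar>"
      by (rule tendsto_rabs)
    then show ?thesis
      by (rule LIMSEQ_le_const2) (use C(2)[OF e] in \<open>auto simp: S_def\<close>)
  qed
  with C(1) show ?thesis by blast
qed

section \<open>Asymptotics near q = 1\<close>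

lemma ln_one_minus_sums:
  fixes x :: real
  assumes "0 < x" "x < 1"
  shows "(\<lambda>m. x ^ Suc m / real (Suc m)) sums (- ln (1 - x))"
proof -
  have "summable (\<lambda>m. x ^ Suc m / real (Suc m))"
  proof (rule summable_comparison_test)
    show "summable (\<lambda>m. x ^ Suc m)" using assms by (subst summable_Suc_iff) (simp add: summable_geometric)
    have "norm (x ^ Suc m / real (Suc m)) \<le> x ^ Suc m" for m
    proof -
      have "x ^ Suc m / real (Suc m) \<le> x ^ Suc m / 1" using assms by (intro divide_left_mono) auto
      then show ?thesis using assms by (simp add: abs_mult)
    qed
    then show "\<exists>N. \<forall>n\<ge>N. norm (x ^ Suc n / real (Suc n)) \<le> x ^ Suc n" by blast
  qed
  moreover have "ln (1 - x) = (\<Sum>n. - (x ^ Suc n / real (Suc n)))"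
  proof -
    have "ln (1 - x) = (\<Sum>n. (-1)^n * (1 / real (n + 1)) * ((1 - x) - 1)^(Suc n))"
      using assms by (intro ln_series) auto
    also have "(\<lambda>n. (-1)^n * (1 / real (n + 1)) * ((1 - x) - 1)^(Suc n)) = (\<lambda>n. - (x ^ Suc n / real (Suc n)))"
    proof
      fix n :: nat
      have "(-1)^n * (1 / real (n + 1)) * ((1 - x) - 1)^(Suc n) = ((-1) ^ n * (-1) ^ Suc n) * (x ^ Suc n / real (Suc n))"
        by (simp add: power_minus[of x] ac_simps)
      also have "(-1) ^ n * (-1) ^ Suc n = (-1::real)" by (simp add: power_mult_distrib[symmetric])
      finally show "(-1)^n * (1 / real (n + 1)) * ((1 - x) - 1)^(Suc n) = - (x ^ Suc n / real (Suc n))" by simp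
    qed
    finally show ?thesis .
  qed
  ultimately show ?thesis by (simp add: sums_iff suminf_minus)
qed

text \<open>A Lambert series: the logarithm of each factor is expanded in powers of q^(k + 1). With
  the sign changed all terms are nonnegative, so the order of summation may be swapped, and the sum
  over k is geometric.\<close>

lemma ln_qpochhammer_1_sums:
  assumes e: "e > 0"
  shows "(\<lambda>m. 1 / (real (Suc m) * (exp (e * real (Suc m)) - 1))) sums (- ln_qpochhammer 1 e)"
proof -
  define f where "f = (\<lambda>(k::nat, m::nat). exp (- (e * (real k + 1))) ^ Suc m / real (Suc m))"
  have nn: "f x \<ge> 0" for x unfolding f_def by (auto split: prod.split)
  have x: "0 < exp (- (e * (real k + 1)))" "exp (- (e * (real k + 1))) < 1" for k
    using e by (auto intro!: mult_pos_pos)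
  have 1: "((\<lambda>m. f (k, m)) has_sum (- ln (1 - exp (- (e * (real k + 1)))))) UNIV" for k
    unfolding f_def prod.case by (intro sums_nonneg_imp_has_sum ln_one_minus_sums x) auto
  have 2: "((\<lambda>k. - ln (1 - exp (- (e * (real k + 1))))) has_sum (- ln_qpochhammer 1 e)) UNIV"
  proof (intro sums_nonneg_imp_has_sum sums_minus ln_qpochhammer_sums e)
    fix k :: nat
    have "ln (1 - exp (- (e * (real k + 1)))) \<le> 0" using x[of k] by (subst ln_le_zero_iff) auto
    then show "- ln (1 - exp (- (e * (real k + 1)))) \<ge> 0" by simp
  qed auto
  have "f summable_on (UNIV \<times> UNIV)"
    by (rule summable_on_SigmaI[OF 1]) (use 2 nn in \<open>auto simp: summable_on_def\<close>)
  from has_sum_SigmaI[OF 1 2 this] have "(f has_sum (- ln_qpochhammer 1 e)) (UNIV \<times> UNIV)" .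
  then have 3: "((\<lambda>(x,y). f (y,x)) has_sum (- ln_qpochhammer 1 e)) (UNIV \<times> UNIV)"
    by (subst (asm) has_sum_swap)
  have 4: "((\<lambda>k. (\<lambda>(x,y). f (y,x)) (m, k)) has_sum (1 / (real (Suc m) * (exp (e * real (Suc m)) - 1)))) UNIV" for m
  proof -
    define y where "y = exp (- (e * real (Suc m)))"
    have y: "0 < y" "y < 1" unfolding y_def using e by (auto intro!: mult_pos_pos)
    have "(\<lambda>k. y ^ k) sums (1 / (1 - y))" using y by (intro geometric_sums) auto
    from sums_mult[OF this, of "y / real (Suc m)"]
    have "(\<lambda>k. y / real (Suc m) * y ^ k) sums (y / real (Suc m) * (1 / (1 - y)))" .
    also have "(\<lambda>k. y / real (Suc m) * y ^ k) = (\<lambda>k. f (k, m))"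
    proof
      fix k
      have "exp (- (e * (real k + 1))) ^ Suc m = y ^ Suc k"
        unfolding y_def exp_of_nat_mult[symmetric] by (simp add: algebra_simps)
      then show "y / real (Suc m) * y ^ k = f (k, m)" unfolding f_def by simp
    qed
    also have "y / real (Suc m) * (1 / (1 - y)) = 1 / (real (Suc m) * (exp (e * real (Suc m)) - 1))"
    proof -
      have "exp (e * real (Suc m)) = 1 / y" unfolding y_def by (simp add: exp_minus divide_inverse)
      then show ?thesis using y by (simp only:) (simp add: field_simps)
    qed
    finally show ?thesis using nn by (intro sums_nonneg_imp_has_sum) auto
  qed
  show ?thesis
    by (rule has_sum_imp_sums, rule has_sum_SigmaD[OF 3 4])
qed

text \<open>Multiplied by e, the m-th term of the Lambert series tends to 1 / (m + 1)^2 and is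
  dominated by it, since exp x - 1 \<ge> x. Tannery's theorem then leads to the sum of the inverse
  squares.\<close>

lemma ln_qpochhammer_1_leading:
  "((\<lambda>e. e * ln_qpochhammer 1 e) \<longlongrightarrow> - (pi\<^sup>2 / 6)) (at_right 0)"
proof -
  define a where "a = (\<lambda>m::nat. \<lambda>e::real. e / (real (Suc m) * (exp (e * real (Suc m)) - 1)))"
  have lim: "(a m \<longlongrightarrow> 1 / (real m + 1)\<^sup>2) (at_right 0)" for m
  proof -
    define c where "c = real m + 1"
    have c: "c > 0" unfolding c_def by simp
    have "((\<lambda>e. e / (c * (exp (e * c) - 1))) \<longlongrightarrow> 1 / c\<^sup>2) (at_right 0)" using c
      by (real_asymp simp: power2_eq_square field_simps)
    then show ?thesis unfolding a_def c_def by (simp add: add.commute)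
  qed
  have b: "norm (a m e) \<le> 1 / (real m + 1)\<^sup>2" if "e > 0" for e m
  proof -
    have ge: "e * real (Suc m) \<le> exp (e * real (Suc m)) - 1"
      using exp_ge_add_one_self[of "e * real (Suc m)"] by linarith
    have pos: "e * real (Suc m) > 0" using that by simp
    have "e / (real (Suc m) * (exp (e * real (Suc m)) - 1)) \<le> e / (real (Suc m) * (e * real (Suc m)))"
      using ge pos that by (intro divide_left_mono mult_left_mono mult_pos_pos) auto
    also have "\<dots> = 1 / (real m + 1)\<^sup>2" using that by (simp add: power2_eq_square add.commute)
    finally have "a m e \<le> 1 / (real m + 1)\<^sup>2" unfolding a_def .
    moreover have "a m e \<ge> 0" unfolding a_def using ge pos that by (intro divide_nonneg_nonneg mult_nonneg_nonneg) auto
    ultimately show ?thesis by simp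
  qed
  have "((\<lambda>e. suminf (\<lambda>m. a m e)) \<longlongrightarrow> suminf (\<lambda>m. 1 / (real m + 1)\<^sup>2)) (at_right 0)"
  proof (intro tannerys_theorem[THEN conjunct2, THEN conjunct2])
    show "\<forall>\<^sub>F (k, n) in sequentially \<times>\<^sub>F at_right 0. norm (a k n) \<le> 1 / (real k + 1)\<^sup>2"
    proof -
      have "\<forall>\<^sub>F n in at_right (0::real). n > 0" by (simp add: eventually_at_right_less)
      then have "\<forall>\<^sub>F x in sequentially \<times>\<^sub>F at_right (0::real). snd x > 0"
        by (rule filterlim_snd[unfolded filterlim_iff, rule_format, OF ])
      then show ?thesis by (rule eventually_mono) (use b in auto)
    qed
    show "summable (\<lambda>m. 1 / (real m + 1)\<^sup>2)" using inverse_squares_sums by (simp add: sums_iff add.commute)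
  qed (use lim in auto)
  also have "suminf (\<lambda>m. 1 / (real m + 1)\<^sup>2) = pi\<^sup>2 / 6" using inverse_squares_sums by (simp add: sums_iff add.commute)
  finally have "((\<lambda>e. - suminf (\<lambda>m. a m e)) \<longlongrightarrow> - (pi\<^sup>2 / 6)) (at_right 0)" by (rule tendsto_minus)
  then show ?thesis
  proof (rule Lim_transform_eventually)
    have "- suminf (\<lambda>m. a m e) = e * ln_qpochhammer 1 e" if "e > 0" for e
      using sums_mult[OF ln_qpochhammer_1_sums[OF that], of e] unfolding a_def by (simp add: sums_iff)
    then show "\<forall>\<^sub>F e in at_right 0. - suminf (\<lambda>m. a m e) = e * ln_qpochhammer 1 e"
      using eventually_at_right_less by (rule eventually_mono[rotated]) auto
  qed
qed

text \<open>The numbers k + 1 are split into the odd ones 2 (n + 1/2) and the even ones 2 (n +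
  1).\<close>

lemma ln_qpochhammer_1_split:
  assumes e: "e > 0"
  shows "ln_qpochhammer 1 e = ln_qpochhammer (1/2) (2 * e) + ln_qpochhammer 1 (2 * e)"
proof -
  define f where "f = (\<lambda>k::nat. ln (1 - exp (- (e * (real k + 1)))))"
  have "(\<lambda>n. sum f {n * 2..<n * 2 + 2}) sums ln_qpochhammer 1 e"
    unfolding f_def using e by (intro sums_group ln_qpochhammer_sums) auto
  moreover have "sum f {n * 2..<n * 2 + 2} = ln (1 - exp (- ((2 * e) * (real n + 1/2)))) + ln (1 - exp (- ((2 * e) * (real n + 1))))" for n
  proof -
    have "{n * 2..<n * 2 + 2} = {n * 2, Suc (n * 2)}" by auto
    then show ?thesis unfolding f_def by (simp add: algebra_simps)
  qed
  moreover have "(\<lambda>n. ln (1 - exp (- ((2 * e) * (real n + 1/2)))) + ln (1 - exp (- ((2 * e) * (real n + 1)))))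
      sums (ln_qpochhammer (1/2) (2 * e) + ln_qpochhammer 1 (2 * e))"
    using e by (intro sums_add ln_qpochhammer_sums) auto
  ultimately show ?thesis by (simp add: sums_unique2)
qed

text \<open>In the odd-even splitting the Gamma comparison at 1/2 trades the odd part for (q^2;
  q^2)_\<infinity>, so that R e - 2 R (2 e) = O(e). The terms ln e / 2 and ln (2 pi) / 2 are those
  for which all but the error cancels in this relation, as Gamma (1/2) = sqrt pi.\<close>

lemma ln_qpochhammer_1_asymp:
  "\<exists>C\<ge>0. \<forall>e>0. \<bar>ln_qpochhammer 1 e + pi\<^sup>2 / (6 * e) + ln e / 2 - ln (2 * pi) / 2\<bar> \<le> C * e"
proof -
  define R where "R = (\<lambda>e. ln_qpochhammer 1 e + pi\<^sup>2 / (6 * e) + ln e / 2 - ln (2 * pi) / 2)"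
  \<comment> \<open>Multiplying by e turns R e - 2 R (2 e) into a difference of values of T, of size
    O(e^2), which is summable along e / 2^n.\<close>
  define T where "T = (\<lambda>e. e * R e)"
  obtain C where C: "C \<ge> 0" and C': "\<And>e. e > 0 \<Longrightarrow> \<bar>ln_qpochhammer 1 e - ln_qpochhammer (1/2) e - (1/2 - 1) * ln e - ln (Gamma (1/2))\<bar> \<le> C * e"
    using ln_qpochhammer_Gamma[of "1/2"] by auto
  have R: "\<bar>R e - 2 * R (2 * e)\<bar> \<le> 2 * C * e" if e: "e > 0" for e
  proof -
    have "ln (sqrt pi) = ln pi / 2" by (simp add: ln_sqrt)
    then have "R e - 2 * R (2 * e) = - (ln_qpochhammer 1 (2 * e) - ln_qpochhammer (1/2) (2 * e) - (1/2 - 1) * ln (2 * e) - ln (Gamma (1/2)))"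
      unfolding R_def ln_qpochhammer_1_split[OF e] Gamma_one_half_real using e by (simp add: ln_mult field_simps)
    then show ?thesis using C'[of "2 * e"] e by simp
  qed
  have T: "\<bar>T (2 * e) - T e\<bar> \<le> 2 * C * e\<^sup>2" if e: "e > 0" for e
  proof -
    have "T (2 * e) - T e = - e * (R e - 2 * R (2 * e))" unfolding T_def by (simp add: algebra_simps)
    then have "\<bar>T (2 * e) - T e\<bar> = e * \<bar>R e - 2 * R (2 * e)\<bar>" using e by (simp add: abs_mult)
    also have "\<dots> \<le> e * (2 * C * e)" using R[OF e] e by (intro mult_left_mono) auto
    finally show ?thesis by (simp add: power2_eq_square algebra_simps)
  qed
  have Tn: "\<bar>T e - T (e / 2 ^ n)\<bar> \<le> 2 * C * e\<^sup>2 * (1 - 1 / 2 ^ n)" if e: "e > 0" for e n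
  proof (induction n)
    case (Suc n)
    have "\<bar>T (2 * (e / 2 ^ Suc n)) - T (e / 2 ^ Suc n)\<bar> \<le> 2 * C * (e / 2 ^ Suc n)\<^sup>2"
      using e by (intro T) auto
    also have "\<dots> = 2 * C * e\<^sup>2 * ((1 / 2 ^ Suc n) * (1 / 2 ^ Suc n))" by (simp add: power_divide power2_eq_square)
    \<comment> \<open>Weakening 1 / 4^(n + 1) to 1 / 2^(n + 1) lets the induction close on 1 - 1 /
      2^n.\<close>
    also have "\<dots> \<le> 2 * C * e\<^sup>2 * ((1 / 2 ^ Suc n) * 1)"
      using C one_le_power[of "2::real" "Suc n"] by (intro mult_left_mono) (auto simp del: power_Suc)
    finally have "\<bar>T (e / 2 ^ n) - T (e / 2 ^ Suc n)\<bar> \<le> 2 * C * e\<^sup>2 * (1 / 2 ^ Suc n)" by simp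
    with Suc have "\<bar>T e - T (e / 2 ^ Suc n)\<bar> \<le> 2 * C * e\<^sup>2 * (1 - 1 / 2 ^ n) + 2 * C * e\<^sup>2 * (1 / 2 ^ Suc n)" by linarith
    also have "\<dots> = 2 * C * e\<^sup>2 * (1 - 1 / 2 ^ Suc n)" by (simp add: field_simps)
    finally show ?case .
  qed auto
  have T0: "(T \<longlongrightarrow> 0) (at_right 0)"
  proof -
    have "((\<lambda>e. e * ln_qpochhammer 1 e + (pi\<^sup>2 / 6 + e * ln e / 2 - e * (ln (2 * pi) / 2))) \<longlongrightarrow> - (pi\<^sup>2 / 6) + (pi\<^sup>2 / 6 + 0 - 0 * (ln (2 * pi) / 2))) (at_right 0)"
    proof (intro tendsto_add tendsto_diff ln_qpochhammer_1_leading tendsto_const tendsto_mult tendsto_ident_at)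
      show "((\<lambda>e::real. e * ln e / 2) \<longlongrightarrow> 0) (at_right 0)" by real_asymp
    qed
    then have "((\<lambda>e. e * ln_qpochhammer 1 e + (pi\<^sup>2 / 6 + e * ln e / 2 - e * (ln (2 * pi) / 2))) \<longlongrightarrow> 0) (at_right 0)" by simp
    then show ?thesis
    proof (rule Lim_transform_eventually)
      show "\<forall>\<^sub>F e in at_right 0. e * ln_qpochhammer 1 e + (pi\<^sup>2 / 6 + e * ln e / 2 - e * (ln (2 * pi) / 2)) = T e"
        using eventually_at_right_less[of "0::real"]
        by (rule eventually_mono) (simp add: T_def R_def field_simps)
    qed
  qed
  have "\<bar>R e\<bar> \<le> 2 * C * e" if e: "e > 0" for e
  proof -
    have "filterlim (\<lambda>n. e / 2 ^ n) (at_right 0) sequentially"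
    proof (rule tendsto_imp_filterlim_at_right)
      show "(\<lambda>n. e / 2 ^ n) \<longlonglongrightarrow> 0" by real_asymp
      show "\<forall>\<^sub>F n in sequentially. 0 < e / 2 ^ n" using e by simp
    qed
    from filterlim_compose[OF T0 this] have "(\<lambda>n. \<bar>T e - T (e / 2 ^ n)\<bar>) \<longlonglongrightarrow> \<bar>T e - 0\<bar>" by (intro tendsto_intros)
    moreover have "\<bar>T e - T (e / 2 ^ n)\<bar> \<le> 2 * C * e\<^sup>2" for n
    proof -
      have "2 * C * e\<^sup>2 * (1 - 1 / 2 ^ n) \<le> 2 * C * e\<^sup>2 * 1" using C by (intro mult_left_mono) auto
      then show ?thesis using Tn[OF e, of n] by linarith
    qed
    ultimately have "\<bar>T e\<bar> \<le> 2 * C * e\<^sup>2" using LIMSEQ_le_const2[of _ "\<bar>T e - 0\<bar>"] by auto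
    then have "e * \<bar>R e\<bar> \<le> e * (2 * C * e)" unfolding T_def using e by (simp add: abs_mult power2_eq_square)
    then show ?thesis using e by (simp only: mult_le_cancel_left_pos)
  qed
  then show ?thesis using C unfolding R_def by (intro exI[of _ "2 * C"]) auto
qed

lemma ln_qpochhammer_asymp:
  assumes "a > 0"
  shows "\<exists>C\<ge>0. \<forall>e>0. \<bar>ln_qpochhammer a e - (- pi\<^sup>2 / (6 * e) + (1/2 - a) * ln e + ln (2 * pi) / 2 - ln (Gamma a))\<bar> \<le> C * e"
proof -
  obtain C1 where C1: "C1 \<ge> 0" "\<And>e. e > 0 \<Longrightarrow> \<bar>ln_qpochhammer 1 e - ln_qpochhammer a e - (a - 1) * ln e - ln (Gamma a)\<bar> \<le> C1 * e"
    using ln_qpochhammer_Gamma[OF assms] by blast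
  obtain C2 where C2: "C2 \<ge> 0" "\<And>e. e > 0 \<Longrightarrow> \<bar>ln_qpochhammer 1 e + pi\<^sup>2 / (6 * e) + ln e / 2 - ln (2 * pi) / 2\<bar> \<le> C2 * e"
    using ln_qpochhammer_1_asymp by blast
  have "\<bar>ln_qpochhammer a e - (- pi\<^sup>2 / (6 * e) + (1/2 - a) * ln e + ln (2 * pi) / 2 - ln (Gamma a))\<bar> \<le> (C1 + C2) * e" if "e > 0" for e
    using C1(2)[OF that] C2(2)[OF that] by (simp add: algebra_simps)
  then show ?thesis using C1(1) C2(1) by (intro exI[of _ "C1 + C2"]) auto
qed

section \<open>Poisson summation for Gaussian sums\<close>

text \<open>
  The substitution \<open>x = arccos u\<close> turns even trigonometric polynomials into polynomials, so that
  Weierstrass approximation applies to \<open>h \<circ> arccos\<close>.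
\<close>

lemma cos_moments_eq_0_imp_eq_0:
  fixes h :: "real \<Rightarrow> real"
  assumes cont: "continuous_on {0..pi} h"
    and mom: "\<And>j::nat. integral {0..pi} (\<lambda>x. h x * cos (real j * x)) = 0"
    and x: "x \<in> {0..pi}"
  shows "h x = 0"
proof -
  have int: "(\<lambda>x. h x * cos x ^ n * cos (real m * x)) integrable_on {0..pi}" for n m
    by (auto intro!: integrable_continuous_interval continuous_intros cont)
  \<comment> \<open>A further factor cos x shifts the frequency by one in both directions, so the
    induction on the power needs all j at once.\<close>
  have mom': "integral {0..pi} (\<lambda>x. h x * cos x ^ n * cos (real j * x)) = 0" for n j
  proof (induction n arbitrary: j)
    case (Suc n)
    show ?case
    proof (cases j)
      case 0
      then have "(\<lambda>x. h x * cos x ^ Suc n * cos (real j * x)) = (\<lambda>x. h x * cos x ^ n * cos (real 1 * x))"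
        by (simp add: fun_eq_iff)
      then show ?thesis by (simp only: Suc)
    next
      case (Suc i)
      have "h x * cos x ^ Suc n * cos (real j * x) = (1/2) * (h x * cos x ^ n * cos (real (Suc j) * x) + h x * cos x ^ n * cos (real i * x))" for x
      proof -
        have "cos x * cos (real j * x) = (1/2) * (cos (real (Suc j) * x) + cos (real i * x))"
          unfolding cos_times_cos by (simp add: Suc algebra_simps)
        moreover have "h x * cos x ^ Suc n * cos (real j * x) = h x * cos x ^ n * (cos x * cos (real j * x))" by simp
        moreover have "A * B * ((1/2) * (C + D)) = (1/2) * (A * B * C + A * B * D)" for A B C D :: real
          by (simp add: algebra_simps)
        ultimately show ?thesis by (simp only:)
      qed
      then show ?thesis using int by (simp only: integral_mult_right integral_add[OF int int] Suc.IH) simp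
    qed
  qed (use mom in simp)
  have poly: "integral {0..pi} (\<lambda>x. h x * p (cos x)) = 0" if p: "real_polynomial_function p" for p :: "real \<Rightarrow> real"
  proof -
    obtain a n where p: "p = (\<lambda>x. \<Sum>i\<le>n. a i * x ^ i)" using p unfolding real_polynomial_function_iff_sum by blast
    have "((\<lambda>x. \<Sum>i\<le>n. a i * (h x * cos x ^ i * cos (real 0 * x))) has_integral (\<Sum>i\<le>n. a i * 0)) {0..pi}"
    proof (rule has_integral_sum, simp, rule has_integral_mult_right)
      fix i
      show "((\<lambda>x. h x * cos x ^ i * cos (real 0 * x)) has_integral 0) {0..pi}"
        using mom'[of i 0] int[of i 0] by (simp only: has_integral_integrable_integral)
    qed
    then show ?thesis unfolding p by (simp add: integral_unique sum_distrib_left mult_ac)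
  qed
  \<comment> \<open>As h is orthogonal to every polynomial in cos x, h^2 has the same integral as h
    (x) (h (x) - p (cos x)), whose last factor is uniformly small.\<close>
  have "integral {0..pi} (\<lambda>x. (h x)\<^sup>2) \<le> 0"
  proof (rule field_le_epsilon)
    fix e :: real assume e: "e > 0"
    define M where "M = integral {0..pi} (\<lambda>x. \<bar>h x\<bar>)"
    have M: "M \<ge> 0" unfolding M_def by (intro integral_nonneg integrable_continuous_interval continuous_intros cont) auto
    define d where "d = e / (M + 1)"
    have d: "d > 0" unfolding d_def using e M by auto
    have ca: "continuous_on {-1..1} (\<lambda>u. h (arccos u))"
      by (rule continuous_on_compose2[OF cont continuous_on_arccos']) (auto simp: arccos_lbound arccos_ubound)
    obtain p where p: "real_polynomial_function p" "\<And>u. u \<in> {-1..1} \<Longrightarrow> \<bar>h (arccos u) - p u\<bar> < d"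
    proof (rule Stone_Weierstrass_real_polynomial_function[OF compact_Icc ca d])
      fix g assume "real_polynomial_function g" "\<And>u. u \<in> {-1..1} \<Longrightarrow> \<bar>h (arccos u) - g u\<bar> < d"
      then show thesis by (rule that)
    qed
    have pc: "continuous_on {0..pi} (\<lambda>x. p (cos x))"
    proof (rule continuous_on_compose2[of UNIV p])
      show "continuous_on UNIV p"
        using p(1) by (intro continuous_on_polymonial_function) (simp add: real_polynomial_function_eq)
    qed (auto intro!: continuous_intros)
    have ap: "\<bar>h x - p (cos x)\<bar> \<le> d" if "x \<in> {0..pi}" for x
      using p(2)[of "cos x"] that by (simp add: arccos_cos)
    have "integral {0..pi} (\<lambda>x. (h x)\<^sup>2) = integral {0..pi} (\<lambda>x. (h x)\<^sup>2 - h x * p (cos x))"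
      by (subst integral_diff) (auto intro!: integrable_continuous_interval continuous_intros cont pc simp: poly[OF p(1)])
    also have "\<dots> \<le> integral {0..pi} (\<lambda>x. d * \<bar>h x\<bar>)"
    proof (rule integral_le)
      fix x assume x: "x \<in> {0..pi}"
      have "(h x)\<^sup>2 - h x * p (cos x) \<le> \<bar>h x * (h x - p (cos x))\<bar>" by (simp add: power2_eq_square algebra_simps)
      also have "\<dots> \<le> \<bar>h x\<bar> * d" unfolding abs_mult using ap[OF x] by (intro mult_left_mono) auto
      finally show "(h x)\<^sup>2 - h x * p (cos x) \<le> d * \<bar>h x\<bar>" by (simp add: mult.commute)
    qed (auto intro!: integrable_continuous_interval continuous_intros cont pc)
    also have "\<dots> = d * M" unfolding M_def by simp
    also have "\<dots> \<le> 0 + e" unfolding d_def using M e by (simp add: field_simps)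
    finally show "integral {0..pi} (\<lambda>x. (h x)\<^sup>2) \<le> 0 + e" .
  qed
  moreover have "integral {0..pi} (\<lambda>x. (h x)\<^sup>2) \<ge> 0"
    by (intro integral_nonneg integrable_continuous_interval continuous_intros cont) auto
  ultimately have "integral {0..pi} (\<lambda>x. (h x)\<^sup>2) = 0" by simp
  then have "\<forall>x\<in>{0..pi}. (h x)\<^sup>2 = 0"
    by (subst (asm) integral_eq_0_iff) (auto intro!: continuous_intros cont)
  with x show ?thesis by simp
qed

text \<open>Real part of the characteristic function of the standard normal law at b / sqrt (2 c),
  rescaled by x = sqrt (2 c) y.\<close>

lemma has_bochner_integral_gaussian_cos:
  assumes "c > 0"
  shows "has_bochner_integral lborel (\<lambda>y. exp (- c * y\<^sup>2) * cos (b * y)) (sqrt (pi / c) * exp (- b\<^sup>2 / (4 * c)))"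
proof -
  define u where "u = b / sqrt (2 * c)"
  define f where "f = (\<lambda>x. std_normal_density x * cos (u * x))"
  have 1: "integrable std_normal_distribution (\<lambda>x. iexp (u * x))"
    by (rule finite_measure.integrable_const_bound[OF prob_space.finite_measure[OF prob_space_normal_density], where B = 1]) auto
  then have i1: "integrable lborel (\<lambda>x. std_normal_density x *\<^sub>R iexp (u * x))"
    by (subst (asm) integrable_density) auto
  have "(LINT x|lborel. std_normal_density x *\<^sub>R iexp (u * x)) = of_real (exp (- u\<^sup>2 / 2))"
    using char_std_normal_distribution unfolding char_def fun_eq_iff
    by (subst (asm) integral_density) auto
  with i1 have "has_bochner_integral lborel (\<lambda>x. std_normal_density x *\<^sub>R iexp (u * x)) (of_real (exp (- u\<^sup>2 / 2)))"
    by (simp add: has_bochner_integral_iff)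
  from has_bochner_integral_Re[OF this]
  have "has_bochner_integral lborel f (exp (- u\<^sup>2 / 2))"
    by (simp add: f_def Re_exp)
  then have "has_bochner_integral lborel (\<lambda>y. f (0 + sqrt (2 * c) * y)) (exp (- u\<^sup>2 / 2) /\<^sub>R \<bar>sqrt (2 * c)\<bar>)"
    using assms by (subst (asm) lborel_has_bochner_integral_real_affine_iff[where c = "sqrt (2 * c)" and t = 0]) auto
  then have "has_bochner_integral lborel (\<lambda>y. sqrt (2 * pi) * f (0 + sqrt (2 * c) * y)) (sqrt (2 * pi) * (exp (- u\<^sup>2 / 2) /\<^sub>R \<bar>sqrt (2 * c)\<bar>))"
    by (rule has_bochner_integral_mult_right)
  moreover have "sqrt (2 * pi) * f (0 + sqrt (2 * c) * y) = exp (- c * y\<^sup>2) * cos (b * y)" for y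
    using assms unfolding f_def u_def std_normal_density_def by (simp add: power_mult_distrib field_simps)
  moreover have "sqrt (2 * pi) * (exp (- u\<^sup>2 / 2) /\<^sub>R \<bar>sqrt (2 * c)\<bar>) = sqrt (pi / c) * exp (- b\<^sup>2 / (4 * c))"
    using assms unfolding u_def by (simp add: power_divide real_sqrt_mult real_sqrt_divide field_simps)
  ultimately show ?thesis by simp
qed

text \<open>Half of the integral over the line, by evenness. The upper limits are whole periods
  because integrating a partial periodization over {0..pi} produces those.\<close>

lemma gaussian_cos_integral_LIMSEQ:
  assumes "c > 0"
  shows "(\<lambda>N. integral {0..2 * pi * real N} (\<lambda>y. exp (- c * y\<^sup>2) * cos (b * y))) \<longlonglongrightarrow> sqrt (pi / c) * exp (- b\<^sup>2 / (4 * c)) / 2"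
proof -
  let ?g = "\<lambda>y. exp (- c * y\<^sup>2) * cos (b * y)"
  note G = has_bochner_integral_gaussian_cos[OF assms, of b]
  have Gi: "integrable lborel ?g" using G by (simp add: has_bochner_integral_iff)
  have si: "set_integrable lborel A ?g" if "A \<in> sets borel" for A
    using integrable_mult_indicator[OF _ Gi, of A] that by (simp add: set_integrable_def)
  define I where "I = (LINT x|lborel. indicator {0..} x *\<^sub>R ?g x)"
  have "has_bochner_integral lborel (\<lambda>x. indicator {0..} x *\<^sub>R ?g x) I"
    using si[of "{0..}"] unfolding I_def set_integrable_def has_bochner_integral_iff by simp
  then have "has_bochner_integral lborel ?g (2 *\<^sub>R I)"
    by (rule has_bochner_integral_even_function) simp
  then have I: "I = sqrt (pi / c) * exp (- b\<^sup>2 / (4 * c)) / 2"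
    using has_bochner_integral_eq[OF G] by fastforce
  have "((\<lambda>y. LINT x|lborel. indicator {..y} x *\<^sub>R (indicator {0..} x *\<^sub>R ?g x)) \<longlongrightarrow> I) at_top"
    unfolding I_def using si[of "{0..}"] by (intro tendsto_integral_at_top) (auto simp: set_integrable_def)
  moreover have "filterlim (\<lambda>N. 2 * pi * real N) at_top sequentially" by real_asymp
  ultimately have "(\<lambda>N. LINT x|lborel. indicator {..2 * pi * real N} x *\<^sub>R (indicator {0..} x *\<^sub>R ?g x)) \<longlonglongrightarrow> I"
    by (rule filterlim_compose)
  moreover have "(LINT x|lborel. indicator {..2 * pi * real N} x *\<^sub>R (indicator {0..} x *\<^sub>R ?g x)) = integral {0..2 * pi * real N} ?g" for N
  proof -
    have "(LINT x|lborel. indicator {..2 * pi * real N} x *\<^sub>R (indicator {0..} x *\<^sub>R ?g x)) = (LINT x:{0..2 * pi * real N}|lborel. ?g x)"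
      unfolding set_lebesgue_integral_def by (intro Bochner_Integration.integral_cong refl) (auto split: split_indicator)
    also have "\<dots> = integral {0..2 * pi * real N} ?g"
      by (intro set_borel_integral_eq_integral si) auto
    finally show ?thesis .
  qed
  ultimately show ?thesis unfolding I by simp
qed

section \<open>Cosine moments and the Poisson identity\<close>

lemma integral_cos_cos:
  "integral {0..pi} (\<lambda>y. cos (real i * y) * cos (real j * y)) = (if i = j then if j = 0 then pi else pi / 2 else 0)"
proof -
  have c: "((\<lambda>y. cos (of_int m * y)) has_integral (if m = 0 then pi else 0)) {0..pi}" for m :: int
  proof (cases "m = 0")
    case False
    have "((\<lambda>y. cos (of_int m * y)) has_integral (sin (of_int m * pi) / of_int m - sin (of_int m * 0) / of_int m)) {0..pi}"
      using False by (intro fundamental_theorem_of_calculus)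
        (auto intro!: derivative_eq_intros simp: has_real_derivative_iff_has_vector_derivative[symmetric])
    moreover have "sin (of_int m * pi) = 0" by (simp add: sin_zero_iff_int2)
    ultimately show ?thesis using False by simp
  qed (use has_integral_const_real[of "1::real" 0 pi] in simp)
  have "((\<lambda>y. (cos (of_int (int i - int j) * y) + cos (of_int (int i + int j) * y)) / 2) has_integral
      ((if int i - int j = 0 then pi else 0) + (if int i + int j = 0 then pi else 0)) / 2) {0..pi}"
    by (intro has_integral_divide has_integral_add c)
  also have "(\<lambda>y. (cos (of_int (int i - int j) * y) + cos (of_int (int i + int j) * y)) / 2) = (\<lambda>y. cos (real i * y) * cos (real j * y))"
    by (simp add: cos_times_cos algebra_simps)
  finally show ?thesis by (auto simp: integral_unique)
qed

text \<open>Unfolding: each period is cut in the middle, the first half is moved to {0..pi} by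
  translation and the second half by reflection. The cosine is invariant under both.\<close>

lemma integral_periodized_cos:
  fixes g :: "real \<Rightarrow> real"
  assumes g: "continuous_on UNIV g"
  shows "((\<lambda>y. \<Sum>m<N. (g (y + 2 * pi * real m) + g (2 * pi * (real m + 1) - y)) * cos (real j * y))
     has_integral integral {0..2 * pi * real N} (\<lambda>y. g y * cos (real j * y))) {0..pi}"
proof -
  define k where "k = (\<lambda>y. g y * cos (real j * y))"
  have kU: "continuous_on UNIV k"
    unfolding k_def by (intro continuous_on_mult g continuous_on_cos continuous_on_const continuous_on_id)
  have k: "continuous_on A k" for A
    by (rule continuous_on_subset[OF kU]) simp
  \<comment> \<open>Starting at - 1 keeps 0 in the interior, so that \<Phi> has a two-sided
    derivative there too.\<close>
  define \<Phi> where "\<Phi> = (\<lambda>x. integral {-1..x} k)"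
  have \<Phi>: "(\<Phi> has_real_derivative k t) (at t)" if "t \<ge> 0" for t
  proof -
    have "(\<Phi> has_real_derivative k t) (at t within {-1..t + 1})"
      unfolding \<Phi>_def using that by (intro integral_has_real_derivative k) auto
    moreover have "at t within {-1..t + 1} = at t" using that by (intro at_within_interior) simp
    ultimately show ?thesis by simp
  qed
  have per: "cos (real j * (y + 2 * pi * real m)) = cos (real j * y)"
    "cos (real j * (2 * pi * (real m + 1) - y)) = cos (real j * y)" for y and m :: nat
  proof -
    have "real j * (y + 2 * pi * real m) = real j * y + 2 * real (j * m) * pi" by (simp add: algebra_simps)
    then show "cos (real j * (y + 2 * pi * real m)) = cos (real j * y)"
      by (simp add: cos_add cos_2npi sin_2npi del: of_nat_mult)
    have "real j * (2 * pi * (real m + 1) - y) = 2 * real (j * Suc m) * pi - real j * y" by (simp add: algebra_simps)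
    then show "cos (real j * (2 * pi * (real m + 1) - y)) = cos (real j * y)"
      by (simp add: cos_diff cos_2npi sin_2npi del: of_nat_mult of_nat_Suc mult_Suc_right)
  qed
  have step: "((\<lambda>y. (g (y + 2 * pi * real m) + g (2 * pi * (real m + 1) - y)) * cos (real j * y))
     has_integral (\<Phi> (2 * pi * real (Suc m)) - \<Phi> (2 * pi * real m))) {0..pi}" for m
  proof -
    define \<Psi> where "\<Psi> = (\<lambda>y. \<Phi> (y + 2 * pi * real m) - \<Phi> (2 * pi * (real m + 1) - y))"
    have "((\<lambda>y. k (y + 2 * pi * real m) + k (2 * pi * (real m + 1) - y)) has_integral (\<Psi> pi - \<Psi> 0)) {0..pi}"
    proof (rule fundamental_theorem_of_calculus)
      fix y assume y: "y \<in> {0..pi}"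
      have "(\<Psi> has_real_derivative (k (y + 2 * pi * real m) * 1 - k (2 * pi * (real m + 1) - y) * (- 1))) (at y)"
        unfolding \<Psi>_def
      proof (intro DERIV_diff DERIV_chain2[where f = \<Phi>] \<Phi>)
        show "0 \<le> y + 2 * pi * real m" using y by simp
        have "y \<le> 2 * pi * 1" using y pi_gt_zero by simp
        also have "\<dots> \<le> 2 * pi * (real m + 1)" by (intro mult_left_mono) auto
        finally show "0 \<le> 2 * pi * (real m + 1) - y" by simp
      qed (auto intro!: derivative_eq_intros)
      then show "(\<Psi> has_vector_derivative (k (y + 2 * pi * real m) + k (2 * pi * (real m + 1) - y))) (at y within {0..pi})"
        by (simp add: has_real_derivative_iff_has_vector_derivative has_vector_derivative_at_within)
    qed auto
    moreover have "\<Psi> pi - \<Psi> 0 = \<Phi> (2 * pi * real (Suc m)) - \<Phi> (2 * pi * real m)"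
    proof -
      have "pi + 2 * pi * real m = 2 * pi * (real m + 1) - pi" by (simp add: algebra_simps)
      then have e1: "\<Phi> (pi + 2 * pi * real m) = \<Phi> (2 * pi * (real m + 1) - pi)" by (rule arg_cong)
      show ?thesis unfolding \<Psi>_def e1 by (simp add: add.commute)
    qed
    moreover have "k (y + 2 * pi * real m) + k (2 * pi * (real m + 1) - y) = (g (y + 2 * pi * real m) + g (2 * pi * (real m + 1) - y)) * cos (real j * y)" for y
      unfolding k_def per by (simp only: distrib_right)
    ultimately show ?thesis by (simp only:)
  qed
  have "((\<lambda>y. \<Sum>m<N. (g (y + 2 * pi * real m) + g (2 * pi * (real m + 1) - y)) * cos (real j * y))
     has_integral (\<Sum>m<N. \<Phi> (2 * pi * real (Suc m)) - \<Phi> (2 * pi * real m))) {0..pi}"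
    by (rule has_integral_sum[OF finite_lessThan step])
  also have "(\<Sum>m<N. \<Phi> (2 * pi * real (Suc m)) - \<Phi> (2 * pi * real m)) = \<Phi> (2 * pi * real N) - \<Phi> 0"
    by (subst sum_lessThan_telescope) simp
  also have "\<dots> = integral {0..2 * pi * real N} k"
    unfolding \<Phi>_def using Henstock_Kurzweil_Integration.integral_combine[where a = "-1" and c = 0 and b = "2 * pi * real N" and f = k]
    by (simp add: integrable_continuous_interval k)
  finally show ?thesis unfolding k_def .
qed

lemma power_square_le_power:
  fixes r :: real
  assumes "0 \<le> r" "r \<le> 1"
  shows "r ^ (j\<^sup>2) \<le> r ^ j"
  by (rule power_decreasing) (use assms in \<open>auto simp: power2_eq_square\<close>)

text \<open>Since G is even, the two terms are its translates by 2 pi m and - 2 pi (m + 1), and the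
  sum is the full periodization, even and periodic in y; hence half a period suffices. Both sides
  are uniformly convergent, hence continuous, and their cosine moments agree, so
  \<open>cos_moments_eq_0_imp_eq_0\<close> applies to the difference.\<close>

lemma gaussian_poisson_half_period:
  assumes c: "c > 0" and y: "y \<in> {0..pi}"
  defines "G \<equiv> \<lambda>x. exp (- c * x\<^sup>2)"
  shows "(\<lambda>m. G (y + 2 * pi * real m) + G (2 * pi * (real m + 1) - y)) sums
     (1 / (2 * sqrt (pi * c)) * (\<Sum>j. (if j = 0 then 1 else 2) * exp (- (real j)\<^sup>2 / (4 * c)) * cos (real j * y)))"
proof -
  define r where "r = exp (- c)"
  have r: "0 < r" "r < 1" unfolding r_def using c by auto
  define u where "u = (\<lambda>m::nat. \<lambda>y. G (y + 2 * pi * real m) + G (2 * pi * (real m + 1) - y))"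
  have ub: "\<bar>u m y\<bar> \<le> 2 * r ^ m" if "y \<in> {0..pi}" for m y
  proof -
    have g: "G x \<le> r ^ m" if "x \<ge> real m" for x
    proof -
      have "real m \<le> (real m)\<^sup>2" by (cases m) (auto simp: power2_eq_square)
      also have "\<dots> \<le> x\<^sup>2" using that by (intro power_mono) auto
      finally have "c * real m \<le> c * x\<^sup>2" using c by (intro mult_left_mono) auto
      then show ?thesis unfolding G_def r_def exp_of_nat_mult[symmetric] by (simp add: mult.commute)
    qed
    have m: "real m \<le> 2 * pi * real m" using pi_ge_two by (cases m) (auto simp: mult_le_cancel_right1)
    have "real m \<le> 2 * pi * (real m + 1) - y"
      using m that pi_ge_two by (simp add: algebra_simps)
    moreover have "real m \<le> y + 2 * pi * real m" using m that by simp
    ultimately have "u m y \<le> 2 * r ^ m" unfolding u_def using g[of "y + 2 * pi * real m"] g[of "2 * pi * (real m + 1) - y"] by linarith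
    moreover have "u m y \<ge> 0" unfolding u_def G_def by (intro add_nonneg_nonneg) auto
    ultimately show ?thesis by simp
  qed
  have sr: "summable (\<lambda>m. 2 * r ^ m)" using r by (intro summable_mult summable_geometric) auto
  define F where "F = (\<lambda>y. \<Sum>m. u m y)"
  have Fs: "(\<lambda>m. u m y) sums F y" if "y \<in> {0..pi}" for y
    unfolding F_def using ub[OF that] by (intro summable_sums summable_comparison_test[OF _ sr]) auto
  have Gc: "continuous_on A G" for A unfolding G_def by (intro continuous_intros)
  have uc: "continuous_on A (u m)" for m A
    unfolding u_def G_def by (intro continuous_intros)
  define r' where "r' = exp (- 1 / (4 * c))"
  have r': "0 < r'" "r' < 1" unfolding r'_def using c by auto
  define w where "w = (\<lambda>j::nat. (if j = 0 then 1 else 2) * exp (- (real j)\<^sup>2 / (4 * c)))"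
  have w: "0 \<le> w j" "w j \<le> 2 * r' ^ j" for j
  proof -
    have "exp (- (real j)\<^sup>2 / (4 * c)) = r' ^ (j\<^sup>2)"
      unfolding r'_def exp_of_nat_mult[symmetric] by simp
    also have "\<dots> \<le> r' ^ j" using r' by (intro power_square_le_power) auto
    finally have "exp (- (real j)\<^sup>2 / (4 * c)) \<le> r' ^ j" .
    then show "w j \<le> 2 * r' ^ j" unfolding w_def using r' by (auto intro!: mult_mono)
  qed (simp add: w_def)
  have sr': "summable (\<lambda>m. 2 * r' ^ m)" using r' by (intro summable_mult summable_geometric) auto
  define H where "H = (\<lambda>y. \<Sum>j. w j * cos (real j * y))"
  have wb: "\<bar>w j * cos (real j * y)\<bar> \<le> 2 * r' ^ j" for j y
  proof -
    have "\<bar>w j * cos (real j * y)\<bar> \<le> w j * 1" unfolding abs_mult using w[of j] by (intro mult_mono) auto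
    then show ?thesis using w[of j] by simp
  qed
  have Hs: "(\<lambda>j. w j * cos (real j * y)) sums H y" for y
    unfolding H_def using wb by (intro summable_sums summable_comparison_test[OF _ sr']) auto
  have contF: "continuous_on {0..pi} F"
  proof (rule uniform_limit_theorem)
    show "uniform_limit {0..pi} (\<lambda>n y. \<Sum>m<n. u m y) F sequentially"
      unfolding F_def by (rule Weierstrass_m_test[OF _ sr]) (use ub in auto)
  qed (auto intro!: eventuallyI continuous_on_sum uc)
  have contH: "continuous_on {0..pi} H"
  proof (rule uniform_limit_theorem)
    show "uniform_limit {0..pi} (\<lambda>n y. \<Sum>j<n. w j * cos (real j * y)) H sequentially"
      unfolding H_def by (rule Weierstrass_m_test[OF _ sr']) (use wb in auto)
  qed (auto intro!: eventuallyI continuous_intros)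
  \<comment> \<open>Uniform convergence permits integration term by term, and unfolding turns the
    partial sums into integrals of the Gaussian over n whole periods.\<close>
  have IF: "integral {0..pi} (\<lambda>y. F y * cos (real i * y)) = sqrt (pi / c) * exp (- (real i)\<^sup>2 / (4 * c)) / 2" for i
  proof -
    have ul: "uniform_limit {0..pi} (\<lambda>n y. \<Sum>m<n. u m y * cos (real i * y)) (\<lambda>y. \<Sum>m. u m y * cos (real i * y)) sequentially"
    proof (rule Weierstrass_m_test[OF _ sr])
      fix m y assume "y \<in> {0..pi}"
      have "\<bar>u m y\<bar> * \<bar>cos (real i * y)\<bar> \<le> (2 * r ^ m) * 1" using ub[OF \<open>y \<in> _\<close>, of m] r by (intro mult_mono) auto
      then show "norm (u m y * cos (real i * y)) \<le> 2 * r ^ m" by (simp add: abs_mult)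
    qed
    obtain I J where IJ: "\<And>n. ((\<lambda>y. \<Sum>m<n. u m y * cos (real i * y)) has_integral I n) {0..pi}"
      "((\<lambda>y. \<Sum>m. u m y * cos (real i * y)) has_integral J) {0..pi}" "I \<longlonglongrightarrow> J"
      by (rule uniform_limit_integral[OF ul]) (auto intro!: continuous_intros uc)
    have "I n = integral {0..2 * pi * real n} (\<lambda>y. G y * cos (real i * y))" for n
      using IJ(1)[of n] integral_periodized_cos[OF Gc, of i n] unfolding u_def by (rule has_integral_unique)
    then have "I \<longlonglongrightarrow> sqrt (pi / c) * exp (- (real i)\<^sup>2 / (4 * c)) / 2"
      using gaussian_cos_integral_LIMSEQ[OF c, of "real i"] unfolding G_def by presburger
    then have J: "J = sqrt (pi / c) * exp (- (real i)\<^sup>2 / (4 * c)) / 2" using IJ(3) LIMSEQ_unique by blast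
    have "((\<lambda>y. F y * cos (real i * y)) has_integral J) {0..pi}"
    proof (rule has_integral_eq[OF _ IJ(2)])
      fix y assume "y \<in> {0..pi}"
      from sums_mult2[OF Fs[OF this], of "cos (real i * y)"]
      show "(\<Sum>m. u m y * cos (real i * y)) = F y * cos (real i * y)" by (simp add: sums_iff)
    qed
    then show ?thesis using J by (simp add: integral_unique)
  qed
  \<comment> \<open>Orthogonality keeps only the i-th term; the weight 2 for positive j compensates
    the integral pi / 2 in place of pi.\<close>
  have IH: "integral {0..pi} (\<lambda>y. H y * cos (real i * y)) = pi * exp (- (real i)\<^sup>2 / (4 * c))" for i
  proof -
    have ul: "uniform_limit {0..pi} (\<lambda>n y. \<Sum>j<n. w j * cos (real j * y) * cos (real i * y)) (\<lambda>y. \<Sum>j. w j * cos (real j * y) * cos (real i * y)) sequentially"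
    proof (rule Weierstrass_m_test[OF _ sr'])
      fix j and y :: real
      have "\<bar>w j * cos (real j * y)\<bar> * \<bar>cos (real i * y)\<bar> \<le> (2 * r' ^ j) * 1" using wb[of j y] r' by (intro mult_mono) auto
      then show "norm (w j * cos (real j * y) * cos (real i * y)) \<le> 2 * r' ^ j" by (simp add: abs_mult)
    qed
    obtain I J where IJ: "\<And>n. ((\<lambda>y. \<Sum>j<n. w j * cos (real j * y) * cos (real i * y)) has_integral I n) {0..pi}"
      "((\<lambda>y. \<Sum>j. w j * cos (real j * y) * cos (real i * y)) has_integral J) {0..pi}" "I \<longlonglongrightarrow> J"
      by (rule uniform_limit_integral[OF ul]) (auto intro!: continuous_intros)
    define v where "v = (\<lambda>j. if j = i then pi * exp (- (real i)\<^sup>2 / (4 * c)) else 0)"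
    have "I n = (\<Sum>j<n. v j)" for n
    proof (rule has_integral_unique[OF IJ(1)], rule has_integral_sum)
      fix j
      have "((\<lambda>y. cos (real j * y) * cos (real i * y)) has_integral (if j = i then if i = 0 then pi else pi / 2 else 0)) {0..pi}"
        using integral_cos_cos[of j i] by (simp add: has_integral_integrable_integral integrable_continuous_interval continuous_intros)
      from has_integral_mult_right[OF this, of "w j"]
      show "((\<lambda>y. w j * cos (real j * y) * cos (real i * y)) has_integral v j) {0..pi}"
        unfolding v_def w_def by (auto simp: mult.assoc mult.commute[of pi] split: if_splits)
    qed auto
    moreover have "(\<lambda>n. \<Sum>j<n. v j) \<longlonglongrightarrow> pi * exp (- (real i)\<^sup>2 / (4 * c))"
      using sums_single[of i "\<lambda>_. pi * exp (- (real i)\<^sup>2 / (4 * c))"] unfolding v_def sums_def by simp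
    ultimately have J: "J = pi * exp (- (real i)\<^sup>2 / (4 * c))" using IJ(3) LIMSEQ_unique[of I] by presburger
    have "((\<lambda>y. H y * cos (real i * y)) has_integral J) {0..pi}"
    proof (rule has_integral_eq[OF _ IJ(2)])
      fix y
      from sums_mult2[OF Hs, of y "cos (real i * y)"]
      show "(\<Sum>j. w j * cos (real j * y) * cos (real i * y)) = H y * cos (real i * y)" by (simp add: sums_iff)
    qed
    then show ?thesis using J by (simp add: integral_unique)
  qed
  \<comment> \<open>The quotient of the moments: sqrt (pi / c) / 2 against pi.\<close>
  define \<kappa> where "\<kappa> = 1 / (2 * sqrt (pi * c))"
  have \<kappa>: "\<kappa> * pi = sqrt (pi / c) / 2"
  proof -
    have "pi / sqrt (pi * c) = sqrt (pi / c)"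
    proof -
      have "pi / (sqrt pi * sqrt c) = (pi / sqrt pi) / sqrt c" by simp
      then show ?thesis by (simp only: real_sqrt_mult real_sqrt_divide real_div_sqrt[OF pi_ge_zero])
    qed
    then show ?thesis unfolding \<kappa>_def by simp
  qed
  have "F y - \<kappa> * H y = 0"
  proof (rule cos_moments_eq_0_imp_eq_0[OF _ _ y])
    show "continuous_on {0..pi} (\<lambda>y. F y - \<kappa> * H y)"
      by (intro continuous_intros contF contH)
    fix i :: nat
    have i1: "(\<lambda>y. F y * cos (real i * y)) integrable_on {0..pi}" "(\<lambda>y. H y * cos (real i * y)) integrable_on {0..pi}"
      by (auto intro!: integrable_continuous_interval continuous_intros contF contH)
    have "integral {0..pi} (\<lambda>y. (F y - \<kappa> * H y) * cos (real i * y)) = integral {0..pi} (\<lambda>y. F y * cos (real i * y) - \<kappa> * (H y * cos (real i * y)))"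
      by (simp add: algebra_simps)
    also have "\<dots> = integral {0..pi} (\<lambda>y. F y * cos (real i * y)) - \<kappa> * integral {0..pi} (\<lambda>y. H y * cos (real i * y))"
      using i1 by (subst integral_diff) (auto intro: integrable_on_mult_right)
    also have "\<dots> = 0" unfolding IF IH using \<kappa> by (simp add: mult.assoc[symmetric])
    finally show "integral {0..pi} (\<lambda>y. (F y - \<kappa> * H y) * cos (real i * y)) = 0" .
  qed
  then have "F y = \<kappa> * H y" by simp
  then show ?thesis using Fs[OF y] unfolding u_def \<kappa>_def H_def w_def by simp
qed

text \<open>The theta series over all integers j with terms exp (- pi j^2 / t + 2 pi i j x), with j
  and - j folded into a cosine. It is the side of Poisson's formula that converges fast for small
  t.\<close>

definition dual_theta :: "real \<Rightarrow> real \<Rightarrow> real" where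
  "dual_theta t x = (\<Sum>j. (if j = 0 then 1 else 2) * exp (- pi * (real j)\<^sup>2 / t) * cos (2 * pi * real j * x))"

text \<open>The half-period identity at y = 2 pi x, c = t / (4 pi). Its m-th term pairs the integers
  - m and m + 1; nonnegativity allows the pairs to be taken apart and summed unordered.\<close>

lemma gaussian_poisson_half_unit:
  assumes t: "t > 0" and x: "0 \<le> x" "x \<le> 1/2"
  shows "((\<lambda>k::int. exp (- pi * t * (of_int k - x)\<^sup>2)) has_sum (dual_theta t x / sqrt t)) UNIV"
proof -
  define a where "a = (\<lambda>k::int. exp (- pi * t * (of_int k - x)\<^sup>2))"
  define c where "c = t / (4 * pi)"
  have c: "c > 0" unfolding c_def using t by simp
  have ct: "c * (4 * pi\<^sup>2) = pi * t" unfolding c_def by (simp add: power2_eq_square)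
  have g1: "exp (- c * (2 * pi * x + 2 * pi * real m)\<^sup>2) = a (- int m)" for m
  proof -
    have "c * (2 * pi * x + 2 * pi * real m)\<^sup>2 = c * (4 * pi\<^sup>2) * (real m + x)\<^sup>2" by (simp add: power2_eq_square algebra_simps)
    also have "(real m + x)\<^sup>2 = (- real m - x)\<^sup>2" by (simp add: power2_eq_square algebra_simps)
    finally show ?thesis unfolding a_def ct by simp
  qed
  have g2: "exp (- c * (2 * pi * (real m + 1) - 2 * pi * x)\<^sup>2) = a (int m + 1)" for m
  proof -
    have "c * (2 * pi * (real m + 1) - 2 * pi * x)\<^sup>2 = c * (4 * pi\<^sup>2) * (real m + 1 - x)\<^sup>2" by (simp add: power2_eq_square algebra_simps)
    then show ?thesis unfolding a_def ct by simp
  qed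
  have y: "2 * pi * x \<in> {0..pi}" using x mult_left_mono[of x "1/2" "2 * pi"] by simp
  have k1: "1 / (2 * sqrt (pi * c)) = 1 / sqrt t"
    unfolding c_def by (simp add: real_sqrt_divide)
  have k2: "- (real j)\<^sup>2 / (4 * c) = - pi * (real j)\<^sup>2 / t" "real j * (2 * pi * x) = 2 * pi * real j * x" for j
    unfolding c_def by simp_all
  have S: "(\<lambda>m. a (- int m) + a (int m + 1)) sums (dual_theta t x / sqrt t)"
    using gaussian_poisson_half_period[OF c y] unfolding g1 g2 k1 k2 dual_theta_def by simp
  have nn: "a k \<ge> 0" for k unfolding a_def by simp
  have s1: "summable (\<lambda>m. a (- int m))"
    by (rule summable_comparison_test[OF _ sums_summable[OF S]]) (use nn in \<open>auto intro!: exI[of _ 0]\<close>)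
  have s2: "summable (\<lambda>m. a (int m + 1))"
    by (rule summable_comparison_test[OF _ sums_summable[OF S]]) (use nn in \<open>auto intro!: exI[of _ 0]\<close>)
  have h1: "(a has_sum (\<Sum>m. a (- int m))) {..0}"
  proof -
    have "((\<lambda>m. a (- int m)) has_sum (\<Sum>m. a (- int m))) UNIV"
      by (rule sums_nonneg_imp_has_sum[OF summable_sums[OF s1] nn])
    then show ?thesis
      by (rule has_sum_reindex_bij_witness[where i = "\<lambda>k. nat (- k)" and j = "\<lambda>m. - int m", THEN iffD1, rotated -1]) auto
  qed
  have h2: "(a has_sum (\<Sum>m. a (int m + 1))) {1..}"
  proof -
    have "((\<lambda>m. a (int m + 1)) has_sum (\<Sum>m. a (int m + 1))) UNIV"
      by (rule sums_nonneg_imp_has_sum[OF summable_sums[OF s2] nn])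
    then show ?thesis
      by (rule has_sum_reindex_bij_witness[where i = "\<lambda>k. nat (k - 1)" and j = "\<lambda>m. int m + 1", THEN iffD1, rotated -1]) auto
  qed
  have "(a has_sum ((\<Sum>m. a (- int m)) + (\<Sum>m. a (int m + 1)))) ({..0} \<union> {1..})"
    by (rule has_sum_Un_disjoint[OF h1 h2]) auto
  moreover have "{..0} \<union> {1..} = (UNIV :: int set)" by auto
  moreover have "(\<Sum>m. a (- int m)) + (\<Sum>m. a (int m + 1)) = dual_theta t x / sqrt t"
    using S s1 s2 by (simp add: suminf_add sums_iff)
  ultimately show ?thesis unfolding a_def by simp
qed

lemma dual_theta_reduce:
  shows "dual_theta t (of_int n + x) = dual_theta t x" "dual_theta t (of_int n - x) = dual_theta t x"
proof -
  have p: "cos (2 * pi * real j * (of_int n + y)) = cos (2 * pi * real j * y)" for j y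
  proof -
    have "2 * pi * real j * (of_int n + y) = 2 * pi * real j * y + 2 * pi * of_int (int j * n)" by (simp add: algebra_simps)
    then show ?thesis
      using cos_int_2pin[of "int j * n"] sin_int_2pin[of "int j * n"] by (simp only: cos_add)
  qed
  show "dual_theta t (of_int n + x) = dual_theta t x" unfolding dual_theta_def p ..
  have "cos (2 * pi * real j * (of_int n - x)) = cos (2 * pi * real j * x)" for j
    using p[of j "- x"] by simp
  then show "dual_theta t (of_int n - x) = dual_theta t x" unfolding dual_theta_def by simp
qed

text \<open>Both sides are even and 1-periodic in x, so x can be moved into [0, 1/2] by subtracting
  the nearest integer and, if necessary, reflecting.\<close>

lemma gaussian_poisson:
  assumes t: "t > 0"
  shows "((\<lambda>k::int. exp (- pi * t * (of_int k - x)\<^sup>2)) has_sum (dual_theta t x / sqrt t)) UNIV"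
proof -
  define n where "n = round x"
  define d where "d = x - of_int n"
  have d: "\<bar>d\<bar> \<le> 1/2" unfolding d_def n_def using of_int_round_abs_le[of x] by (simp add: abs_minus_commute)
  show ?thesis
  proof (cases "d \<ge> 0")
    case True
    have "((\<lambda>k::int. exp (- pi * t * (of_int k - d)\<^sup>2)) has_sum (dual_theta t d / sqrt t)) UNIV"
      using True d by (intro gaussian_poisson_half_unit t) auto
    moreover have "dual_theta t x = dual_theta t d" using dual_theta_reduce(1)[of t n d] unfolding d_def by simp
    moreover have "((\<lambda>k::int. exp (- pi * t * (of_int (k - n) - d)\<^sup>2)) has_sum S) UNIV \<longleftrightarrow> ((\<lambda>k::int. exp (- pi * t * (of_int k - d)\<^sup>2)) has_sum S) UNIV" for S
      by (rule has_sum_reindex_bij_betw) (auto intro!: bij_betwI[of _ _ _ "\<lambda>k. k + n"])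
    moreover have "of_int (k - n) - d = of_int k - x" for k unfolding d_def by simp
    ultimately show ?thesis by (simp only:)
  next
    case False
    have "((\<lambda>k::int. exp (- pi * t * (of_int k - (- d))\<^sup>2)) has_sum (dual_theta t (- d) / sqrt t)) UNIV"
      using False d by (intro gaussian_poisson_half_unit t) auto
    moreover have "dual_theta t x = dual_theta t (- d)" using dual_theta_reduce(2)[of t n "- d"] unfolding d_def by simp
    moreover have "((\<lambda>k::int. exp (- pi * t * (of_int (n - k) - (- d))\<^sup>2)) has_sum S) UNIV \<longleftrightarrow> ((\<lambda>k::int. exp (- pi * t * (of_int k - (- d))\<^sup>2)) has_sum S) UNIV" for S
      by (rule has_sum_reindex_bij_betw) (auto intro!: bij_betwI[of _ _ _ "\<lambda>k. n - k"])
    moreover have "(of_int (n - k) - (- d))\<^sup>2 = (of_int k - x)\<^sup>2" for k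
      unfolding d_def by (simp add: power2_commute)
    ultimately show ?thesis by (simp only:)
  qed
qed

text \<open>As (i + p)^2 \<ge> i + p^2, the tail is dominated by a geometric series of ratio exp (-
  pi / t) \<le> 2 / 3; thus 6 is 2 times 1 / (1 - 2 / 3). The range up to 4 allows the use at 4 t
  for the alternating sum.\<close>

lemma dual_theta_approx:
  assumes t: "0 < t" "t \<le> 4"
  shows "\<bar>dual_theta t x - (\<Sum>j<p. (if j = 0 then 1 else 2) * exp (- pi * (real j)\<^sup>2 / t) * cos (2 * pi * real j * x))\<bar> \<le> 6 * exp (- pi * (real p)\<^sup>2 / t)"
proof -
  define w where "w = (\<lambda>j::nat. (if j = 0 then 1 else 2) * exp (- pi * (real j)\<^sup>2 / t) * cos (2 * pi * real j * x))"
  define r where "r = exp (- pi / t)"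
  have r: "0 < r" "r \<le> 2 / 3"
  proof -
    have "1 + 1 / 2 \<le> 1 + pi / 4" using pi_ge_two by simp
    also have "\<dots> \<le> 1 + pi / t" using t by (intro add_left_mono divide_left_mono) auto
    also have "\<dots> \<le> exp (pi / t)" by (rule exp_ge_add_one_self)
    finally have "3 / 2 \<le> exp (pi / t)" by simp
    then have "inverse (exp (pi / t)) \<le> inverse (3 / 2)" by (intro le_imp_inverse_le) auto
    then show "r \<le> 2 / 3" unfolding r_def by (simp add: exp_minus)
  qed (simp add: r_def)
  have wb: "\<bar>w (i + p)\<bar> \<le> 2 * exp (- pi * (real p)\<^sup>2 / t) * r ^ i" for i p
  proof -
    have "real i \<le> (real i)\<^sup>2" by (cases i) (auto simp: power2_eq_square)
    moreover have "(real (i + p))\<^sup>2 = (real i)\<^sup>2 + 2 * (real i * real p) + (real p)\<^sup>2" by (simp add: power2_eq_square algebra_simps)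
    moreover have "real i * real p \<ge> 0" by simp
    ultimately have "real i + (real p)\<^sup>2 \<le> (real (i + p))\<^sup>2" by linarith
    then have "pi / t * (real i + (real p)\<^sup>2) \<le> pi / t * (real (i + p))\<^sup>2" using t by (intro mult_left_mono) auto
    then have "exp (- pi * (real (i + p))\<^sup>2 / t) \<le> exp (- (pi / t * (real i + (real p)\<^sup>2)))" by simp
    also have "\<dots> = exp (- pi * (real p)\<^sup>2 / t) * r ^ i"
      unfolding r_def exp_of_nat_mult[symmetric] exp_add[symmetric] by (simp add: field_simps add_divide_distrib)
    finally have e: "exp (- pi * (real (i + p))\<^sup>2 / t) \<le> exp (- pi * (real p)\<^sup>2 / t) * r ^ i" .
    have "\<bar>w (i + p)\<bar> = (if i + p = 0 then 1 else 2) * exp (- pi * (real (i + p))\<^sup>2 / t) * \<bar>cos (2 * pi * real (i + p) * x)\<bar>"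
      unfolding w_def abs_mult by (simp only: abs_exp_cancel if_distrib[of abs] abs_numeral abs_one)
    also have "\<dots> \<le> 2 * (exp (- pi * (real p)\<^sup>2 / t) * r ^ i) * 1"
      using e by (intro mult_mono) (auto simp: r(1) less_imp_le)
    finally show ?thesis by simp
  qed
  have sr: "(\<lambda>i. 2 * exp (- pi * (real p)\<^sup>2 / t) * r ^ i) sums (2 * exp (- pi * (real p)\<^sup>2 / t) * (1 / (1 - r)))" for p :: nat
    using r by (intro sums_mult geometric_sums) auto
  have sw: "summable w"
    using wb[of _ 0] by (intro summable_comparison_test[OF _ sums_summable[OF sr[of 0]]]) auto
  have sw': "summable (\<lambda>i. \<bar>w (i + p)\<bar>)"
    using wb[of _ p] by (intro summable_comparison_test[OF _ sums_summable[OF sr[of p]]]) auto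
  have "dual_theta t x - (\<Sum>j<p. w j) = (\<Sum>i. w (i + p))"
    unfolding dual_theta_def w_def[symmetric] using suminf_split_initial_segment[OF sw, of p] by simp
  also have "\<bar>\<dots>\<bar> \<le> (\<Sum>i. \<bar>w (i + p)\<bar>)" using sw' by (rule summable_rabs)
  also have "\<dots> \<le> 2 * exp (- pi * (real p)\<^sup>2 / t) * (1 / (1 - r))"
    using suminf_le[OF wb sw' sums_summable[OF sr]] sr[of p] by (simp add: sums_iff)
  also have "\<dots> \<le> 2 * exp (- pi * (real p)\<^sup>2 / t) * 3"
    using r by (intro mult_left_mono) (auto simp: divide_le_eq)
  finally show ?thesis unfolding w_def by simp
qed

lemma gaussian_sum_approx:
  assumes t: "0 < t" "t \<le> 1" and S: "((\<lambda>k::int. exp (- pi * t * (of_int k - x)\<^sup>2)) has_sum S) UNIV"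
  shows "\<bar>sqrt t * S - 1\<bar> \<le> 6 * exp (- pi / t)"
proof -
  have "S = dual_theta t x / sqrt t" using S gaussian_poisson[OF t(1)] by (rule has_sum_unique)
  then have "sqrt t * S = dual_theta t x" using t by simp
  then show ?thesis using dual_theta_approx[of t x 1] t by simp
qed

text \<open>
  The alternating sum is twice the sum over the even integers minus the full sum.
\<close>

lemma alternating_gaussian_sum:
  assumes t: "t > 0"
  shows "((\<lambda>k::int. (if even k then 1 else - 1) * exp (- pi * t * (of_int k - x)\<^sup>2)) has_sum ((dual_theta (4 * t) (x / 2) - dual_theta t x) / sqrt t)) UNIV"
proof -
  define a where "a = (\<lambda>k::int. exp (- pi * t * (of_int k - x)\<^sup>2))"
  have "((\<lambda>k::int. exp (- pi * (4 * t) * (of_int k - x / 2)\<^sup>2)) has_sum (dual_theta (4 * t) (x / 2) / sqrt (4 * t))) UNIV"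
    using t by (intro gaussian_poisson) auto
  moreover have "exp (- pi * (4 * t) * (of_int k - x / 2)\<^sup>2) = a (2 * k)" for k
    unfolding a_def by (simp add: power2_eq_square algebra_simps)
  ultimately have "((\<lambda>k. a (2 * k)) has_sum (dual_theta (4 * t) (x / 2) / sqrt (4 * t))) UNIV" by simp
  then have "(a has_sum (dual_theta (4 * t) (x / 2) / sqrt (4 * t))) {k. even k}"
    by (rule has_sum_reindex_bij_witness[where i = "\<lambda>k. k div 2" and j = "\<lambda>k. 2 * k", THEN iffD1, rotated -1]) auto
  then have "((\<lambda>k. 2 * a k) has_sum (2 * (dual_theta (4 * t) (x / 2) / sqrt (4 * t)))) {k. even k}"
    by (rule has_sum_cmult_right)
  then have "((\<lambda>k. if even k then 2 * a k else 0) has_sum (2 * (dual_theta (4 * t) (x / 2) / sqrt (4 * t)))) UNIV"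
    by (subst has_sum_cong_neutral[where T = "{k. even k}" and g = "\<lambda>k. 2 * a k"]) auto
  from has_sum_add[OF this has_sum_cmult_right[OF gaussian_poisson[OF t, of x], of "- 1"]]
  have "((\<lambda>k. (if even k then 2 * a k else 0) - a k) has_sum (2 * (dual_theta (4 * t) (x / 2) / sqrt (4 * t)) - dual_theta t x / sqrt t)) UNIV"
    unfolding a_def by simp
  moreover have "(if even k then 2 * a k else 0) - a k = (if even k then 1 else - 1) * a k" for k by simp
  \<comment> \<open>The factor 2 disappears against sqrt (4 t) = 2 sqrt t.\<close>
  moreover have "2 * (dual_theta (4 * t) (x / 2) / sqrt (4 * t)) - dual_theta t x / sqrt t = (dual_theta (4 * t) (x / 2) - dual_theta t x) / sqrt t"
    using t by (simp add: real_sqrt_mult diff_divide_distrib)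
  ultimately show ?thesis unfolding a_def by (simp only:)
qed

text \<open>The constant terms of the two theta series cancel. Truncating the one at 4 t after two
  terms and the one at t after one leaves the same error exp (- pi / t), and only the first cosine
  at 4 t remains.\<close>

lemma alternating_gaussian_sum_approx:
  assumes t: "0 < t" "t \<le> 1"
    and S: "((\<lambda>k::int. (if even k then 1 else - 1) * exp (- pi * t * (of_int k - x)\<^sup>2)) has_sum S) UNIV"
  shows "\<bar>sqrt t * S - 2 * exp (- pi / (4 * t)) * cos (pi * x)\<bar> \<le> 12 * exp (- pi / t)"
proof -
  have "S = (dual_theta (4 * t) (x / 2) - dual_theta t x) / sqrt t"
    using S alternating_gaussian_sum[OF t(1)] by (rule has_sum_unique)
  then have "sqrt t * S = dual_theta (4 * t) (x / 2) - dual_theta t x" using t by simp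
  moreover have "\<bar>dual_theta t x - 1\<bar> \<le> 6 * exp (- pi / t)"
    using dual_theta_approx[of t x 1] t by simp
  moreover have "\<bar>dual_theta (4 * t) (x / 2) - (1 + 2 * exp (- pi / (4 * t)) * cos (pi * x))\<bar> \<le> 6 * exp (- pi / t)"
    using dual_theta_approx[of "4 * t" "x / 2" 2] t by (simp add: numeral_2_eq_2)
  ultimately show ?thesis by linarith
qed

section \<open>Gaussian form of the basic hypergeometric series\<close>

text \<open>The effect of replacing all coefficients by 1 is at most \<eta> times the Gaussian from
  n on. Below n the distance to x is at least n / 2: half of the exponent yields exp (- pi t n^2 /
  8), and the other half, a Gaussian with t / 2, keeps the sum convergent.\<close>

lemma weighted_gaussian_sum:
  fixes d :: "nat \<Rightarrow> real" and \<sigma> :: "int \<Rightarrow> real"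
  defines "a \<equiv> \<lambda>x t k::int. exp (- pi * t * (of_int k - x)\<^sup>2)"
  assumes t: "0 < t" "t \<le> 1" and \<sigma>: "\<And>k. \<bar>\<sigma> k\<bar> \<le> 1"
    and S: "((\<lambda>k. \<sigma> k * a x t k) has_sum S) UNIV"
    and d1: "\<And>k. \<bar>d k\<bar> \<le> B" and d2: "\<And>k. k \<ge> n \<Longrightarrow> \<bar>d k - 1\<bar> \<le> \<eta>"
    and x: "3 * real n / 2 \<le> x" and \<eta>: "\<eta> \<ge> 0"
  shows "\<exists>T. (\<lambda>k. \<sigma> (int k) * d k * a x t (int k)) sums T \<and>
     sqrt t * \<bar>T - S\<bar> \<le> 10 * (\<eta> + (B + 1) * exp (- pi * t * (real n)\<^sup>2 / 8))"
proof -
  have B: "B \<ge> 0" using d1[of 0] by linarith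
  \<comment> \<open>Extended by 0, the absent terms with negative k deviate from 1 by 1, so the
    bound B + 1 for the terms below n covers them.\<close>
  define D where "D = (\<lambda>k::int. if k \<ge> 0 then d (nat k) else 0)"
  define c where "c = (B + 1) * exp (- pi * t * (real n)\<^sup>2 / 8)"
  have c: "c \<ge> 0" unfolding c_def using B by simp
  define A1 where "A1 = dual_theta t x / sqrt t"
  define A2 where "A2 = dual_theta (t / 2) x / sqrt (t / 2)"
  have A1: "(a x t has_sum A1) UNIV" unfolding a_def A1_def using t by (intro gaussian_poisson) auto
  have A2: "(a x (t / 2) has_sum A2) UNIV" unfolding a_def A2_def using t by (intro gaussian_poisson) auto
  have b: "sqrt t' * A \<le> 7" if "0 < t'" "t' \<le> 1" "(a x t' has_sum A) UNIV" for t' A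
  proof -
    have "\<bar>sqrt t' * A - 1\<bar> \<le> 6 * exp (- pi / t')"
      using that unfolding a_def by (intro gaussian_sum_approx) auto
    moreover have "exp (- pi / t') \<le> 1" using that by simp
    ultimately show ?thesis by linarith
  qed
  have b1: "sqrt t * A1 \<le> 10" using b[OF _ _ A1] t by simp
  \<comment> \<open>A normalized Gaussian sum is at most 1 + 6 = 7; passing from t / 2 to t costs
    sqrt 2, and 7 sqrt 2 \<le> 10.\<close>
  have b2: "sqrt t * A2 \<le> 10"
  proof -
    have "sqrt t = sqrt 2 * sqrt (t / 2)" by (simp add: real_sqrt_mult[symmetric])
    then have "sqrt t * A2 = sqrt 2 * (sqrt (t / 2) * A2)" by simp
    also have "\<dots> \<le> sqrt 2 * 7" using b[OF _ _ A2] t by (intro mult_left_mono) auto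
    also have "sqrt 2 \<le> 10 / 7" by (rule real_le_lsqrt) (auto simp: power2_eq_square)
    finally show ?thesis by simp
  qed
  have pos: "a x t k \<ge> 0" "a x (t / 2) k \<ge> 0" for k unfolding a_def by auto
  have bd: "\<bar>\<sigma> k * (D k - 1) * a x t k\<bar> \<le> \<eta> * a x t k + c * a x (t / 2) k" for k
  proof -
    have "\<bar>\<sigma> k * (D k - 1) * a x t k\<bar> = \<bar>\<sigma> k\<bar> * (\<bar>D k - 1\<bar> * a x t k)" using pos by (simp add: abs_mult)
    also have "\<dots> \<le> 1 * (\<bar>D k - 1\<bar> * a x t k)" using \<sigma>[of k] pos by (intro mult_right_mono) auto
    also have "\<dots> \<le> \<eta> * a x t k + c * a x (t / 2) k"
    proof (cases "k \<ge> int n")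
      case True
      then have "\<bar>D k - 1\<bar> \<le> \<eta>" using d2[of "nat k"] unfolding D_def by simp
      then have "\<bar>D k - 1\<bar> * a x t k \<le> \<eta> * a x t k" using pos by (intro mult_right_mono) auto
      moreover have "c * a x (t / 2) k \<ge> 0" using c pos by simp
      ultimately show ?thesis by simp
    next
      case False
      have 1: "\<bar>D k - 1\<bar> \<le> B + 1" using d1[of "nat k"] B unfolding D_def by auto
      have "real n / 2 \<le> x - of_int k" using False x by linarith
      then have "(real n / 2)\<^sup>2 \<le> (x - of_int k)\<^sup>2" by (intro power_mono) auto
      then have "pi * t / 2 * (real n / 2)\<^sup>2 \<le> pi * t / 2 * (of_int k - x)\<^sup>2"
        using t by (intro mult_left_mono) (auto simp: power2_commute)
      then have 2: "exp (- (pi * t / 2 * (of_int k - x)\<^sup>2)) \<le> exp (- pi * t * (real n)\<^sup>2 / 8)"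
        by (simp add: power_divide)
      have "a x t k = exp (- (pi * t / 2 * (of_int k - x)\<^sup>2)) * a x (t / 2) k"
        unfolding a_def exp_add[symmetric] by (simp add: field_simps)
      also have "\<dots> \<le> exp (- pi * t * (real n)\<^sup>2 / 8) * a x (t / 2) k"
        using 2 pos by (intro mult_right_mono) auto
      finally have "\<bar>D k - 1\<bar> * a x t k \<le> (B + 1) * (exp (- pi * t * (real n)\<^sup>2 / 8) * a x (t / 2) k)"
        using 1 B pos by (intro mult_mono) auto
      moreover have "\<eta> * a x t k \<ge> 0" using \<eta> pos by simp
      ultimately show ?thesis unfolding c_def by (simp add: mult.assoc)
    qed
    finally show ?thesis .
  qed
  have G: "((\<lambda>k. \<eta> * a x t k + c * a x (t / 2) k) has_sum (\<eta> * A1 + c * A2)) UNIV"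
    by (intro has_sum_add has_sum_cmult_right A1 A2)
  have "(\<lambda>k. norm (\<sigma> k * (D k - 1) * a x t k)) summable_on UNIV"
  proof (rule Infinite_Sum.abs_summable_on_comparison_test)
    have "(\<lambda>k. \<eta> * a x t k + c * a x (t / 2) k) summable_on UNIV" using G by (auto simp: summable_on_def)
    moreover have "norm (\<eta> * a x t k + c * a x (t / 2) k) = \<eta> * a x t k + c * a x (t / 2) k" for k
      using \<eta> c pos by simp
    ultimately show "(\<lambda>k. norm (\<eta> * a x t k + c * a x (t / 2) k)) summable_on UNIV" by (simp only:)
  qed (use bd in \<open>smt (verit) real_norm_def\<close>)
  then have "(\<lambda>k. \<sigma> k * (D k - 1) * a x t k) summable_on UNIV" by (rule Infinite_Sum.abs_summable_summable)
  then obtain F where F: "((\<lambda>k. \<sigma> k * (D k - 1) * a x t k) has_sum F) UNIV" by (auto simp: summable_on_def)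
  have "norm F \<le> \<eta> * A1 + c * A2"
    by (rule norm_infsum_le[OF F G]) (use bd in simp)
  then have "sqrt t * \<bar>F\<bar> \<le> sqrt t * (\<eta> * A1 + c * A2)" using t by (intro mult_left_mono) auto
  also have "\<dots> = \<eta> * (sqrt t * A1) + c * (sqrt t * A2)" by (simp add: algebra_simps)
  also have "\<dots> \<le> \<eta> * 10 + c * 10" using b1 b2 \<eta> c by (intro add_mono mult_left_mono) auto
  finally have Fb: "sqrt t * \<bar>F\<bar> \<le> 10 * (\<eta> + c)" by simp
  have "((\<lambda>k. \<sigma> k * a x t k + \<sigma> k * (D k - 1) * a x t k) has_sum (S + F)) UNIV"
    by (rule has_sum_add[OF S F])
  moreover have "\<sigma> k * a x t k + \<sigma> k * (D k - 1) * a x t k = \<sigma> k * D k * a x t k" for k by (simp add: algebra_simps)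
  ultimately have "((\<lambda>k. \<sigma> k * D k * a x t k) has_sum (S + F)) UNIV" by simp
  then have "((\<lambda>k. \<sigma> k * D k * a x t k) has_sum (S + F)) {0..}"
    by (subst (asm) has_sum_cong_neutral[where T = "{0..}" and g = "\<lambda>k. \<sigma> k * D k * a x t k"]) (auto simp: D_def)
  then have "((\<lambda>k. \<sigma> (int k) * d k * a x t (int k)) has_sum (S + F)) UNIV"
    by (rule has_sum_reindex_bij_witness[where i = int and j = nat, THEN iffD1, rotated -1]) (auto simp: D_def)
  then have "(\<lambda>k. \<sigma> (int k) * d k * a x t (int k)) sums (S + F)" by (rule has_sum_imp_sums)
  with Fb show ?thesis unfolding c_def by (intro exI[of _ "S + F"]) simp
qed

text \<open>The k-dependent factors (a q^k; q)_\<infinity>. They divide in (a; q)_k, so upper and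
  lower parameters trade places. The factors without k are collected in
  \<open>ln_qcoeff\<close>.\<close>

definition qcoeff_ratio :: "nat \<Rightarrow> nat \<Rightarrow> (nat \<Rightarrow> real) \<Rightarrow> (nat \<Rightarrow> real) \<Rightarrow> real \<Rightarrow> nat \<Rightarrow> real" where
  "qcoeff_ratio r s \<alpha> \<beta> e k =
     qpochhammer_inf (exp (- e) * exp (- e) ^ k) (exp (- e)) *
     (\<Prod>j=1..s. qpochhammer_inf (exp (- e * \<beta> j) * exp (- e) ^ k) (exp (- e))) /
     (\<Prod>j=1..r. qpochhammer_inf (exp (- e * \<alpha> j) * exp (- e) ^ k) (exp (- e)))"

definition ln_qcoeff :: "nat \<Rightarrow> nat \<Rightarrow> (nat \<Rightarrow> real) \<Rightarrow> (nat \<Rightarrow> real) \<Rightarrow> real \<Rightarrow> real" where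
  "ln_qcoeff r s \<alpha> \<beta> e = (\<Sum>j=1..r. ln_qpochhammer (\<alpha> j) e) - ln_qpochhammer 1 e - (\<Sum>j=1..s. ln_qpochhammer (\<beta> j) e)"

lemma qcoeff_factorization:
  assumes e: "e > 0" and \<alpha>: "\<And>j. j \<in> {1..r} \<Longrightarrow> \<alpha> j > 0" and \<beta>: "\<And>j. j \<in> {1..s} \<Longrightarrow> \<beta> j > 0"
  shows "(\<Prod>j=1..r. qpochhammer (exp (- e * \<alpha> j)) (exp (- e)) k) /
    (qpochhammer (exp (- e)) (exp (- e)) k * (\<Prod>j=1..s. qpochhammer (exp (- e * \<beta> j)) (exp (- e)) k))
    = exp (ln_qcoeff r s \<alpha> \<beta> e) * qcoeff_ratio r s \<alpha> \<beta> e k"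
proof -
  have "exp (ln_qcoeff r s \<alpha> \<beta> e) = (\<Prod>j=1..r. qpochhammer_inf (exp (- e * \<alpha> j)) (exp (- e))) /
      (qpochhammer_inf (exp (- e)) (exp (- e)) * (\<Prod>j=1..s. qpochhammer_inf (exp (- e * \<beta> j)) (exp (- e))))"
  proof -
    have "(\<Prod>j=1..r. exp (ln_qpochhammer (\<alpha> j) e)) = (\<Prod>j=1..r. qpochhammer_inf (exp (- e * \<alpha> j)) (exp (- e)))"
      by (intro prod.cong refl exp_ln_qpochhammer e \<alpha>) auto
    moreover have "(\<Prod>j=1..s. exp (ln_qpochhammer (\<beta> j) e)) = (\<Prod>j=1..s. qpochhammer_inf (exp (- e * \<beta> j)) (exp (- e)))"
      by (intro prod.cong refl exp_ln_qpochhammer e \<beta>) auto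
    moreover have "exp (ln_qpochhammer 1 e) = qpochhammer_inf (exp (- e)) (exp (- e))"
      using exp_ln_qpochhammer[of 1 e] e by simp
    ultimately show ?thesis unfolding ln_qcoeff_def exp_diff by (simp add: exp_sum)
  qed
  then show ?thesis
    unfolding qcoeff_ratio_def qpochhammer_def prod_dividef by (simp add: mult_ac)
qed

lemma prod_in_unit_interval:
  fixes f :: "nat \<Rightarrow> real"
  assumes "\<And>j. j \<in> A \<Longrightarrow> 1 - \<delta> \<le> f j" "\<And>j. j \<in> A \<Longrightarrow> f j \<le> 1" "\<And>j. j \<in> A \<Longrightarrow> 0 \<le> f j" 
  shows "1 - real (card A) * \<delta> \<le> (\<Prod>j\<in>A. f j)" "(\<Prod>j\<in>A. f j) \<le> 1"
proof -
  have "1 - (\<Sum>j\<in>A. 1 - f j) \<le> (\<Prod>j\<in>A. 1 - (1 - f j))"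
    using assms by (intro Weierstrass_prod_ineq) auto
  moreover have "(\<Sum>j\<in>A. 1 - f j) \<le> real (card A) * \<delta>"
    using assms(1) by (intro sum_bounded_above) (auto simp: algebra_simps)
  ultimately show "1 - real (card A) * \<delta> \<le> (\<Prod>j\<in>A. f j)" by simp
  show "(\<Prod>j\<in>A. f j) \<le> 1" using assms by (intro prod_le_1) auto
qed

text \<open>Every factor (q^a q^k; q)_\<infinity> lies between (q^a; q)_\<infinity> and 1, which
  gives the crude bound for all k. For k \<ge> n it is also at least 1 - q^n / (1 - q), and
  Weierstrass' inequality adds up the deviations. The condition with 1 / 2 keeps the denominator
  product at least 1 / 2.\<close>

lemma qcoeff_ratio_bounds:
  assumes e: "e > 0" and \<alpha>: "\<And>j. j \<in> {1..r} \<Longrightarrow> \<alpha> j > 0" and \<beta>: "\<And>j. j \<in> {1..s} \<Longrightarrow> \<beta> j > 0"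
  shows "\<bar>qcoeff_ratio r s \<alpha> \<beta> e k\<bar> \<le> exp (- (\<Sum>j=1..r. ln_qpochhammer (\<alpha> j) e))"
    and "n \<le> k \<Longrightarrow> real r * (exp (- e * real n) / (1 - exp (- e))) \<le> 1 / 2 \<Longrightarrow>
      \<bar>qcoeff_ratio r s \<alpha> \<beta> e k - 1\<bar> \<le> 2 * real (r + s + 1) * (exp (- e * real n) / (1 - exp (- e)))"
proof -
  define f where "f = (\<lambda>a. qpochhammer_inf (exp (- e * a) * exp (- e) ^ k) (exp (- e)))"
  have q: "0 < exp (- e)" "exp (- e) < 1" using e by auto
  have y: "0 \<le> exp (- e * a) * exp (- e) ^ k" "exp (- e * a) * exp (- e) ^ k < 1"
    "exp (- e * a) * exp (- e) ^ k \<le> exp (- e * a)" "exp (- e * a) < 1"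
    "exp (- e * a) * exp (- e) ^ k \<le> exp (- e) ^ k" if "a > 0" for a
  proof -
    show 1: "exp (- e * a) < 1" using that e by simp
    show "exp (- e * a) * exp (- e) ^ k < 1" by (rule mult_power_less_one[OF q _ 1]) simp
    show "exp (- e * a) * exp (- e) ^ k \<le> exp (- e * a)" using q by (intro mult_left_le) (auto intro: power_le_one)
    show "exp (- e * a) * exp (- e) ^ k \<le> exp (- e) ^ k" using 1 by (intro mult_left_le_one_le) auto
  qed auto
  have f: "0 < f a" "f a \<le> 1" "exp (ln_qpochhammer a e) \<le> f a" "1 - exp (- e) ^ k / (1 - exp (- e)) \<le> f a" if "a > 0" for a
  proof -
    show "0 < f a" unfolding f_def using y[OF that] q by (intro qpochhammer_inf_pos) auto
    show "f a \<le> 1" unfolding f_def using y[OF that] q by (intro qpochhammer_inf_le_1) auto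
    show "exp (ln_qpochhammer a e) \<le> f a" unfolding f_def exp_ln_qpochhammer[OF that e] using y[OF that] q
      by (intro qpochhammer_inf_antimono) auto
    have "1 - exp (- e) ^ k / (1 - exp (- e)) \<le> 1 - exp (- e * a) * exp (- e) ^ k / (1 - exp (- e))"
      using y(5)[OF that] q by (intro diff_left_mono divide_right_mono) auto
    also have "\<dots> \<le> f a" unfolding f_def using y[OF that] q by (intro qpochhammer_inf_ge) auto
    finally show "1 - exp (- e) ^ k / (1 - exp (- e)) \<le> f a" .
  qed
  have d: "qcoeff_ratio r s \<alpha> \<beta> e k = f 1 * (\<Prod>j=1..s. f (\<beta> j)) / (\<Prod>j=1..r. f (\<alpha> j))"
    unfolding qcoeff_ratio_def f_def by simp
  have p\<alpha>: "(\<Prod>j=1..r. f (\<alpha> j)) > 0" using \<alpha> by (intro prod_pos) (auto intro: f)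
  have p\<beta>: "(\<Prod>j=1..s. f (\<beta> j)) > 0" using \<beta> by (intro prod_pos) (auto intro: f)
  have p\<beta>': "(\<Prod>j=1..s. f (\<beta> j)) \<le> 1" using \<beta> by (intro prod_le_1) (auto intro: f less_imp_le)
  have n1: "f 1 * (\<Prod>j=1..s. f (\<beta> j)) \<le> 1" using f(1,2)[of 1] p\<beta> p\<beta>' by (intro mult_le_one) auto
  show "\<bar>qcoeff_ratio r s \<alpha> \<beta> e k\<bar> \<le> exp (- (\<Sum>j=1..r. ln_qpochhammer (\<alpha> j) e))"
  proof -
    have 1: "(\<Prod>j=1..r. exp (ln_qpochhammer (\<alpha> j) e)) \<le> (\<Prod>j=1..r. f (\<alpha> j))"
      using \<alpha> by (intro prod_mono) (auto intro: f)
    have 2: "(\<Prod>j=1..r. exp (ln_qpochhammer (\<alpha> j) e)) > 0" by (intro prod_pos) auto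
    have "\<bar>qcoeff_ratio r s \<alpha> \<beta> e k\<bar> = f 1 * (\<Prod>j=1..s. f (\<beta> j)) / (\<Prod>j=1..r. f (\<alpha> j))"
      unfolding d using p\<alpha> p\<beta> f(1)[of 1] by simp
    also have "\<dots> \<le> 1 / (\<Prod>j=1..r. exp (ln_qpochhammer (\<alpha> j) e))"
      using 1 2 n1 by (intro frac_le) auto
    finally show ?thesis by (simp add: exp_minus exp_sum divide_inverse)
  qed
  assume nk: "n \<le> k" and r: "real r * (exp (- e * real n) / (1 - exp (- e))) \<le> 1 / 2"
  define \<delta> where "\<delta> = exp (- e * real n) / (1 - exp (- e))"
  have \<delta>: "\<delta> \<ge> 0" unfolding \<delta>_def using q by simp
  have f4: "1 - \<delta> \<le> f a" if "a > 0" for a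
  proof -
    have "exp (- e) ^ k \<le> exp (- e) ^ n" using q nk by (intro power_decreasing) auto
    also have "\<dots> = exp (- e * real n)" by (simp add: exp_of_nat_mult[symmetric] mult.commute)
    finally have "exp (- e) ^ k / (1 - exp (- e)) \<le> \<delta>" unfolding \<delta>_def using q by (intro divide_right_mono) auto
    then show ?thesis using f(4)[OF that] by linarith
  qed
  define N where "N = f 1 * (\<Prod>j=1..s. f (\<beta> j))"
  define R where "R = (\<Prod>j=1..r. f (\<alpha> j))"
  have R: "1 - real r * \<delta> \<le> R" "R \<le> 1"
    using prod_in_unit_interval[of "{1..r}" \<delta> "\<lambda>j. f (\<alpha> j)"] \<alpha> f f4 less_imp_le[OF f(1)] unfolding R_def by auto
  have N2: "1 - real s * \<delta> \<le> (\<Prod>j=1..s. f (\<beta> j))"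
    using prod_in_unit_interval(1)[of "{1..s}" \<delta> "\<lambda>j. f (\<beta> j)"] \<beta> f f4 less_imp_le[OF f(1)] by auto
  \<comment> \<open>For a, b in [0, 1] one has a b \<ge> a + b - 1.\<close>
  have N: "1 - real (s + 1) * \<delta> \<le> N"
  proof -
    have "(1 - f 1) * (\<Prod>j=1..s. f (\<beta> j)) \<le> (1 - f 1) * 1" using f(2)[of 1] p\<beta>' by (intro mult_left_mono) auto
    then have "f 1 + (\<Prod>j=1..s. f (\<beta> j)) - 1 \<le> N" unfolding N_def by (simp add: algebra_simps)
    then show ?thesis using f4[of 1] N2 by (simp add: algebra_simps)
  qed
  have N': "N \<le> 1" unfolding N_def by (rule n1)
  have R': "R \<ge> 1 / 2" using R(1) r unfolding \<delta>_def by linarith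
  have pos: "real r * \<delta> \<ge> 0" "real (s + 1) * \<delta> \<ge> 0" "real (r + s + 1) * \<delta> = real r * \<delta> + real (s + 1) * \<delta>"
    using \<delta> by (auto simp: algebra_simps)
  have "\<bar>N - R\<bar> \<le> real (r + s + 1) * \<delta>"
    unfolding pos(3) using N N' R pos(1,2) by linarith
  then have "\<bar>N - R\<bar> / R \<le> (real (r + s + 1) * \<delta>) / (1 / 2)" using R' \<delta> by (intro frac_le) auto
  moreover have "\<bar>qcoeff_ratio r s \<alpha> \<beta> e k - 1\<bar> = \<bar>N - R\<bar> / R"
  proof -
    have "qcoeff_ratio r s \<alpha> \<beta> e k - 1 = (N - R) / R" unfolding d N_def[symmetric] R_def[symmetric] using R' by (simp add: field_simps)
    then show ?thesis using R' by simp
  qed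
  moreover have "real (r + s + 1) * \<delta> / (1 / 2) = 2 * real (r + s + 1) * \<delta>" by (simp add: algebra_simps)
  ultimately have "\<bar>qcoeff_ratio r s \<alpha> \<beta> e k - 1\<bar> \<le> 2 * real (r + s + 1) * \<delta>" by (simp only:)
  then show "\<bar>qcoeff_ratio r s \<alpha> \<beta> e k - 1\<bar> \<le> 2 * real (r + s + 1) * (exp (- e * real n) / (1 - exp (- e)))"
    unfolding \<delta>_def .
qed

text \<open>Completing the square in the exponent 2 k l e x - l e k^2 of the k-th term. The - 1 in 4
  n - 1 offsets the power q^(- l) built into the series. After division by the sign in the series,
  only \<sigma>^k remains of the sign \<tau> of the argument.\<close>

lemma basic_hypergeometric_gaussian:
  fixes \<alpha> \<beta> :: "nat \<Rightarrow> real" and \<tau> \<sigma> :: real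
  assumes e: "e > 0" and l: "l = (real s + 1 - real r) / 2" "l > 0"
    and \<alpha>: "\<And>j. j \<in> {1..r} \<Longrightarrow> \<alpha> j > 0" and \<beta>: "\<And>j. j \<in> {1..s} \<Longrightarrow> \<beta> j > 0"
    and \<tau>: "\<And>k::nat. \<tau> ^ k / (- 1) powi (int k * (int s + 1 - int r)) = \<sigma> ^ k"
    and x: "x = 2 * real n + pi * v / (l * e)"
    and T: "(\<lambda>k. \<sigma> ^ k * qcoeff_ratio r s \<alpha> \<beta> e k * exp (- (l * e) * (real k - x)\<^sup>2)) sums T"
  shows "basic_hypergeometric r s (\<lambda>j. exp (- e * \<alpha> j)) (\<lambda>k. exp (- e * \<beta> k)) (exp (- e))
      (\<tau> * exp (2 * pi * v) * exp (- e) powr (- l * (4 * real n - 1)))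
    = exp (ln_qcoeff r s \<alpha> \<beta> e) * exp (l * e * x\<^sup>2) * T"
proof -
  define w where "w = \<tau> * exp (2 * pi * v) * exp (- e) powr (- l * (4 * real n - 1))"
  have term_eq: "((\<Prod>j=1..r. qpochhammer (exp (- e * \<alpha> j)) (exp (- e)) k) * (w * of_real (exp (- e) powr (- l))) ^ k * of_real (exp (- e) powr (l * real k ^ 2)))
      / (qpochhammer (of_real (exp (- e))) (exp (- e)) k * (\<Prod>j=1..s. qpochhammer (exp (- e * \<beta> j)) (exp (- e)) k) * (- 1) powi (int k * (int s + 1 - int r)))
    = (exp (ln_qcoeff r s \<alpha> \<beta> e) * exp (l * e * x\<^sup>2)) * (\<sigma> ^ k * qcoeff_ratio r s \<alpha> \<beta> e k * exp (- (l * e) * (real k - x)\<^sup>2))"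
    (is "?L = ?R") for k
  proof -
    have ex: "real k * (2 * pi * v + e * l * (4 * real n - 1) + e * l) - e * l * (real k)\<^sup>2 = l * e * x\<^sup>2 - l * e * (real k - x)\<^sup>2"
    proof -
      have "l * e * x = 2 * l * e * real n + pi * v" unfolding x using l e by (simp add: field_simps)
      moreover have "l * e * x\<^sup>2 - l * e * (real k - x)\<^sup>2 = 2 * real k * (l * e * x) - l * e * (real k)\<^sup>2"
        by (simp add: power2_eq_square algebra_simps)
      ultimately show ?thesis by (simp add: algebra_simps)
    qed
    have "(w * exp (- e) powr (- l)) ^ k * exp (- e) powr (l * real k ^ 2)
        = \<tau> ^ k * (exp (2 * pi * v) * exp (e * l * (4 * real n - 1)) * exp (e * l)) ^ k * exp (- (e * l * (real k)\<^sup>2))"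
      unfolding w_def powr_def by (simp add: power_mult_distrib mult_ac)
    also have "\<dots> = \<tau> ^ k * exp (real k * (2 * pi * v + e * l * (4 * real n - 1) + e * l) - e * l * (real k)\<^sup>2)"
      by (simp only: exp_of_nat_mult exp_add exp_diff exp_minus divide_inverse mult.assoc)
    also have "\<dots> = \<tau> ^ k * (exp (l * e * x\<^sup>2) * exp (- (l * e) * (real k - x)\<^sup>2))"
      unfolding ex by (simp add: exp_diff exp_minus divide_inverse)
    finally have 1: "(w * exp (- e) powr (- l)) ^ k * exp (- e) powr (l * real k ^ 2) = \<tau> ^ k * (exp (l * e * x\<^sup>2) * exp (- (l * e) * (real k - x)\<^sup>2))" .
    have "?L = ((\<Prod>j=1..r. qpochhammer (exp (- e * \<alpha> j)) (exp (- e)) k) /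
        (qpochhammer (exp (- e)) (exp (- e)) k * (\<Prod>j=1..s. qpochhammer (exp (- e * \<beta> j)) (exp (- e)) k)))
        * ((w * exp (- e) powr (- l)) ^ k * exp (- e) powr (l * real k ^ 2)) / (- 1) powi (int k * (int s + 1 - int r))"
      by (simp add: mult_ac)
    also have "\<dots> = exp (ln_qcoeff r s \<alpha> \<beta> e) * qcoeff_ratio r s \<alpha> \<beta> e k * (exp (l * e * x\<^sup>2) * exp (- (l * e) * (real k - x)\<^sup>2)) * (\<tau> ^ k / (- 1) powi (int k * (int s + 1 - int r)))"
      unfolding 1 by (subst qcoeff_factorization[OF e]) (use \<alpha> \<beta> in \<open>auto simp: mult_ac\<close>)
    also have "\<dots> = ?R" unfolding \<tau> by (simp only: mult_ac)
    finally show ?thesis .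
  qed
  show ?thesis
    unfolding basic_hypergeometric_def Let_def l(1)[symmetric] w_def[symmetric] term_eq
    using sums_mult[OF T, of "exp (ln_qcoeff r s \<alpha> \<beta> e) * exp (l * e * x\<^sup>2)"] by (simp add: sums_iff)
qed

section \<open>Asymptotics of the constant\<close>

text \<open>For e \<le> 1 each term of the asymptotics is at most a constant over e. This crude form
  suffices below n, where the Gaussian decay outweighs exp (K / e).\<close>

lemma ln_qpochhammer_lower:
  assumes "a > 0"
  shows "\<exists>K\<ge>0. \<forall>e. 0 < e \<and> e \<le> 1 \<longrightarrow> - ln_qpochhammer a e \<le> K / e"
proof -
  obtain C where C: "C \<ge> 0" "\<And>e. e > 0 \<Longrightarrow> \<bar>ln_qpochhammer a e - (- pi\<^sup>2 / (6 * e) + (1/2 - a) * ln e + ln (2 * pi) / 2 - ln (Gamma a))\<bar> \<le> C * e"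
    using ln_qpochhammer_asymp[OF assms] by blast
  define K where "K = pi\<^sup>2 / 6 + \<bar>1/2 - a\<bar> + \<bar>ln (2 * pi) / 2 - ln (Gamma a)\<bar> + C"
  have "- ln_qpochhammer a e \<le> K / e" if e: "0 < e" "e \<le> 1" for e
  proof -
    have i: "1 \<le> 1 / e" using e by simp
    have "ln (1 / e) \<le> 1 / e - 1" using e by (intro ln_le_minus_one) auto
    then have "\<bar>ln e\<bar> \<le> 1 / e" using e by (simp add: ln_div)
    then have 1: "\<bar>(1/2 - a) * ln e\<bar> \<le> \<bar>1/2 - a\<bar> * (1 / e)" unfolding abs_mult by (intro mult_left_mono) auto
    have 2: "\<bar>ln (2 * pi) / 2 - ln (Gamma a)\<bar> \<le> \<bar>ln (2 * pi) / 2 - ln (Gamma a)\<bar> * (1 / e)"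
      using mult_left_mono[OF i, of "\<bar>ln (2 * pi) / 2 - ln (Gamma a)\<bar>"] by simp
    have 3: "C * e \<le> C * (1 / e)" using order_trans[OF e(2) i] C(1) by (rule mult_left_mono)
    have "K / e = pi\<^sup>2 / (6 * e) + \<bar>1/2 - a\<bar> * (1 / e) + \<bar>ln (2 * pi) / 2 - ln (Gamma a)\<bar> * (1 / e) + C * (1 / e)"
      unfolding K_def by (simp add: add_divide_distrib)
    moreover have "- pi\<^sup>2 / (6 * e) = - (pi\<^sup>2 / (6 * e))" by simp
    ultimately show ?thesis using C(2)[OF e(1)] 1 2 3 by linarith
  qed
  moreover have "K \<ge> 0" unfolding K_def using C(1) by (intro add_nonneg_nonneg) auto
  ultimately show ?thesis by blast
qed

lemma ln_qpochhammer_sum_lower: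
  assumes "finite A" "\<And>j. j \<in> A \<Longrightarrow> \<alpha> j > 0"
  shows "\<exists>K\<ge>0. \<forall>e. 0 < e \<and> e \<le> 1 \<longrightarrow> - (\<Sum>j\<in>A. ln_qpochhammer (\<alpha> j) e) \<le> K / e"
proof -
  have "\<forall>j. \<exists>K. j \<in> A \<longrightarrow> K \<ge> 0 \<and> (\<forall>e. 0 < e \<and> e \<le> 1 \<longrightarrow> - ln_qpochhammer (\<alpha> j) e \<le> K / e)"
    using ln_qpochhammer_lower assms(2) by meson
  then obtain K where K: "\<And>j. j \<in> A \<Longrightarrow> K j \<ge> 0" "\<And>j e. j \<in> A \<Longrightarrow> 0 < e \<Longrightarrow> e \<le> 1 \<Longrightarrow> - ln_qpochhammer (\<alpha> j) e \<le> K j / e"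
    by metis
  show ?thesis
  proof (intro exI[of _ "\<Sum>j\<in>A. K j"] conjI allI impI)
    show "0 \<le> (\<Sum>j\<in>A. K j)" using K(1) by (rule sum_nonneg)
    fix e :: real assume e: "0 < e \<and> e \<le> 1"
    have "(\<Sum>j\<in>A. - ln_qpochhammer (\<alpha> j) e) \<le> (\<Sum>j\<in>A. K j / e)" using K(2) e by (intro sum_mono) auto
    then show "- (\<Sum>j\<in>A. ln_qpochhammer (\<alpha> j) e) \<le> (\<Sum>j\<in>A. K j) / e" by (simp add: sum_negf sum_divide_distrib)
  qed
qed

lemma ln_qpochhammer_sum_asymp:
  assumes "finite A" "\<And>j. j \<in> A \<Longrightarrow> \<alpha> j > 0"
  shows "\<exists>C\<ge>0. \<forall>e>0. \<bar>(\<Sum>j\<in>A. ln_qpochhammer (\<alpha> j) e) - (real (card A) * (- pi\<^sup>2 / (6 * e) + ln e / 2 + ln (2 * pi) / 2) - (\<Sum>j\<in>A. \<alpha> j) * ln e - (\<Sum>j\<in>A. ln (Gamma (\<alpha> j))))\<bar> \<le> C * e"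
proof -
  have "\<forall>j. \<exists>C. j \<in> A \<longrightarrow> C \<ge> 0 \<and> (\<forall>e>0. \<bar>ln_qpochhammer (\<alpha> j) e - (- pi\<^sup>2 / (6 * e) + (1/2 - \<alpha> j) * ln e + ln (2 * pi) / 2 - ln (Gamma (\<alpha> j)))\<bar> \<le> C * e)"
    using ln_qpochhammer_asymp assms(2) by meson
  then obtain C where C: "\<And>j. j \<in> A \<Longrightarrow> C j \<ge> 0" "\<And>j e. j \<in> A \<Longrightarrow> e > 0 \<Longrightarrow> \<bar>ln_qpochhammer (\<alpha> j) e - (- pi\<^sup>2 / (6 * e) + (1/2 - \<alpha> j) * ln e + ln (2 * pi) / 2 - ln (Gamma (\<alpha> j)))\<bar> \<le> C j * e"
    by metis
  show ?thesis
  proof (intro exI[of _ "\<Sum>j\<in>A. C j"] conjI allI impI)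
    show "0 \<le> (\<Sum>j\<in>A. C j)" using C(1) by (rule sum_nonneg)
    fix e :: real assume e: "0 < e"
    have "(\<Sum>j\<in>A. - pi\<^sup>2 / (6 * e) + (1/2 - \<alpha> j) * ln e + ln (2 * pi) / 2 - ln (Gamma (\<alpha> j)))
      = (\<Sum>j\<in>A. (- pi\<^sup>2 / (6 * e) + ln e / 2 + ln (2 * pi) / 2) - \<alpha> j * ln e - ln (Gamma (\<alpha> j)))"
      by (intro sum.cong refl) (simp add: algebra_simps)
    also have "\<dots> = real (card A) * (- pi\<^sup>2 / (6 * e) + ln e / 2 + ln (2 * pi) / 2) - (\<Sum>j\<in>A. \<alpha> j) * ln e - (\<Sum>j\<in>A. ln (Gamma (\<alpha> j)))"
      by (simp only: sum_subtractf sum_constant sum_distrib_right)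
    finally have eq: "(\<Sum>j\<in>A. ln_qpochhammer (\<alpha> j) e) - (real (card A) * (- pi\<^sup>2 / (6 * e) + ln e / 2 + ln (2 * pi) / 2) - (\<Sum>j\<in>A. \<alpha> j) * ln e - (\<Sum>j\<in>A. ln (Gamma (\<alpha> j))))
      = (\<Sum>j\<in>A. ln_qpochhammer (\<alpha> j) e - (- pi\<^sup>2 / (6 * e) + (1/2 - \<alpha> j) * ln e + ln (2 * pi) / 2 - ln (Gamma (\<alpha> j))))"
      by (simp only: sum_subtractf)
    show "\<bar>(\<Sum>j\<in>A. ln_qpochhammer (\<alpha> j) e) - (real (card A) * (- pi\<^sup>2 / (6 * e) + ln e / 2 + ln (2 * pi) / 2) - (\<Sum>j\<in>A. \<alpha> j) * ln e - (\<Sum>j\<in>A. ln (Gamma (\<alpha> j))))\<bar> \<le> (\<Sum>j\<in>A. C j) * e"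
      unfolding eq by (subst sum_distrib_right) (intro order_trans[OF sum_abs] sum_mono C(2) e)
  qed
qed

text \<open>The net count of factors, with (q; q)_\<infinity> as parameter 1, is r - s - 1 = - 2 l;
  it multiplies the terms common to all parameters. The parameters themselves sum to \<rho>, whose -
  1 stems from (q; q)_\<infinity>.\<close>

lemma ln_qcoeff_asymp:
  fixes l \<rho> :: real
  assumes l: "l = (real s + 1 - real r) / 2"
    and \<alpha>: "\<And>j. j \<in> {1..r} \<Longrightarrow> \<alpha> j > 0" and \<beta>: "\<And>j. j \<in> {1..s} \<Longrightarrow> \<beta> j > 0"
    and \<rho>: "\<rho> = (\<Sum>j=1..r. \<alpha> j) - (\<Sum>k=1..s. \<beta> k) - 1"
  shows "\<exists>C\<ge>0. \<forall>e>0. \<bar>ln_qcoeff r s \<alpha> \<beta> e - (l * pi\<^sup>2 / (3 * e) - (l + \<rho>) * ln e - l * ln (2 * pi)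
     + (\<Sum>k=1..s. ln (Gamma (\<beta> k))) - (\<Sum>j=1..r. ln (Gamma (\<alpha> j))))\<bar> \<le> C * e"
proof -
  obtain C1 where C1: "C1 \<ge> 0" "\<And>e. e > 0 \<Longrightarrow> \<bar>(\<Sum>j=1..r. ln_qpochhammer (\<alpha> j) e) - (real r * (- pi\<^sup>2 / (6 * e) + ln e / 2 + ln (2 * pi) / 2) - (\<Sum>j=1..r. \<alpha> j) * ln e - (\<Sum>j=1..r. ln (Gamma (\<alpha> j))))\<bar> \<le> C1 * e"
    using ln_qpochhammer_sum_asymp[of "{1..r}" \<alpha>] \<alpha> by auto
  obtain C2 where C2: "C2 \<ge> 0" "\<And>e. e > 0 \<Longrightarrow> \<bar>(\<Sum>j=1..s. ln_qpochhammer (\<beta> j) e) - (real s * (- pi\<^sup>2 / (6 * e) + ln e / 2 + ln (2 * pi) / 2) - (\<Sum>j=1..s. \<beta> j) * ln e - (\<Sum>j=1..s. ln (Gamma (\<beta> j))))\<bar> \<le> C2 * e"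
    using ln_qpochhammer_sum_asymp[of "{1..s}" \<beta>] \<beta> by auto
  obtain C3 where C3: "C3 \<ge> 0" "\<And>e. e > 0 \<Longrightarrow> \<bar>ln_qpochhammer 1 e + pi\<^sup>2 / (6 * e) + ln e / 2 - ln (2 * pi) / 2\<bar> \<le> C3 * e"
    using ln_qpochhammer_1_asymp by blast
  show ?thesis
  proof (intro exI[of _ "C1 + C2 + C3"] conjI allI impI)
    fix e :: real assume e: "e > 0"
    define P where "P = pi\<^sup>2 / (6 * e)"
    have "l * pi\<^sup>2 / (3 * e) - (l + \<rho>) * ln e - l * ln (2 * pi)
       = (real r * (- P + ln e / 2 + ln (2 * pi) / 2) - (\<Sum>j=1..r. \<alpha> j) * ln e)
        - (real s * (- P + ln e / 2 + ln (2 * pi) / 2) - (\<Sum>j=1..s. \<beta> j) * ln e) - (- P - ln e / 2 + ln (2 * pi) / 2)"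
    proof -
      have P: "l * pi\<^sup>2 / (3 * e) = 2 * l * P" unfolding P_def by simp
      have l2: "real r = real s + 1 - 2 * l" using l by simp
      show ?thesis unfolding P \<rho> l2 by (simp add: field_simps)
    qed
    moreover have "- pi\<^sup>2 / (6 * e) = - P" unfolding P_def by simp
    ultimately show "\<bar>ln_qcoeff r s \<alpha> \<beta> e - (l * pi\<^sup>2 / (3 * e) - (l + \<rho>) * ln e - l * ln (2 * pi)
     + (\<Sum>k=1..s. ln (Gamma (\<beta> k))) - (\<Sum>j=1..r. ln (Gamma (\<alpha> j))))\<bar> \<le> (C1 + C2 + C3) * e"
      using C1(2)[OF e] C2(2)[OF e] C3(2)[OF e] unfolding ln_qcoeff_def P_def[symmetric] distrib_right
      by (simp only: abs_le_iff) linarith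
  qed (use C1 C2 C3 in auto)
qed

text \<open>The factor sqrt (l / L) is split off because it normalizes the Gaussian sum, which is of
  size 1 / sqrt t. It accounts for sqrt l and for the extra 1 / 2 in the power of L.\<close>

lemma exp_leading_qcoeff:
  fixes l \<rho> L :: real and \<alpha> \<beta> :: "nat \<Rightarrow> real"
  assumes L: "L > 0" and l: "l > 0"
    and \<alpha>: "\<And>j. j \<in> {1..r} \<Longrightarrow> \<alpha> j > 0" and \<beta>: "\<And>j. j \<in> {1..s} \<Longrightarrow> \<beta> j > 0"
  shows "exp (l * pi\<^sup>2 / (3 * (pi / L)) - (l + \<rho>) * ln (pi / L) - l * ln (2 * pi)
     + (\<Sum>k=1..s. ln (Gamma (\<beta> k))) - (\<Sum>j=1..r. ln (Gamma (\<alpha> j))))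
   = (\<Prod>k=1..s. Gamma (\<beta> k)) / (\<Prod>j=1..r. Gamma (\<alpha> j))
       * (L powr (\<rho> + l + 1 / 2) / (sqrt l * 2 powr l * pi powr (\<rho> + 2 * l))) * exp (l * pi * L / 3) * sqrt (l / L)"
proof -
  have g0: "exp (\<Sum>j=1..m. ln (Gamma (\<gamma> j))) = (\<Prod>j=1..m. Gamma (\<gamma> j))"
    if "\<And>j. j \<in> {1..m} \<Longrightarrow> \<gamma> j > 0" for m :: nat and \<gamma> :: "nat \<Rightarrow> real"
    unfolding exp_sum[OF finite_atLeastAtMost] using that by (intro prod.cong refl exp_ln Gamma_real_pos)
  have g: "exp (\<Sum>k=1..s. ln (Gamma (\<beta> k))) = (\<Prod>k=1..s. Gamma (\<beta> k))"
    by (rule g0) (rule \<beta>)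
  have g': "exp (\<Sum>j=1..r. ln (Gamma (\<alpha> j))) = (\<Prod>j=1..r. Gamma (\<alpha> j))"
    by (rule g0) (rule \<alpha>)
  have "L powr (\<rho> + l + 1 / 2) * sqrt (l / L) = sqrt l * L powr (\<rho> + l)"
    using L by (simp add: powr_add powr_half_sqrt real_sqrt_divide)
  then have p: "L powr (\<rho> + l + 1 / 2) / (sqrt l * 2 powr l * pi powr (\<rho> + 2 * l)) * sqrt (l / L) = L powr (\<rho> + l) / (2 powr l * pi powr (\<rho> + 2 * l))"
    using l by (simp add: field_simps)
  have "L powr (\<rho> + l) / (2 powr l * pi powr (\<rho> + 2 * l)) = exp ((\<rho> + l) * ln L - l * ln 2 - (\<rho> + 2 * l) * ln pi)"
    using L by (simp add: powr_def exp_diff exp_add)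
  also have "(\<rho> + l) * ln L - l * ln 2 - (\<rho> + 2 * l) * ln pi = - (l + \<rho>) * ln (pi / L) - l * ln (2 * pi)"
    using L by (simp add: ln_div ln_mult algebra_simps)
  finally have q: "L powr (\<rho> + l) / (2 powr l * pi powr (\<rho> + 2 * l)) = exp (- (l + \<rho>) * ln (pi / L) - l * ln (2 * pi))" .
  have "l * pi\<^sup>2 / (3 * (pi / L)) = l * pi * L / 3" using L by (simp add: power2_eq_square)
  then have "exp (l * pi\<^sup>2 / (3 * (pi / L)) - (l + \<rho>) * ln (pi / L) - l * ln (2 * pi)
     + (\<Sum>k=1..s. ln (Gamma (\<beta> k))) - (\<Sum>j=1..r. ln (Gamma (\<alpha> j))))
    = exp (l * pi * L / 3) * exp (- (l + \<rho>) * ln (pi / L) - l * ln (2 * pi)) * exp (\<Sum>k=1..s. ln (Gamma (\<beta> k))) / exp (\<Sum>j=1..r. ln (Gamma (\<alpha> j)))"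
    unfolding exp_add[symmetric] exp_diff[symmetric] by (simp add: algebra_simps)
  then show ?thesis unfolding g g' q[symmetric] p[symmetric] by (simp add: mult_ac)
qed

section \<open>Error estimates along an admissible scale\<close>

lemma admissible_scale_at_top:
  assumes "admissible_scale lam"
  shows "filterlim lam at_top sequentially"
  unfolding filterlim_at_top
proof
  fix Z :: real
  have "\<forall>\<^sub>F n in sequentially. max Z 0 \<le> lam n / ln (real n)"
    using assms unfolding admissible_scale_def filterlim_at_top by blast
  moreover have "\<forall>\<^sub>F n in sequentially. n \<ge> 3" by (rule eventually_ge_at_top)
  ultimately show "\<forall>\<^sub>F n in sequentially. Z \<le> lam n"
  proof eventually_elim
    case (elim n)
    have "exp 1 \<le> real n" using elim(2) exp_le by linarith
    then have l1: "1 \<le> ln (real n)" using elim(2) by (subst ln_ge_iff) auto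
    have "max Z 0 * 1 \<le> max Z 0 * ln (real n)" using l1 by (intro mult_left_mono) auto
    also have "\<dots> \<le> lam n" using elim(1) l1 by (simp add: le_divide_eq)
    finally show ?case by simp
  qed
qed

lemma exp_neg_le_inverse:
  fixes x :: real
  assumes "x > 0"
  shows "exp (- x) \<le> 1 / x"
proof -
  have "x \<le> exp x" using exp_ge_add_one_self[of x] by linarith
  then have "1 / exp x \<le> 1 / x" using assms by (intro divide_left_mono) auto
  then show ?thesis by (simp add: exp_minus divide_inverse)
qed

lemma abs_exp_minus_one_le: "\<bar>exp y - 1\<bar> \<le> \<bar>y\<bar> * exp \<bar>y\<bar>" for y :: real
proof (cases "y \<ge> 0")
  case True
  have "(1 - y) * exp y \<le> exp (- y) * exp y"
    using exp_ge_add_one_self[of "- y"] by (intro mult_right_mono) auto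
  then show ?thesis using True by (simp add: exp_minus algebra_simps)
next
  case False
  have "1 + y \<le> exp y" "exp y < 1" using False exp_ge_add_one_self[of y] by auto
  then have "\<bar>exp y - 1\<bar> \<le> \<bar>y\<bar> * 1" by linarith
  also have "\<dots> \<le> \<bar>y\<bar> * exp \<bar>y\<bar>" by (intro mult_left_mono) auto
  finally show ?thesis .
qed

text \<open>Errors are measured against exp (- pi / (4 t)), the scale of the alternating sum, so one
  estimate serves both expansions. The conditions on L ensure in turn: e \<le> 1, t \<le> 1, centre
  above 3 n / 2, denominator at least 1 / 2, and Gaussian decay stronger than exp (K L).\<close>

lemma qcoeff_gaussian_sum:
  fixes \<alpha> \<beta> :: "nat \<Rightarrow> real" and \<sigma> L v l K S :: real and \<sigma>' :: "int \<Rightarrow> real" and n :: nat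
  defines "t \<equiv> l / L" and "x \<equiv> 2 * real n + v * L / l"
  assumes \<alpha>: "\<And>j. j \<in> {1..r} \<Longrightarrow> \<alpha> j > 0" and \<beta>: "\<And>j. j \<in> {1..s} \<Longrightarrow> \<beta> j > 0" and l: "l > 0"
    and \<sigma>: "\<And>k. \<sigma>' (int k) = \<sigma> ^ k" "\<And>k. \<bar>\<sigma>' k\<bar> \<le> 1"
    and K: "K \<ge> 0" "\<And>e. 0 < e \<Longrightarrow> e \<le> 1 \<Longrightarrow> - (\<Sum>j=1..r. ln_qpochhammer (\<alpha> j) e) \<le> K / e"
    and S: "((\<lambda>k. \<sigma>' k * exp (- pi * t * (of_int k - x)\<^sup>2)) has_sum S) UNIV"
    and L: "L \<ge> 4" "L \<ge> l" "L \<ge> 2 * \<bar>v\<bar> / l" "L \<ge> 2 * real r" "L\<^sup>2 \<ge> (K + pi / (4 * l) + 1) * (8 / (pi * l))"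
    and n: "real n \<ge> (1 / (4 * l) + 1) * L\<^sup>2"
  shows "\<exists>T. (\<lambda>k. \<sigma> ^ k * qcoeff_ratio r s \<alpha> \<beta> (pi / L) k * exp (- pi * t * (real k - x)\<^sup>2)) sums T \<and>
    exp (pi / (4 * t)) * (sqrt t * \<bar>T - S\<bar>) \<le> 20 * real (r + s + 2) / L"
proof -
  define e where "e = pi / L"
  define \<delta> where "\<delta> = exp (- e * real n) / (1 - exp (- e))"
  define \<eta> where "\<eta> = 2 * real (r + s + 1) * \<delta>"
  define B where "B = exp (- (\<Sum>j=1..r. ln_qpochhammer (\<alpha> j) e))"
  define M where "M = pi * L / (4 * l)"
  have pi34: "3 < pi" "pi < 4" using pi_gt3 pi_less_4 by auto
  have e: "0 < e" "e \<le> 1" unfolding e_def using L pi34 by auto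
  have t: "0 < t" "t \<le> 1" unfolding t_def using L l by auto
  have Mt: "pi / (4 * t) = M" unfolding t_def M_def using L l by (simp add: field_simps)
  have nL: "L\<^sup>2 \<le> real n"
  proof -
    have "1 * L\<^sup>2 \<le> (1 / (4 * l) + 1) * L\<^sup>2" using l by (intro mult_right_mono) auto
    then show ?thesis using n by simp
  qed
  have eL: "exp (- L) \<le> 1 / L" using L by (intro exp_neg_le_inverse) auto
  \<comment> \<open>The bound on n makes e n at least M + pi L: M cancels exp M, and pi L outweighs
    1 / (1 - q) \<le> exp L with room for exp (- L) \<le> 1 / L.\<close>
  have \<delta>1: "exp M * \<delta> \<le> 1 / L"
  proof -
    have "1 / (1 - exp (- e)) \<le> 1 + 1 / e"
    proof -
      have "exp (- e) \<le> 1 / (1 + e)"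
        using exp_ge_add_one_self[of e] e by (simp add: exp_minus divide_inverse le_imp_inverse_le)
      then have "e / (1 + e) \<le> 1 - exp (- e)" using e by (simp add: field_simps)
      then have "1 / (1 - exp (- e)) \<le> 1 / (e / (1 + e))" using e by (intro divide_left_mono) auto
      then show ?thesis using e by (simp add: field_simps)
    qed
    also have "1 / e \<le> L" unfolding e_def using L pi34 by (simp add: divide_le_eq mult_le_cancel_left1)
    also have "1 + L \<le> exp L" by (rule exp_ge_add_one_self)
    finally have 1: "1 / (1 - exp (- e)) \<le> exp L" by simp
    have "e * ((1 / (4 * l) + 1) * L\<^sup>2) \<le> e * real n" using n e by (intro mult_left_mono) auto
    also have "e * ((1 / (4 * l) + 1) * L\<^sup>2) = M + pi * L"
      unfolding e_def M_def using L l by (simp add: power2_eq_square field_simps)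
    finally have "M - e * real n \<le> - (pi * L)" by simp
    also have "\<dots> \<le> - (3 * L)" using pi34 L by simp
    finally have 2: "exp (M - e * real n) \<le> exp (- (3 * L))" by simp
    have "exp M * \<delta> = exp (M - e * real n) * (1 / (1 - exp (- e)))"
      unfolding \<delta>_def by (simp add: exp_diff exp_minus divide_inverse)
    also have "\<dots> \<le> exp (- (3 * L)) * exp L" using 1 2 e by (intro mult_mono) auto
    also have "\<dots> = exp (- 2 * L)" unfolding exp_add[symmetric] by simp
    also have "\<dots> \<le> exp (- L)" using L by simp
    finally show ?thesis using eL by linarith
  qed
  have \<delta>0: "\<delta> \<ge> 0" unfolding \<delta>_def using e by simp
  have M0: "M \<ge> 0" unfolding M_def using L l by simp
  have "1 * \<delta> \<le> exp M * \<delta>" using M0 \<delta>0 by (intro mult_right_mono) auto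
  then have \<delta>2: "\<delta> \<le> 1 / L" using \<delta>1 by simp
  have r\<delta>: "real r * \<delta> \<le> 1 / 2"
  proof -
    have "real r * \<delta> \<le> (L / 2) * (1 / L)" using \<delta>2 \<delta>0 L by (intro mult_mono) auto
    then show ?thesis using L by simp
  qed
  have x: "3 * real n / 2 \<le> x"
  proof -
    have "2 * \<bar>v\<bar> / l = 2 * (\<bar>v\<bar> / l)" by simp
    then have "\<bar>v\<bar> / l \<le> L / 2" using L(3) by linarith
    then have "L * (\<bar>v\<bar> / l) \<le> L * (L / 2)" using L by (intro mult_left_mono) auto
    also have "\<dots> \<le> real n / 2" using nL by (simp add: power2_eq_square)
    finally have "\<bar>v * L / l\<bar> \<le> real n / 2" using L l by (simp add: abs_mult mult.commute)
    moreover have "3 * a / 2 \<le> 2 * a + b" if "\<bar>b\<bar> \<le> a / 2" for a b :: real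
      using that by (simp add: abs_le_iff)
    ultimately show ?thesis unfolding x_def by blast
  qed
  obtain T where T: "(\<lambda>k. \<sigma>' (int k) * qcoeff_ratio r s \<alpha> \<beta> e k * exp (- pi * t * (of_int (int k) - x)\<^sup>2)) sums T"
    and Tb: "sqrt t * \<bar>T - S\<bar> \<le> 10 * (\<eta> + (B + 1) * exp (- pi * t * (real n)\<^sup>2 / 8))"
  proof -
    have "\<exists>T. (\<lambda>k. \<sigma>' (int k) * qcoeff_ratio r s \<alpha> \<beta> e k * exp (- pi * t * (of_int (int k) - x)\<^sup>2)) sums T \<and>
      sqrt t * \<bar>T - S\<bar> \<le> 10 * (\<eta> + (B + 1) * exp (- pi * t * (real n)\<^sup>2 / 8))"
    proof (rule weighted_gaussian_sum[OF t \<sigma>(2) S])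
      show "\<bar>qcoeff_ratio r s \<alpha> \<beta> e k\<bar> \<le> B" for k
        unfolding B_def by (rule qcoeff_ratio_bounds(1)[OF e(1) \<alpha> \<beta>])
      show "\<bar>qcoeff_ratio r s \<alpha> \<beta> e k - 1\<bar> \<le> \<eta>" if "n \<le> k" for k
        unfolding \<eta>_def \<delta>_def by (rule qcoeff_ratio_bounds(2)[OF e(1) \<alpha> \<beta> that]) (use r\<delta> in \<open>simp_all add: \<delta>_def\<close>)
      show "0 \<le> \<eta>" unfolding \<eta>_def using \<delta>0 by simp
    qed (rule x)
    then show ?thesis using that by blast
  qed
  have B1: "exp M * ((B + 1) * exp (- pi * t * (real n)\<^sup>2 / 8)) \<le> 2 / L"
  proof -
    have "K / e \<le> K * L"
    proof -
      have "K * L / pi \<le> K * L / 1" using K(1) L pi34 by (intro divide_left_mono) auto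
      then show ?thesis unfolding e_def by simp
    qed
    then have "B \<le> exp (K * L)" unfolding B_def using K(2)[OF e] by simp
    moreover have "1 \<le> exp (K * L)" using K(1) L by simp
    ultimately have b: "B + 1 \<le> 2 * exp (K * L)" by linarith
    \<comment> \<open>Times L, its summands are the exponent K L of B, the exponent M, and a spare
      L. The Gaussian exponent is of order L^3, as n \<ge> L^2 and t = l / L.\<close>
    define Y where "Y = K + pi / (4 * l) + 1"
    have c1: "8 / (pi * l) * (pi * l / 8) = 1" using l by simp
    have "Y = Y * (8 / (pi * l)) * (pi * l / 8)" using c1 by (simp only: mult.assoc mult_1_right)
    also have "\<dots> \<le> L\<^sup>2 * (pi * l / 8)" unfolding Y_def by (rule mult_right_mono[OF L(5)]) (use l in simp)
    finally have "Y \<le> L\<^sup>2 * (pi * l / 8)" .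
    then have "Y * L \<le> L\<^sup>2 * (pi * l / 8) * L" using L by (intro mult_right_mono) auto
    also have "\<dots> = pi * t * (L\<^sup>2)\<^sup>2 / 8" unfolding t_def using L by (simp add: power2_eq_square field_simps)
    also have "\<dots> \<le> pi * t * (real n)\<^sup>2 / 8" using nL t by (intro divide_right_mono mult_left_mono power_mono) auto
    finally have g: "K * L + M + L \<le> pi * t * (real n)\<^sup>2 / 8" unfolding M_def Y_def by (simp add: algebra_simps)
    have "exp M * ((B + 1) * exp (- pi * t * (real n)\<^sup>2 / 8)) \<le> exp M * ((2 * exp (K * L)) * exp (- pi * t * (real n)\<^sup>2 / 8))"
      using b by (intro mult_left_mono mult_right_mono) auto
    also have "\<dots> = 2 * exp (M + (K * L + - pi * t * (real n)\<^sup>2 / 8))"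
      by (simp only: exp_add mult_ac)
    also have "\<dots> \<le> 2 * exp (- L)" using g by simp
    finally show ?thesis using eL by simp
  qed
  have "exp M * (sqrt t * \<bar>T - S\<bar>) \<le> exp M * (10 * (\<eta> + (B + 1) * exp (- pi * t * (real n)\<^sup>2 / 8)))"
    using Tb by (intro mult_left_mono) auto
  also have "\<dots> = 20 * real (r + s + 1) * (exp M * \<delta>) + 10 * (exp M * ((B + 1) * exp (- pi * t * (real n)\<^sup>2 / 8)))"
    unfolding \<eta>_def by (simp add: algebra_simps)
  also have "\<dots> \<le> 20 * real (r + s + 1) * (1 / L) + 10 * (2 / L)"
    using \<delta>1 B1 by (intro add_mono mult_left_mono) auto
  also have "\<dots> = 20 * real (r + s + 2) / L" by (simp add: add_divide_distrib algebra_simps)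
  finally have "exp (pi / (4 * t)) * (sqrt t * \<bar>T - S\<bar>) \<le> 20 * real (r + s + 2) / L" unfolding Mt .
  with T show ?thesis unfolding \<sigma>(1) e_def by auto
qed

text \<open>The right-hand side of the first expansion without the error factor, with L for
  \<lambda>.\<close>

definition leading_term :: "nat \<Rightarrow> nat \<Rightarrow> (nat \<Rightarrow> real) \<Rightarrow> (nat \<Rightarrow> real) \<Rightarrow> real \<Rightarrow> real \<Rightarrow> real \<Rightarrow> real \<Rightarrow> nat \<Rightarrow> real" where
  "leading_term r s \<alpha> \<beta> l \<rho> L v n = (\<Prod>k=1..s. Gamma (\<beta> k)) / (\<Prod>j=1..r. Gamma (\<alpha> j))
     * (L powr (\<rho> + l + 1 / 2) / (sqrt l * 2 powr l * pi powr (\<rho> + 2 * l)))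
     * exp (pi * L / l * (v + 2 * real n * l / L)\<^sup>2 + l * pi * L / 3)"

text \<open>
  Both parts of the theorem are instances: \<open>c t = \<gamma> t v = 1\<close> for the first one, and
  \<open>c t = exp (\<pi> / (4 t)) / 2\<close> with \<open>\<gamma> t v = cos (\<pi> v / t)\<close> for the second, where \<open>t = l / \<lambda>\<close>.
\<close>

lemma basic_hypergeometric_asymp:
  fixes \<alpha> \<beta> :: "nat \<Rightarrow> real" and \<tau> \<sigma> l \<rho> :: real and \<sigma>' :: "int \<Rightarrow> real" and S \<gamma> :: "real \<Rightarrow> real \<Rightarrow> real" and c :: "real \<Rightarrow> real"
  assumes adm: "admissible_scale lam" and l: "l = (real s + 1 - real r) / 2" "l > 0"
    and \<alpha>: "\<And>j. j \<in> {1..r} \<Longrightarrow> \<alpha> j > 0" and \<beta>: "\<And>j. j \<in> {1..s} \<Longrightarrow> \<beta> j > 0"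
    and \<rho>: "\<rho> = (\<Sum>j=1..r. \<alpha> j) - (\<Sum>k=1..s. \<beta> k) - 1"
    and \<tau>: "\<And>k::nat. \<tau> ^ k / (- 1) powi (int k * (int s + 1 - int r)) = \<sigma> ^ k"
    and \<sigma>: "\<And>k. \<sigma>' (int k) = \<sigma> ^ k" "\<And>k. \<bar>\<sigma>' k\<bar> \<le> 1"
    and c: "\<And>t. 0 < t \<Longrightarrow> t \<le> 1 \<Longrightarrow> 0 \<le> c t \<and> c t \<le> exp (pi / (4 * t))"
    and S: "\<And>t x. 0 < t \<Longrightarrow> t \<le> 1 \<Longrightarrow> ((\<lambda>k. \<sigma>' k * exp (- pi * t * (of_int k - x)\<^sup>2)) has_sum S t x) UNIV"
    and \<gamma>: "\<And>t v n. 0 < t \<Longrightarrow> t \<le> 1 \<Longrightarrow> \<bar>c t * (sqrt t * S t (2 * real n + v / t)) - \<gamma> t v\<bar> \<le> 6 * t"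
      "\<And>t v. \<bar>\<gamma> t v\<bar> \<le> 1"
    and V: "compact V"
  shows "\<exists>C N. \<forall>n\<ge>N. \<forall>v\<in>V. 
    \<bar>c (l / lam n) * basic_hypergeometric r s (\<lambda>j. exp (- (pi / lam n) * \<alpha> j)) (\<lambda>k. exp (- (pi / lam n) * \<beta> k)) (exp (- (pi / lam n)))
      (\<tau> * exp (2 * pi * v) * exp (- (pi / lam n)) powr (- l * (4 * real n - 1))) / leading_term r s \<alpha> \<beta> l \<rho> (lam n) v n - \<gamma> (l / lam n) v\<bar>
     \<le> C * inverse (lam n)"
proof -
  obtain W where W: "\<And>v. v \<in> V \<Longrightarrow> \<bar>v\<bar> \<le> W"
    using compact_imp_bounded[OF V] unfolding bounded_iff by auto
  obtain K where K: "K \<ge> 0" "\<And>e. 0 < e \<Longrightarrow> e \<le> 1 \<Longrightarrow> - (\<Sum>j=1..r. ln_qpochhammer (\<alpha> j) e) \<le> K / e"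
    using ln_qpochhammer_sum_lower[of "{1..r}" \<alpha>] \<alpha> by auto
  obtain C1 where C1: "C1 \<ge> 0" "\<And>e. e > 0 \<Longrightarrow> \<bar>ln_qcoeff r s \<alpha> \<beta> e - (l * pi\<^sup>2 / (3 * e) - (l + \<rho>) * ln e - l * ln (2 * pi)
     + (\<Sum>k=1..s. ln (Gamma (\<beta> k))) - (\<Sum>j=1..r. ln (Gamma (\<alpha> j))))\<bar> \<le> C1 * e"
    using ln_qcoeff_asymp[OF l(1) \<alpha> \<beta> \<rho>] by blast
  \<comment> \<open>The thresholds of \<open>qcoeff_gaussian_sum\<close>, with the bound W in place
    of |v| for uniformity on V. The last one is meant for L^2, which exceeds L as L \<ge> 1.\<close>
  define Z where "Z = Max {4, l, 2 * W / l, 2 * real r, (K + pi / (4 * l) + 1) * (8 / (pi * l))}"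
  have Z: "4 \<le> Z" "l \<le> Z" "2 * W / l \<le> Z" "2 * real r \<le> Z" "(K + pi / (4 * l) + 1) * (8 / (pi * l)) \<le> Z"
    unfolding Z_def by auto
  have "\<forall>\<^sub>F n in sequentially. Z \<le> lam n"
    using admissible_scale_at_top[OF adm] unfolding filterlim_at_top by blast
  moreover have "\<forall>\<^sub>F n in sequentially. 1 / (4 * l) + 1 \<le> real n / (lam n)\<^sup>2"
    using adm unfolding admissible_scale_def filterlim_at_top by blast
  ultimately have "\<forall>\<^sub>F n in sequentially. Z \<le> lam n \<and> 1 / (4 * l) + 1 \<le> real n / (lam n)\<^sup>2"
    by (rule eventually_conj)
  then obtain N where N: "\<And>n. n \<ge> N \<Longrightarrow> Z \<le> lam n \<and> 1 / (4 * l) + 1 \<le> real n / (lam n)\<^sup>2"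
    unfolding eventually_sequentially by blast
  \<comment> \<open>The first summand is the error of \<open>qcoeff_gaussian_sum\<close>, the second
    the theta error 6 t = 6 l / L.\<close>
  define D where "D = 20 * real (r + s + 2) + 6 * l"
  \<comment> \<open>From |exp u - 1| \<le> |u| exp |u| with |u| \<le> C1 e, where e = pi / L is at
    most 4 / L and at most 1.\<close>
  define C2 where "C2 = C1 * 4 * exp C1"
  have C2: "C2 \<ge> 0" unfolding C2_def using C1 by simp
  have D: "D \<ge> 0" unfolding D_def using l by simp
  have main: "\<bar>c (l / L) * basic_hypergeometric r s (\<lambda>j. exp (- (pi / L) * \<alpha> j)) (\<lambda>k. exp (- (pi / L) * \<beta> k)) (exp (- (pi / L)))
      (\<tau> * exp (2 * pi * v) * exp (- (pi / L)) powr (- l * (4 * real n - 1))) / leading_term r s \<alpha> \<beta> l \<rho> L v n - \<gamma> (l / L) v\<bar>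
     \<le> (C2 * (1 + D) + D) * inverse L"
    if v: "v \<in> V" and LZ: "Z \<le> L" and n: "1 / (4 * l) + 1 \<le> real n / L\<^sup>2" for L v n
  proof -
    define t where "t = l / L"
    define e where "e = pi / L"
    define x where "x = 2 * real n + v * L / l"
    have L4: "L \<ge> 4" "L \<ge> 1" "L > 0" using LZ Z by auto
    have t: "0 < t" "t \<le> 1" unfolding t_def using LZ Z l L4 by auto
    have pi4: "pi < 4" by (rule pi_less_4)
    have e: "0 < e" "e \<le> 1" "e \<le> 4 / L" unfolding e_def using L4 pi4 by (auto simp: divide_right_mono)
    have xt: "x = 2 * real n + v / t" unfolding x_def t_def using L4 l by simp
    have te: "pi * t = l * e" unfolding t_def e_def by simp
    obtain T where T: "(\<lambda>k. \<sigma> ^ k * qcoeff_ratio r s \<alpha> \<beta> e k * exp (- pi * t * (real k - x)\<^sup>2)) sums T"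
      and Tb: "exp (pi / (4 * t)) * (sqrt t * \<bar>T - S t x\<bar>) \<le> 20 * real (r + s + 2) / L"
    proof -
      have "2 * \<bar>v\<bar> / l \<le> 2 * W / l" using W[OF v] l by (intro divide_right_mono mult_left_mono) auto
      then have l1: "2 * \<bar>v\<bar> / l \<le> L" using Z LZ by linarith
      have l2: "(K + pi / (4 * l) + 1) * (8 / (pi * l)) \<le> L\<^sup>2"
      proof -
        have "L * 1 \<le> L * L" using L4 by (intro mult_left_mono) auto
        then have "L \<le> L\<^sup>2" by (simp add: power2_eq_square)
        then show ?thesis using Z(5) LZ by linarith
      qed
      have l3: "(1 / (4 * l) + 1) * L\<^sup>2 \<le> real n" using n L4 by (simp add: le_divide_eq)
      have "\<exists>T. (\<lambda>k. \<sigma> ^ k * qcoeff_ratio r s \<alpha> \<beta> (pi / L) k * exp (- pi * (l / L) * (real k - (2 * real n + v * L / l))\<^sup>2)) sums T \<and>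
        exp (pi / (4 * (l / L))) * (sqrt (l / L) * \<bar>T - S t x\<bar>) \<le> 20 * real (r + s + 2) / L"
        by (rule qcoeff_gaussian_sum[OF \<alpha> \<beta> l(2) \<sigma> K])
           (use S[OF t, of x] L4 LZ Z l1 l2 l3 in \<open>auto simp: t_def x_def\<close>)
      then show ?thesis using that unfolding t_def x_def e_def by blast
    qed
    define \<Lambda> where "\<Lambda> = l * pi\<^sup>2 / (3 * e) - (l + \<rho>) * ln e - l * ln (2 * pi)
     + (\<Sum>k=1..s. ln (Gamma (\<beta> k))) - (\<Sum>j=1..r. ln (Gamma (\<alpha> j)))"
    define \<kappa> where "\<kappa> = exp (ln_qcoeff r s \<alpha> \<beta> e - \<Lambda>)"
    define H where "H = basic_hypergeometric r s (\<lambda>j. exp (- e * \<alpha> j)) (\<lambda>k. exp (- e * \<beta> k)) (exp (- e))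
      (\<tau> * exp (2 * pi * v) * exp (- e) powr (- l * (4 * real n - 1)))"
    have H: "H = exp (ln_qcoeff r s \<alpha> \<beta> e) * exp (l * e * x\<^sup>2) * T"
      unfolding H_def
    proof (rule basic_hypergeometric_gaussian[OF e(1) l \<alpha> \<beta> \<tau>])
      show "x = 2 * real n + pi * v / (l * e)" unfolding xt te[symmetric] by simp
      show "(\<lambda>k. \<sigma> ^ k * qcoeff_ratio r s \<alpha> \<beta> e k * exp (- (l * e) * (real k - x)\<^sup>2)) sums T"
        using T unfolding te[symmetric] by simp
    qed
    have lt: "leading_term r s \<alpha> \<beta> l \<rho> L v n * sqrt t = exp \<Lambda> * exp (l * e * x\<^sup>2)"
    proof -
      have "l * e * x\<^sup>2 = pi * L / l * (v + 2 * real n * l / L)\<^sup>2"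
      proof -
        have "x = L / l * (v + 2 * real n * l / L)" unfolding x_def using L4 l(2) by (simp add: field_simps)
        then show ?thesis unfolding e_def using L4 l(2) by (simp add: power2_eq_square)
      qed
      moreover have "exp \<Lambda> = (\<Prod>k=1..s. Gamma (\<beta> k)) / (\<Prod>j=1..r. Gamma (\<alpha> j))
         * (L powr (\<rho> + l + 1 / 2) / (sqrt l * 2 powr l * pi powr (\<rho> + 2 * l))) * exp (l * pi * L / 3) * sqrt t"
        unfolding \<Lambda>_def e_def t_def by (rule exp_leading_qcoeff[OF L4(3) l(2) \<alpha> \<beta>])
      ultimately show ?thesis
        unfolding leading_term_def by (simp only: exp_add mult_ac)
    qed
    have ltnz: "leading_term r s \<alpha> \<beta> l \<rho> L v n \<noteq> 0"
    proof
      assume "leading_term r s \<alpha> \<beta> l \<rho> L v n = 0"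
      with lt show False by simp
    qed
    define y where "y = c t * (sqrt t * T)"
    have "H = leading_term r s \<alpha> \<beta> l \<rho> L v n * (\<kappa> * (sqrt t * T))"
    proof -
      have "H = \<kappa> * (exp \<Lambda> * exp (l * e * x\<^sup>2)) * T"
        unfolding H \<kappa>_def by (simp add: exp_diff)
      then show ?thesis unfolding lt[symmetric] by simp
    qed
    then have ratio: "c t * H / leading_term r s \<alpha> \<beta> l \<rho> L v n = \<kappa> * y"
      using ltnz unfolding y_def by simp
    have yb: "\<bar>y - \<gamma> t v\<bar> \<le> D / L"
    proof -
      have "\<bar>c t * (sqrt t * T) - c t * (sqrt t * S t x)\<bar> = c t * (sqrt t * \<bar>T - S t x\<bar>)"
        using c[OF t] t by (simp add: abs_mult right_diff_distrib[symmetric])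
      also have "\<dots> \<le> exp (pi / (4 * t)) * (sqrt t * \<bar>T - S t x\<bar>)"
        using c[OF t] t by (intro mult_right_mono) auto
      finally have "\<bar>y - c t * (sqrt t * S t x)\<bar> \<le> 20 * real (r + s + 2) / L" using Tb unfolding y_def by linarith
      moreover have "\<bar>c t * (sqrt t * S t x) - \<gamma> t v\<bar> \<le> 6 * l / L" using \<gamma>(1)[OF t, of n v] unfolding xt t_def by simp
      moreover have "D / L = 20 * real (r + s + 2) / L + 6 * l / L" unfolding D_def by (simp add: add_divide_distrib)
      ultimately show ?thesis by linarith
    qed
    have DL: "D / L \<le> D" using D L4 by (simp add: divide_le_eq mult_le_cancel_left1)
    have y1: "\<bar>y\<bar> \<le> 1 + D" using yb DL \<gamma>(2)[of t v] by linarith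
    have \<kappa>1: "\<bar>\<kappa> - 1\<bar> \<le> C2 / L"
    proof -
      define u where "u = ln_qcoeff r s \<alpha> \<beta> e - \<Lambda>"
      have u: "\<bar>u\<bar> \<le> C1 * e" unfolding u_def \<Lambda>_def by (rule C1(2)[OF e(1)])
      have u1: "C1 * e \<le> C1 * 1" using C1 e by (intro mult_left_mono) auto
      have "\<bar>\<kappa> - 1\<bar> \<le> \<bar>u\<bar> * exp \<bar>u\<bar>" unfolding \<kappa>_def u_def[symmetric] by (rule abs_exp_minus_one_le)
      also have "\<dots> \<le> (C1 * e) * exp C1" using u u1 C1 e by (intro mult_mono) auto
      also have "\<dots> \<le> (C1 * (4 / L)) * exp C1" using e C1 by (intro mult_right_mono mult_left_mono) auto
      finally show ?thesis unfolding C2_def by simp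
    qed
    \<comment> \<open>Separates the error of the constant, which multiplies the bounded y, from the
      error of the sum.\<close>
    have "\<bar>\<kappa> * y - \<gamma> t v\<bar> \<le> \<bar>\<kappa> - 1\<bar> * \<bar>y\<bar> + \<bar>y - \<gamma> t v\<bar>"
    proof -
      have "\<kappa> * y - \<gamma> t v = (\<kappa> - 1) * y + (y - \<gamma> t v)" by (simp add: algebra_simps)
      then show ?thesis unfolding abs_mult[symmetric] by (simp only: abs_triangle_ineq)
    qed
    also have "\<dots> \<le> (C2 / L) * (1 + D) + D / L"
      using \<kappa>1 y1 yb C2 L4 by (intro add_mono mult_mono) auto
    also have "\<dots> = (C2 * (1 + D) + D) * inverse L" by (simp add: divide_inverse algebra_simps)
    finally have "\<bar>c t * H / leading_term r s \<alpha> \<beta> l \<rho> L v n - \<gamma> t v\<bar> \<le> (C2 * (1 + D) + D) * inverse L"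
      unfolding ratio .
    then show ?thesis unfolding H_def t_def e_def .
  qed
  show ?thesis
  proof (intro exI allI impI ballI)
    fix n v assume "n \<ge> N" "v \<in> V"
    with N[of n] show "\<bar>c (l / lam n) * basic_hypergeometric r s (\<lambda>j. exp (- (pi / lam n) * \<alpha> j)) (\<lambda>k. exp (- (pi / lam n) * \<beta> k)) (exp (- (pi / lam n)))
      (\<tau> * exp (2 * pi * v) * exp (- (pi / lam n)) powr (- l * (4 * real n - 1))) / leading_term r s \<alpha> \<beta> l \<rho> (lam n) v n - \<gamma> (l / lam n) v\<bar>
     \<le> (C2 * (1 + D) + D) * inverse (lam n)"
      by (intro main) auto
  qed
qed

section \<open>The plain and the alternating expansion\<close>

theorem corollary5:
  fixes lam :: "nat \<Rightarrow> real" and r s :: nat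
    and \<alpha> \<beta> :: "nat \<Rightarrow> real" and l \<rho> :: real
    and z :: "real \<Rightarrow> real" and q :: "nat \<Rightarrow> real"
  assumes "admissible_scale lam"
    and "l = (real s + 1 - real r) / 2" and "l > 0"
    and "\<And>j. 1 \<le> j \<Longrightarrow> j \<le> r \<Longrightarrow> \<alpha> j > 0"
    and "\<And>k. 1 \<le> k \<Longrightarrow> k \<le> s \<Longrightarrow> \<beta> k > 0"
    and "\<rho> = (\<Sum>j=1..r. \<alpha> j) - (\<Sum>k=1..s. \<beta> k) - 1"
    and "\<And>v. z v = exp (2 * pi * v)"
    and "\<And>n. q n = exp (- pi * inverse (lam n))"
  shows
    "(\<exists>E. bigo_unif_on_compacts E (\<lambda>n. inverse (lam n)) \<and>
        (\<forall>n\<ge>1. \<forall>v.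
          basic_hypergeometric r s (\<lambda>j. q n powr \<alpha> j) (\<lambda>k. q n powr \<beta> k) (q n)
            ((- 1) powi (int s + 1 - int r) * z v * q n powr (- l * (4 * real n - 1)))
          = (\<Prod>k=1..s. Gamma (\<beta> k)) / (\<Prod>j=1..r. Gamma (\<alpha> j))
            * (lam n powr (\<rho> + l + 1 / 2) / (sqrt l * 2 powr l * pi powr (\<rho> + 2 * l)))
            * exp (pi * lam n / l * (v + 2 * real n * l / lam n)\<^sup>2 + l * pi * lam n / 3)
            * (1 + E n v)))
     \<and>
     (\<exists>E. bigo_unif_on_compacts E (\<lambda>n. inverse (lam n)) \<and>
        (\<forall>n\<ge>1. \<forall>v.
          basic_hypergeometric r s (\<lambda>j. q n powr \<alpha> j) (\<lambda>k. q n powr \<beta> k) (q n)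
            ((- 1) powi (int s - int r) * z v * q n powr (- l * (4 * real n - 1)))
          = (\<Prod>k=1..s. Gamma (\<beta> k)) / (\<Prod>j=1..r. Gamma (\<alpha> j))
            * (lam n powr (\<rho> + l + 1 / 2) / (sqrt l * 2 powr (l - 1) * pi powr (\<rho> + 2 * l)))
            * exp (pi * lam n / l * (v + 2 * real n * l / lam n)\<^sup>2 + l * pi * lam n / 3
                   - pi * lam n / (4 * l))
            * (cos (pi * lam n * v / l) + E n v)))"
proof -
  have \<alpha>: "\<And>j. j \<in> {1..r} \<Longrightarrow> \<alpha> j > 0" and \<beta>: "\<And>j. j \<in> {1..s} \<Longrightarrow> \<beta> j > 0"
    using assms(4,5) by auto
  have lam: "lam n > 0" if "n \<ge> 1" for n using assms(1) that unfolding admissible_scale_def by blast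
  define H where "H = (\<lambda>\<tau> n v. basic_hypergeometric r s (\<lambda>j. exp (- (pi / lam n) * \<alpha> j)) (\<lambda>k. exp (- (pi / lam n) * \<beta> k)) (exp (- (pi / lam n)))
      (\<tau> * exp (2 * pi * v) * exp (- (pi / lam n)) powr (- l * (4 * real n - 1))))"
  have q: "q n = exp (- (pi / lam n))" for n unfolding assms(8) by (simp add: divide_inverse)
  have qp: "q n powr a = exp (- (pi / lam n) * a)" for n a unfolding q by (simp add: powr_def)
  have H_eq: "basic_hypergeometric r s (\<lambda>j. q n powr \<alpha> j) (\<lambda>k. q n powr \<beta> k) (q n) (\<tau> * z v * q n powr (- l * (4 * real n - 1))) = H \<tau> n v" for \<tau> n v
  proof -
    have "(\<lambda>j. q n powr \<alpha> j) = (\<lambda>j. exp (- (pi / lam n) * \<alpha> j))" "(\<lambda>k. q n powr \<beta> k) = (\<lambda>k. exp (- (pi / lam n) * \<beta> k))"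
      by (simp_all only: qp)
    then show ?thesis unfolding H_def assms(7) q by (simp only:)
  qed
  define F where "F = (\<lambda>n v. leading_term r s \<alpha> \<beta> l \<rho> (lam n) v n)"
  have F: "F n v > 0" if "n \<ge> 1" for n v
  proof -
    have "(\<Prod>k=1..s. Gamma (\<beta> k)) > 0" "(\<Prod>j=1..r. Gamma (\<alpha> j)) > 0"
      using \<alpha> \<beta> by (auto intro!: prod_pos Gamma_real_pos)
    then show ?thesis unfolding F_def leading_term_def using lam[OF that] assms(3)
      by (intro mult_pos_pos divide_pos_pos) auto
  qed
  have even_sum: "((\<lambda>k::int. 1 * exp (- pi * t * (of_int k - x)\<^sup>2)) has_sum (dual_theta t x / sqrt t)) UNIV" if "t > 0" for t x
    using gaussian_poisson[OF that] by simp
  have pw: "(- 1 :: real) powi (int k * m) = ((- 1) powi m) ^ k" for k :: nat and m :: int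
    by (simp only: mult.commute[of "int k"] power_int_mult power_int_of_nat)
  show ?thesis
  proof (rule conjI, goal_cases)
    case 1
    \<comment> \<open>The leading term is positive, so the claimed equation can be solved for E;
      what remains is the uniform bound.\<close>
    define E where "E = (\<lambda>n v. H ((- 1) powi (int s + 1 - int r)) n v / F n v - 1)"
    have "bigo_unif_on_compacts E (\<lambda>n. inverse (lam n))"
      unfolding bigo_unif_on_compacts_def
    proof (intro allI impI)
      fix V :: "real set" assume V: "compact V"
      have "\<exists>C N. \<forall>n\<ge>N. \<forall>v\<in>V. \<bar>1 * H ((- 1) powi (int s + 1 - int r)) n v / F n v - 1\<bar> \<le> C * inverse (lam n)"
        unfolding H_def F_def
      proof (rule basic_hypergeometric_asymp[where c = "\<lambda>_. 1" and \<gamma> = "\<lambda>_ _. 1" and \<sigma> = 1 and \<sigma>' = "\<lambda>_. 1" and S = "\<lambda>t x. dual_theta t x / sqrt t"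
            and lam = lam and l = l and r = r and s = s and \<alpha> = \<alpha> and \<beta> = \<beta> and \<rho> = \<rho> and V = V and \<tau> = "(- 1) powi (int s + 1 - int r)"])
        fix k :: nat
        show "((- 1) powi (int s + 1 - int r)) ^ k / (- 1) powi (int k * (int s + 1 - int r)) = (1::real) ^ k"
          unfolding pw by simp
      next
        fix t v :: real and n :: nat assume t: "0 < t" "t \<le> 1"
        have "\<bar>sqrt t * (dual_theta t (2 * real n + v / t) / sqrt t) - 1\<bar> \<le> 6 * exp (- (pi / t))"
          using gaussian_sum_approx[OF t gaussian_poisson[OF t(1)]] by simp
        also have "exp (- (pi / t)) \<le> 1 / (pi / t)" using t by (intro exp_neg_le_inverse) auto
        also have "1 / (pi / t) \<le> t" using t pi_ge_two by (simp add: divide_le_eq mult_le_cancel_left1)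
        finally show "\<bar>1 * (sqrt t * (dual_theta t (2 * real n + v / t) / sqrt t)) - 1\<bar> \<le> 6 * t" by simp
      qed (rule assms(1-3,6) V | erule \<alpha> | erule \<beta> | rule even_sum, assumption | simp)+
      then show "\<exists>C N. \<forall>n\<ge>N. \<forall>v\<in>V. \<bar>E n v\<bar> \<le> C * inverse (lam n)" unfolding E_def by simp
    qed
    moreover have "H ((- 1) powi (int s + 1 - int r)) n v = F n v * (1 + E n v)" if "n \<ge> 1" for n v
      unfolding E_def using F[OF that, of v] by simp
    ultimately show ?case unfolding H_eq unfolding F_def leading_term_def by blast
  next
    case 2
    define E where "E = (\<lambda>n v. exp (pi / (4 * (l / lam n))) / 2 * H ((- 1) powi (int s - int r)) n v / F n v - cos (pi * v / (l / lam n)))"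
    define S where "S = (\<lambda>t x. (dual_theta (4 * t) (x / 2) - dual_theta t x) / sqrt t)"
    have "bigo_unif_on_compacts E (\<lambda>n. inverse (lam n))"
      unfolding bigo_unif_on_compacts_def
    proof (intro allI impI)
      fix V :: "real set" assume V: "compact V"
      show "\<exists>C N. \<forall>n\<ge>N. \<forall>v\<in>V. \<bar>E n v\<bar> \<le> C * inverse (lam n)"
        unfolding H_def F_def E_def
      proof (rule basic_hypergeometric_asymp[where c = "\<lambda>t. exp (pi / (4 * t)) / 2" and \<gamma> = "\<lambda>t v. cos (pi * v / t)"
            and \<sigma> = "- 1" and \<sigma>' = "\<lambda>k. if even k then 1 else - 1" and S = S
            and lam = lam and l = l and r = r and s = s and \<alpha> = \<alpha> and \<beta> = \<beta> and \<rho> = \<rho> and V = V and \<tau> = "(- 1) powi (int s - int r)"])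
        fix k :: nat
        \<comment> \<open>The argument has one sign less than the series divides out, so (- 1)^k
          survives.\<close>
        have "(- 1) powi (int s + 1 - int r) = (- 1) powi (int s - int r) * (- 1 :: real)"
        proof -
          have "int s + 1 - int r = (int s - int r) + 1" by simp
          then show ?thesis by (simp only: power_int_add_1 neg_equal_0_iff_equal one_neq_zero not_False_eq_True simp_thms)
        qed
        moreover have "a / (a * - 1) = - 1" if "a \<noteq> 0" for a :: real using that by simp
        ultimately show "((- 1) powi (int s - int r)) ^ k / (- 1) powi (int k * (int s + 1 - int r)) = (- 1 :: real) ^ k"
          unfolding pw power_divide[symmetric] by (simp only: power_int_eq_0_iff neg_equal_0_iff_equal one_neq_zero simp_thms)
      next
        fix t x :: real assume "0 < t" "t \<le> 1"
        then show "((\<lambda>k::int. (if even k then 1 else - 1) * exp (- pi * t * (of_int k - x)\<^sup>2)) has_sum S t x) UNIV"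
          unfolding S_def by (intro alternating_gaussian_sum)
      next
        fix t v :: real and n :: nat assume t: "0 < t" "t \<le> 1"
        define x where "x = 2 * real n + v / t"
        define m where "m = exp (pi / (4 * t))"
        have m: "m > 0" unfolding m_def by simp
        have me: "m * exp (- pi / (4 * t)) = 1" unfolding m_def by (simp add: exp_add[symmetric])
        \<comment> \<open>The centre is shifted by the even integer 2 n, hence n drops out of the
          cosine.\<close>
        have "pi * x = pi * v / t + 2 * pi * real n" unfolding x_def by (simp add: algebra_simps)
        then have cx: "cos (pi * x) = cos (pi * v / t)" 
          using cos_int_2pin[of "int n"] sin_int_2pin[of "int n"] by (simp add: cos_add)
        have "\<bar>sqrt t * S t x - 2 * exp (- pi / (4 * t)) * cos (pi * x)\<bar> \<le> 12 * exp (- pi / t)"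
          using alternating_gaussian_sum_approx[OF t alternating_gaussian_sum[OF t(1)]] unfolding S_def .
        then have "m / 2 * \<bar>sqrt t * S t x - 2 * exp (- pi / (4 * t)) * cos (pi * x)\<bar> \<le> m / 2 * (12 * exp (- pi / t))"
          using m by (intro mult_left_mono) auto
        also have "m / 2 * \<bar>sqrt t * S t x - 2 * exp (- pi / (4 * t)) * cos (pi * x)\<bar> = \<bar>m / 2 * (sqrt t * S t x) - (m * exp (- pi / (4 * t))) * cos (pi * x)\<bar>"
        proof -
          have eq: "m / 2 * (sqrt t * S t x) - (m * exp (- pi / (4 * t))) * cos (pi * x) = m / 2 * (sqrt t * S t x - 2 * exp (- pi / (4 * t)) * cos (pi * x))"
            by (simp add: algebra_simps)
          show ?thesis unfolding eq abs_mult using m by simp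
        qed
        \<comment> \<open>The rescaling by m uses up a quarter of the exponent pi / t; three
          quarters are left, far more than the order t requires.\<close>
        also have "m / 2 * (12 * exp (- pi / t)) = 6 * exp (- (3 * pi / (4 * t)))"
        proof -
          have "pi / (4 * t) + - pi / t = - (3 * pi / (4 * t))" using t by (simp add: field_simps)
          then have "m * exp (- pi / t) = exp (- (3 * pi / (4 * t)))" unfolding m_def exp_add[symmetric] by (rule arg_cong)
          then show ?thesis by simp
        qed
        also have "exp (- (3 * pi / (4 * t))) \<le> 1 / (3 * pi / (4 * t))" using t by (intro exp_neg_le_inverse) auto
        also have "1 / (3 * pi / (4 * t)) \<le> t" using t pi_ge_two by (simp add: divide_le_eq mult_le_cancel_left1)
        finally have "\<bar>m / 2 * (sqrt t * S t x) - (m * exp (- pi / (4 * t))) * cos (pi * x)\<bar> \<le> 6 * t" by simp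
        then have "\<bar>m / 2 * (sqrt t * S t x) - cos (pi * v / t)\<bar> \<le> 6 * t" by (simp only: me cx mult_1)
        then show "\<bar>exp (pi / (4 * t)) / 2 * (sqrt t * S t (2 * real n + v / t)) - cos (pi * v / t)\<bar> \<le> 6 * t"
          unfolding m_def x_def .
      qed (rule assms(1-3,6) V | erule \<alpha> | erule \<beta> | simp add: minus_one_power_iff)+
    qed
    moreover have "H ((- 1) powi (int s - int r)) n v
       = (\<Prod>k=1..s. Gamma (\<beta> k)) / (\<Prod>j=1..r. Gamma (\<alpha> j))
            * (lam n powr (\<rho> + l + 1 / 2) / (sqrt l * 2 powr (l - 1) * pi powr (\<rho> + 2 * l)))
            * exp (pi * lam n / l * (v + 2 * real n * l / lam n)\<^sup>2 + l * pi * lam n / 3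
                   - pi * lam n / (4 * l))
            * (cos (pi * lam n * v / l) + E n v)" if n: "n \<ge> 1" for n v
    proof -
      have "pi / (4 * (l / lam n)) = pi * lam n / (4 * l)" "pi * v / (l / lam n) = pi * lam n * v / l"
        using lam[OF n] by (simp_all add: field_simps)
      then have "cos (pi * lam n * v / l) + E n v = exp (pi * lam n / (4 * l)) / 2 * H ((- 1) powi (int s - int r)) n v / F n v"
        unfolding E_def by (simp only: diff_add_cancel add_diff_cancel_left' diff_add_eq add_diff_eq)
      \<comment> \<open>The second prefactor is the first one times 2 exp (- pi \<lambda> / (4 l)),
        the 2 coming from the power l - 1; its inverse is the factor c.\<close>
      moreover have "(\<Prod>k=1..s. Gamma (\<beta> k)) / (\<Prod>j=1..r. Gamma (\<alpha> j))
            * (lam n powr (\<rho> + l + 1 / 2) / (sqrt l * 2 powr (l - 1) * pi powr (\<rho> + 2 * l)))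
            * exp (pi * lam n / l * (v + 2 * real n * l / lam n)\<^sup>2 + l * pi * lam n / 3
                   - pi * lam n / (4 * l)) = F n v * (2 / exp (pi * lam n / (4 * l)))"
        unfolding F_def leading_term_def exp_diff by (simp add: powr_diff)
      ultimately show ?thesis using F[OF n, of v] by simp
    qed
    ultimately show ?case unfolding H_eq by blast
  qed
qed

end
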